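(* Let $X=(X_t,\,t\in[0,1])$ be an extremal exchangeable increment process with deterministic characteristics $(\alpha,\sigma,\beta)$, defined on a probability space $(\Omega,\mathcal{F},\mathbb{P})$. Then, for all $t\in[0,1]$ and $\theta\in\mathbb{R}$, $$\mathbb{E}\left(e^{\theta X_t}\right)=e^{\alpha\theta t+\theta^2\sigma^2t(1-t)/2}\prod_{j=1}^\infty\left[e^{-\theta\beta_jt}(1-t)+e^{\theta\beta_j(1-t)}t\right]<\infty.$$ Fix $T\in(0,1)$ and $\theta\in\mathbb{R}$, let $\mathcal{F}_t=\sigma(X_s:s\le t)$ and define $\mathbb{Q}$ on $\mathcal{F}_T$ by $$\mathbb{Q}(A)=\frac{\mathbb{E}_{\mathbb{P}}\left(\mathbf{1}_Ae^{\theta X_T}\right)}{\mathbb{E}_{\mathbb{P}}\left(e^{\theta X_T}\right)}.$$ Under $\mathbb{Q}$, the stochastic process $(X_t,\,t\le T)$ is an exchangeable increment process whose (random) characteristics $(\alpha^\theta,\sigma,\beta^\theta)$ have the following law. Let $(B_j)_{j\ge 1}$ be independent Bernoulli random variables with respective parameters $$p_j=\frac{Te^{\theta\beta_j}}{Te^{\theta\beta_j}+(1-T)}.$$ Then $$\alpha^\theta=\alpha T+\theta\sigma+\sum_j\beta_j[B_j-T]\quad\text{and}\quad\beta^\theta_j=\beta_jB_j,$$ where $\sum_j\beta_j[B_j-T]$ converges almost surely and in $L_1$. If $\alpha=0$ and either $\sigma>0$ or $\sum_i\mathbf{1}_{\{\beta_i\ne0\}}=\infty$, then for every $t\in(0,1)$,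 $\mathbb{E}(e^{\lambda X_t})\to\infty$ as $\lambda\to\infty$.
   Context: An extremal exchangeable increment (EI) process with deterministic characteristics (parameters) $(\alpha,\sigma,\beta)$, where $\alpha\in\mathbb{R}$, $\sigma\ge 0$ and $\beta=(\beta_i)_{i\ge 1}$ is a real sequence with $\sum_i\beta_i^2<\infty$, is the càdlàg process $$X_t=\alpha t+\sigma b_t+\sum_{i\ge 1}\beta_i\left[\mathbf{1}_{\{U_i\le t\}}-t\right],\qquad t\in[0,1],$$ where $(U_i)_{i\ge1}$ are i.i.d. uniform random variables on $(0,1)$ and $b$ is an independent standard Brownian bridge on $[0,1]$. A process on $[0,T]$ is an EI process with random characteristics $(a,s,(c_j)_j)$ if it has the same law as $$t\mapsto a\frac{t}{T}+s\,b_{t/T}+\sum_jc_j\left[\mathbf{1}_{\{U_j\le t/T\}}-\frac{t}{T}\right],\qquad t\in[0,T],$$ where $(a,s,(c_j)_j)$ is independent of $(b,(U_j)_j)$, $b$ is a standard Brownian bridge on $[0,1]$, and $(U_j)$ are i.i.d. uniform on $(0,1)$ independent of $b$.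
   Formalization: The printed tilted law fails for every σ>0. The drift term θσ is replaced by θσ²T(1−T)+σ√(T(1−T))Z, with Z standard normal independent of (B_j), and the second characteristic σ by σ√T. For σ=0 it is the printed law. *)

theory Defs
  imports "HOL-Probability.Probability"
begin

section \<open>Independence\<close>

text \<open>The library's \<open>indep_var\<close> needs both random variables to have values in the same type.\<close>

definition indep_rvs ::
    "'w measure \<Rightarrow> 'c measure \<Rightarrow> ('w \<Rightarrow> 'c) \<Rightarrow> 'd measure \<Rightarrow> ('w \<Rightarrow> 'd) \<Rightarrow> bool" where
  "indep_rvs M S f R g \<longleftrightarrow>
     f \<in> measurable M S \<and> g \<in> measurable M R \<and>
     prob_space.indep_set M
       {f -` A \<inter> space M | A. A \<in> sets S} {g -` A \<inter> space M | A. A \<in> sets R}"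


section \<open>Brownian bridge and uniform jump times\<close>

text \<open>The normal law with variance 0 is the point mass at 0.\<close>

definition centered_normal :: "'w measure \<Rightarrow> ('w \<Rightarrow> real) \<Rightarrow> real \<Rightarrow> bool" where
  "centered_normal M Y v \<longleftrightarrow>
     Y \<in> borel_measurable M \<and>
     (if v = 0 then AE \<omega> in M. Y \<omega> = 0
      else 0 < v \<and> distributed M lborel Y (\<lambda>x. ennreal (normal_density 0 (sqrt v) x)))"

definition brownian_bridge :: "'w measure \<Rightarrow> (real \<Rightarrow> 'w \<Rightarrow> real) \<Rightarrow> bool" where
  "brownian_bridge M b \<longleftrightarrow>
     (\<forall>t\<in>{0..1}. b t \<in> borel_measurable M) \<and>
     (\<forall>\<omega>\<in>space M. continuous_on {0..1} (\<lambda>t. b t \<omega>)) \<and>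
     (\<forall>F c. finite F \<and> F \<subseteq> {0..1} \<longrightarrow>
        centered_normal M (\<lambda>\<omega>. \<Sum>t\<in>F. c t * b t \<omega>)
          (\<Sum>s\<in>F. \<Sum>t\<in>F. c s * c t * (min s t - s * t)))"

definition bridge_and_uniforms ::
    "'w measure \<Rightarrow> (real \<Rightarrow> 'w \<Rightarrow> real) \<Rightarrow> (nat \<Rightarrow> 'w \<Rightarrow> real) \<Rightarrow> bool" where
  "bridge_and_uniforms M b U \<longleftrightarrow>
     brownian_bridge M b \<and>
     prob_space.indep_vars M (\<lambda>_. borel) U UNIV \<and>
     (\<forall>i. distr M borel (U i) = uniform_measure lborel {0<..<1}) \<and>
     indep_rvs M
       (PiM {0..1} (\<lambda>_. borel)) (\<lambda>\<omega>. \<lambda>t\<in>{0..1}. b t \<omega>)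
       (PiM UNIV (\<lambda>_. borel)) (\<lambda>\<omega> i. U i \<omega>)"


section \<open>Exchangeable increment processes\<close>

text \<open>
  For each fixed time the series is required to converge almost surely, in its natural order; the
  null set may depend on the time. Together with regularity of the paths this determines the
  process up to indistinguishability. Sequences are indexed from 0 rather than from 1.
\<close>

definition ei_series ::
    "'w measure \<Rightarrow> real \<Rightarrow> ('w \<Rightarrow> real) \<Rightarrow> ('w \<Rightarrow> real) \<Rightarrow> (nat \<Rightarrow> 'w \<Rightarrow> real) \<Rightarrow>
     (real \<Rightarrow> 'w \<Rightarrow> real) \<Rightarrow> (nat \<Rightarrow> 'w \<Rightarrow> real) \<Rightarrow> (real \<Rightarrow> 'w \<Rightarrow> real) \<Rightarrow> bool" where
  "ei_series M T a s c b U X \<longleftrightarrow>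
     (\<forall>t\<in>{0..T}. X t \<in> borel_measurable M \<and>
        (AE \<omega> in M.
           (\<lambda>j. c j \<omega> * (of_bool (U j \<omega> \<le> t / T) - t / T)) sums
             (X t \<omega> - (a \<omega> * (t / T) + s \<omega> * b (t / T) \<omega>))))"

definition cadlag_on_unit :: "(real \<Rightarrow> real) \<Rightarrow> bool" where
  "cadlag_on_unit f \<longleftrightarrow>
     (\<forall>t. 0 \<le> t \<and> t < 1 \<longrightarrow> (f \<longlongrightarrow> f t) (at_right t)) \<and>
     (\<forall>t. 0 < t \<and> t \<le> 1 \<longrightarrow> (\<exists>l. (f \<longlongrightarrow> l) (at_left t)))"

definition extremal_ei_process ::
    "'w measure \<Rightarrow> real \<Rightarrow> real \<Rightarrow> (nat \<Rightarrow> real) \<Rightarrow> (real \<Rightarrow> 'w \<Rightarrow> real) \<Rightarrow> bool" where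
  "extremal_ei_process M \<alpha> \<sigma> \<beta> X \<longleftrightarrow>
     0 \<le> \<sigma> \<and> summable (\<lambda>i. (\<beta> i)\<^sup>2) \<and>
     (\<forall>\<omega>\<in>space M. cadlag_on_unit (\<lambda>t. X t \<omega>)) \<and>
     (\<exists>b U. bridge_and_uniforms M b U \<and>
        ei_series M 1 (\<lambda>_. \<alpha>) (\<lambda>_. \<sigma>) (\<lambda>i _. \<beta> i) b U X)"

text \<open>The law, on the product \<open>\<sigma>\<close>-algebra, of a process with time set \<open>{0..T}\<close>.\<close>

definition path_law ::
    "'w measure \<Rightarrow> real \<Rightarrow> (real \<Rightarrow> 'w \<Rightarrow> real) \<Rightarrow> (real \<Rightarrow> real) measure" where
  "path_law M T X = distr M (PiM {0..T} (\<lambda>_. borel)) (\<lambda>\<omega>. \<lambda>t\<in>{0..T}. X t \<omega>)"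

abbreviation char_space :: "(real \<times> real \<times> (nat \<Rightarrow> real)) measure" where
  "char_space \<equiv> borel \<Otimes>\<^sub>M borel \<Otimes>\<^sub>M PiM UNIV (\<lambda>_. borel)"

text \<open>
  \<open>\<kappa>\<close> is the joint law of the random characteristics \<open>(a, s, (c\<^sub>j)\<^sub>j)\<close>. An existential
  quantifier in a definition cannot range over types, so the auxiliary probability space lives on
  the canonical sample type: characteristics, uniforms, bridge path. This is no restriction, since
  every realisation can be pushed forward to that type.
\<close>

type_synonym ei_sample = "(real \<times> real \<times> (nat \<Rightarrow> real)) \<times> (nat \<Rightarrow> real) \<times> (real \<Rightarrow> real)"

definition ei_process ::
    "'w measure \<Rightarrow> real \<Rightarrow> (real \<Rightarrow> 'w \<Rightarrow> real) \<Rightarrow>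
     (real \<times> real \<times> (nat \<Rightarrow> real)) measure \<Rightarrow> bool" where
  "ei_process Q T X \<kappa> \<longleftrightarrow>
     (\<exists>(N :: ei_sample measure) a s c b U Y.
        prob_space N \<and>
        bridge_and_uniforms N b U \<and>
        indep_rvs N
          char_space (\<lambda>\<omega>. (a \<omega>, s \<omega>, \<lambda>j. c j \<omega>))
          (PiM {0..1} (\<lambda>_. borel) \<Otimes>\<^sub>M PiM UNIV (\<lambda>_. borel))
          (\<lambda>\<omega>. (\<lambda>t\<in>{0..1}. b t \<omega>, \<lambda>i. U i \<omega>)) \<and>
        distr N char_space (\<lambda>\<omega>. (a \<omega>, s \<omega>, \<lambda>j. c j \<omega>)) = \<kappa> \<and>
        ei_series N T a s c b U Y \<and>
        path_law Q T X = path_law N T Y)"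


section \<open>Exponential change of measure\<close>

definition past :: "'w measure \<Rightarrow> (real \<Rightarrow> 'w \<Rightarrow> real) \<Rightarrow> real \<Rightarrow> 'w set set" where
  "past M X T =
     sigma_sets (space M) {X s -` A \<inter> space M | s A. s \<in> {0..T} \<and> A \<in> sets borel}"

definition tilted_measure ::
    "'w measure \<Rightarrow> (real \<Rightarrow> 'w \<Rightarrow> real) \<Rightarrow> real \<Rightarrow> real \<Rightarrow> 'w measure" where
  "tilted_measure M X T \<theta> =
     measure_of (space M) (past M X T)
       (\<lambda>A. ennreal ((\<integral>\<omega>. indicator A \<omega> * exp (\<theta> * X T \<omega>) \<partial>M) / (\<integral>\<omega>. exp (\<theta> * X T \<omega>) \<partial>M)))"

definition tilted_success_prob :: "real \<Rightarrow> real \<Rightarrow> real \<Rightarrow> real" where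
  "tilted_success_prob T \<theta> x = T * exp (\<theta> * x) / (T * exp (\<theta> * x) + (1 - T))"

text \<open>
  The Gaussian part of the characteristics of the tilted process. Under the tilt by
  \<open>exp (\<theta> * X T)\<close> the process \<open>\<sigma> * b t\<close> keeps its covariance \<open>\<sigma>\<^sup>2 * (min s t - s * t)\<close> and acquires
  the mean \<open>\<theta> * \<sigma>\<^sup>2 * t * (1 - T)\<close>. Write \<open>b'\<close> for a standard bridge on the unit interval. As
    \<open>s - s * t = T * (s / T - (s / T) * (t / T)) + T * (1 - T) * (s / T) * (t / T)\<close>,
  on \<open>{0..T}\<close> the process is, in law,
    \<open>(\<theta> * \<sigma>\<^sup>2 * T * (1 - T) + \<sigma> * sqrt (T * (1 - T)) * Z) * (t / T) + \<sigma> * sqrt T * b' (t / T)\<close>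
  with \<open>Z\<close> standard normal and independent of \<open>b'\<close>. Taking instead the characteristics
  \<open>\<alpha> * T + \<theta> * \<sigma> + (\<Sum>j. \<beta> j * (B j - T))\<close> and \<open>\<sigma>\<close> is correct only if \<open>\<sigma> = 0\<close>: for
  \<open>\<theta> = 0\<close>, \<open>\<alpha> = 0\<close>, \<open>\<beta> = 0\<close> they would force \<open>\<sigma> * b T\<close> to vanish.
\<close>

definition tilted_drift ::
    "real \<Rightarrow> real \<Rightarrow> (nat \<Rightarrow> real) \<Rightarrow> real \<Rightarrow> real \<Rightarrow> (nat \<Rightarrow> 'v \<Rightarrow> bool) \<Rightarrow> ('v \<Rightarrow> real) \<Rightarrow> 'v \<Rightarrow> real"
  where
  "tilted_drift \<alpha> \<sigma> \<beta> T \<theta> B Z \<omega> =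
     \<alpha> * T + (\<theta> * \<sigma>\<^sup>2 * T * (1 - T) + \<sigma> * sqrt (T * (1 - T)) * Z \<omega>)
       + (\<Sum>j. \<beta> j * (of_bool (B j \<omega>) - T))"

end

theory Submission
  imports Defs
begin

text \<open>
  The process is built from independent ingredients, the bridge \<open>b\<close> and the jump times \<open>U j\<close>, and
  \<open>exp (\<theta> * X T)\<close> is a product of functions of the single ingredients, namely of
  \<open>exp (\<theta> * \<sigma> * b T)\<close> and of \<open>exp (\<theta> * \<beta> j * (1{U j \<le> T} - T))\<close>. So its expectation is a product, and
  tilting by it tilts every ingredient separately and keeps them independent.

  Tilting \<open>U j\<close> gives the event \<open>U j \<le> T\<close> the probability \<open>p j\<close> of the Bernoulli variable \<open>B j\<close>, and
  leaves the conditional law given this event unchanged: it is uniform on \<open>(0, T)\<close>, the law of \<open>T * V\<close>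
  for a uniform \<open>V\<close> (\<open>expectation_unif_tilted\<close>). Tilting the Gaussian process \<open>\<sigma> * b\<close> only shifts its
  mean (\<open>bridge_tilted_char\<close>); its covariance on \<open>[0, T]\<close> is that of a bridge of length \<open>T\<close> plus an
  independent Gaussian drift. The identity
    \<open>\<beta> * (B * 1{V \<le> t / T} - t) = \<beta> * (B - T) * (t / T) + \<beta> * B * (1{V \<le> t / T} - t / T)\<close>
  then shows which part of a jump goes into the drift and which part is a jump of the new process.

  Two processes have the same law if all finite linear combinations of their values have the same
  characteristic functions (\<open>process_law_eq_of_char_eq\<close>). For partial sums of the two series the
  characteristic functions are explicit finite products, and they agree (\<open>partial_ei_tilted_char\<close>,
  \<open>partial_tilted_char\<close>). It remains to let the number of terms go to infinity.
  On the side of the tilted process this needs uniform integrability of the exponentials of the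
  partial sums. Each jump contributes a factor between 1 and \<open>1 + (\<theta> * \<beta> j)\<^sup>2\<close> to the moments, for all
  but finitely many \<open>j\<close>, so the products are bounded for every \<open>\<theta>\<close>; the bound at \<open>2 * \<theta>\<close> is a bound in \<open>L\<^sup>2\<close>
  for the exponentials at \<open>\<theta>\<close>, and \<open>L1_limit_of_L2_bounded\<close> applies. On the other side the integrands
  are bounded, and what has to be shown is the almost sure convergence of the series with the thinned
  jumps \<open>\<beta> j * B j\<close>. It follows from Kolmogorov's theorem on series with summable variances
  (\<open>AE_summable_of_summable_variances\<close>).

  For \<open>\<alpha> = 0\<close> all factors of the exponential moment are at least 1, so the moment is bounded below by
  any one of them; at a time strictly between 0 and 1, each nontrivial factor tends to infinity with \<open>\<theta>\<close>.
\<close>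

section \<open>Limits of expectations under a second moment bound\<close>

text \<open>
  For a nonnegative \<open>d\<close> and a level \<open>K\<close> one has \<open>d \<le> min d K + d\<^sup>2 / K\<close>. With \<open>d\<close> the norm of
  \<open>f n - g\<close>, the first term has vanishing integral by bounded convergence, and the integral of the
  second is at most a constant over \<open>K\<close>. The limit \<open>g\<close> inherits the second moment bound by Fatou's lemma.
\<close>

lemma L1_limit_of_L2_bounded:
  fixes f :: "nat \<Rightarrow> 'w \<Rightarrow> 'b::{banach, second_countable_topology}"
  assumes M: "finite_measure M"
    and f [measurable]: "\<And>n. f n \<in> borel_measurable M" and g [measurable]: "g \<in> borel_measurable M"
    and lim: "AE w in M. (\<lambda>n. f n w) \<longlonglongrightarrow> g w"
    and int: "\<And>n. integrable M (\<lambda>w. (norm (f n w))\<^sup>2)"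
    and bound: "\<And>n. (\<integral>w. (norm (f n w))\<^sup>2 \<partial>M) \<le> C"
  shows "integrable M g" "(\<lambda>n. \<integral>w. norm (f n w - g w) \<partial>M) \<longlonglongrightarrow> 0"
    "(\<lambda>n. \<integral>w. f n w \<partial>M) \<longlonglongrightarrow> (\<integral>w. g w \<partial>M)"
proof -
  interpret finite_measure M by (rule M)
  have C: "0 \<le> C"
    using bound[of 0] integral_nonneg_AE[of "\<lambda>w. (norm (f 0 w))\<^sup>2" M] by (smt (verit) AE_I2 zero_le_power2)
  have L1: "integrable M h" if [measurable]: "h \<in> borel_measurable M" and h: "integrable M (\<lambda>w. (norm (h w))\<^sup>2)"
    for h :: "'w \<Rightarrow> 'b"
  proof (rule Bochner_Integration.integrable_bound)
    show "integrable M (\<lambda>w. 1 + (norm (h w))\<^sup>2)" using h by simp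
    have "x \<le> 1 + x\<^sup>2" for x :: real
      using sum_squares_bound[of x "1/2"] zero_le_power2[of "x - 1"] by (simp add: power2_eq_square algebra_simps)
    then show "AE w in M. norm (h w) \<le> norm (1 + (norm (h w))\<^sup>2)"
      by (simp add: add_nonneg_nonneg)
  qed simp
  have fint: "integrable M (f n)" for n by (rule L1) (use int in auto)
  have fatou: "(\<integral>\<^sup>+w. ennreal ((norm (g w))\<^sup>2) \<partial>M) \<le> ennreal C"
  proof -
    have "(\<integral>\<^sup>+w. ennreal ((norm (g w))\<^sup>2) \<partial>M) = (\<integral>\<^sup>+w. liminf (\<lambda>n. ennreal ((norm (f n w))\<^sup>2)) \<partial>M)"
    proof (rule nn_integral_cong_AE, use lim in eventually_elim)
      case (elim w)
      have "(\<lambda>n. ennreal ((norm (f n w))\<^sup>2)) \<longlonglongrightarrow> ennreal ((norm (g w))\<^sup>2)"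
        by (intro tendsto_ennrealI tendsto_power tendsto_norm elim)
      from lim_imp_Liminf[OF _ this] show ?case by simp
    qed
    also have "\<dots> \<le> liminf (\<lambda>n. \<integral>\<^sup>+w. ennreal ((norm (f n w))\<^sup>2) \<partial>M)"
      by (intro nn_integral_liminf) simp
    also have "\<dots> = liminf (\<lambda>n. ennreal (\<integral>w. (norm (f n w))\<^sup>2 \<partial>M))"
      using int by (subst nn_integral_eq_integral) auto
    also have "\<dots> \<le> limsup (\<lambda>n. ennreal (\<integral>w. (norm (f n w))\<^sup>2 \<partial>M))"
      by (intro Liminf_le_Limsup) simp
    also have "\<dots> \<le> ennreal C"
      using bound by (intro Limsup_bounded) (simp add: ennreal_leI)
    finally show ?thesis .
  qed
  have g2: "integrable M (\<lambda>w. (norm (g w))\<^sup>2)"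
    using fatou by (intro integrableI_bounded) (auto simp: top.extremum_strict intro: le_less_trans)
  show gint: "integrable M g" by (rule L1) (use g2 in auto)
  have g2C: "(\<integral>w. (norm (g w))\<^sup>2 \<partial>M) \<le> C"
    using fatou C g2 by (subst (asm) nn_integral_eq_integral) auto
  define d where "d = (\<lambda>n w. norm (f n w - g w))"
  have [measurable]: "d n \<in> borel_measurable M" for n unfolding d_def by simp
  have dint: "integrable M (d n)" for n using fint gint unfolding d_def by auto
  have dle: "(d n w)\<^sup>2 \<le> 2 * (norm (f n w))\<^sup>2 + 2 * (norm (g w))\<^sup>2" for n w
  proof -
    have "(d n w)\<^sup>2 \<le> (norm (f n w) + norm (g w))\<^sup>2"
      unfolding d_def by (intro power_mono norm_triangle_ineq4) simp
    also have "\<dots> \<le> 2 * (norm (f n w))\<^sup>2 + 2 * (norm (g w))\<^sup>2"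
      using sum_squares_bound[of "norm (f n w)" "norm (g w)"] by (simp add: power2_eq_square algebra_simps)
    finally show ?thesis .
  qed
  have d2int: "integrable M (\<lambda>w. (d n w)\<^sup>2)" for n
    by (rule Bochner_Integration.integrable_bound[where f="\<lambda>w. 2 * (norm (f n w))\<^sup>2 + 2 * (norm (g w))\<^sup>2"])
       (use int g2 dle in \<open>auto intro!: order_trans[OF dle]\<close>)
  have d2: "(\<integral>w. (d n w)\<^sup>2 \<partial>M) \<le> 4 * C" for n
  proof -
    have "(\<integral>w. (d n w)\<^sup>2 \<partial>M) \<le> (\<integral>w. 2 * (norm (f n w))\<^sup>2 + 2 * (norm (g w))\<^sup>2 \<partial>M)"
      by (intro integral_mono d2int dle) (use int g2 in auto)
    also have "\<dots> \<le> 4 * C" using int g2 bound[of n] g2C by simp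
    finally show ?thesis .
  qed
  have dlim: "(\<lambda>n. \<integral>w. d n w \<partial>M) \<longlonglongrightarrow> 0"
  proof (rule LIMSEQ_I)
    fix e :: real assume e: "0 < e"
    \<comment> \<open>With this level, \<open>4 * C / K\<close>, which bounds the contribution of the second moments, is at most \<open>e / 2\<close>.\<close>
    define K where "K = (8 * C + 1) / e"
    have K: "0 < K" using e C by (simp add: K_def)
    have "(\<lambda>n. \<integral>w. min (d n w) K \<partial>M) \<longlonglongrightarrow> (\<integral>w. 0 \<partial>M)"
    proof (rule integral_dominated_convergence[where w="\<lambda>_. K"])
      show "AE w in M. (\<lambda>n. min (d n w) K) \<longlonglongrightarrow> 0"
        using lim
      proof eventually_elim
        case (elim w)
        then have "(\<lambda>n. d n w) \<longlonglongrightarrow> 0"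
          unfolding d_def using LIM_zero tendsto_norm_zero by blast
        then have "(\<lambda>n. min (d n w) K) \<longlonglongrightarrow> min 0 K"
          by (intro tendsto_min tendsto_const)
        then show ?case using K by simp
      qed
      show "AE w in M. norm (min (d n w) K) \<le> K" for n using K by (auto simp: d_def)
    qed auto
    then obtain n0 where n0: "\<And>n. n \<ge> n0 \<Longrightarrow> \<bar>\<integral>w. min (d n w) K \<partial>M\<bar> < e / 2"
      using e LIMSEQ_D[of _ 0 "e/2"] by fastforce
    have "\<bar>\<integral>w. d n w \<partial>M\<bar> < e" if n: "n \<ge> n0" for n
    proof -
      have le: "d n w \<le> min (d n w) K + (d n w)\<^sup>2 / K" for w
      proof (cases "d n w \<le> K")
        case False
        then have "K * d n w \<le> d n w * d n w" using K by (intro mult_right_mono) auto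
        then have "d n w \<le> (d n w)\<^sup>2 / K" using K by (simp add: field_simps power2_eq_square)
        then show ?thesis using K False by simp
      qed (use K in auto)
      have "(\<integral>w. d n w \<partial>M) \<le> (\<integral>w. min (d n w) K + (d n w)\<^sup>2 / K \<partial>M)"
        by (intro integral_mono le dint Bochner_Integration.integrable_add Bochner_Integration.integrable_min integrable_divide d2int) auto
      also have "\<dots> = (\<integral>w. min (d n w) K \<partial>M) + (\<integral>w. (d n w)\<^sup>2 \<partial>M) / K"
        by (subst Bochner_Integration.integral_add) (use d2int dint in auto)
      also have "\<dots> < e / 2 + e / 2"
      proof (rule add_less_le_mono)
        show "(\<integral>w. min (d n w) K \<partial>M) < e / 2" using n0[OF n] by simp
        have "(\<integral>w. (d n w)\<^sup>2 \<partial>M) / K \<le> 4 * C / K" using K d2[of n] by (intro divide_right_mono) auto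
        also have "\<dots> \<le> e / 2" using e C by (simp add: K_def field_simps)
        finally show "(\<integral>w. (d n w)\<^sup>2 \<partial>M) / K \<le> e / 2" .
      qed
      finally have "(\<integral>w. d n w \<partial>M) < e" by simp
      moreover have "0 \<le> (\<integral>w. d n w \<partial>M)" by (intro integral_nonneg_AE) (simp add: d_def)
      ultimately show ?thesis by simp
    qed
    then show "\<exists>no. \<forall>n\<ge>no. norm ((\<integral>w. d n w \<partial>M) - 0) < e" by auto
  qed
  then show "(\<lambda>n. \<integral>w. norm (f n w - g w) \<partial>M) \<longlonglongrightarrow> 0" by (simp add: d_def)
  show "(\<lambda>n. \<integral>w. f n w \<partial>M) \<longlonglongrightarrow> (\<integral>w. g w \<partial>M)"
  proof (rule LIM_zero_cancel, rule Lim_null_comparison[OF _ dlim], rule always_eventually, rule allI)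
    fix n
    have "(\<integral>w. f n w \<partial>M) - (\<integral>w. g w \<partial>M) = (\<integral>w. f n w - g w \<partial>M)"
      using fint gint by simp
    then show "norm ((\<integral>w. f n w \<partial>M) - (\<integral>w. g w \<partial>M)) \<le> (\<integral>w. d n w \<partial>M)"
      by (simp add: d_def)
  qed
qed

section \<open>Kolmogorov's theorem on random series\<close>

text \<open>
  The term \<open>x n\<close> is added only if the current value lies in \<open>Q\<close>. For \<open>Q = {-e..e}\<close> this is the sequence
  of partial sums stopped at its first exit from \<open>Q\<close>, since a value outside \<open>Q\<close> never changes again;
  for \<open>Q = UNIV\<close> these are the partial sums themselves. One second moment estimate serves both.
\<close>

primrec gated_sum :: "real set \<Rightarrow> (nat \<Rightarrow> real) \<Rightarrow> nat \<Rightarrow> real" where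
  "gated_sum Q x 0 = 0"
| "gated_sum Q x (Suc n) = gated_sum Q x n + (if gated_sum Q x n \<in> Q then x n else 0)"

lemma gated_sum_cong: "(\<And>i. i < n \<Longrightarrow> x i = y i) \<Longrightarrow> gated_sum Q x n = gated_sum Q y n"
  by (induction n) auto

lemma gated_sum_UNIV: "gated_sum UNIV x n = sum x {..<n}"
  by (induction n) auto

lemma gated_sum_measurable:
  assumes [measurable]: "Q \<in> sets borel" and X: "\<And>i. i < n \<Longrightarrow> X i \<in> borel_measurable K"
  shows "(\<lambda>w. gated_sum Q (\<lambda>i. X i w) n) \<in> borel_measurable K"
  using X
proof (induction n)
  case (Suc n)
  then have [measurable]: "(\<lambda>w. gated_sum Q (\<lambda>i. X i w) n) \<in> borel_measurable K"
    "X n \<in> borel_measurable K" by auto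
  show ?case by simp
qed simp

text \<open>
  A partial sum outside the interval freezes the gated sum there, so the maximum of the partial sums
  is controlled by the single random variable \<open>gated_sum {-e..e} x n\<close>.
\<close>

lemma gated_sum_exceeds:
  assumes "k \<le> n" "\<bar>sum x {..<k}\<bar> > e"
  shows "\<bar>gated_sum {-e..e} x n\<bar> > e"
proof -
  have "(gated_sum {-e..e} x n = sum x {..<n} \<and> (\<forall>i<n. \<bar>sum x {..<i}\<bar> \<le> e)) \<or> \<bar>gated_sum {-e..e} x n\<bar> > e" for n
  proof (induction n)
    case (Suc n)
    show ?case
    proof (cases "\<bar>gated_sum {-e..e} x n\<bar> > e")
      case True
      then have "gated_sum {-e..e} x n \<notin> {-e..e}" by auto
      then have "gated_sum {-e..e} x (Suc n) = gated_sum {-e..e} x n" by (simp only: gated_sum.simps if_False add_0_right)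
      with True show ?thesis by (simp only: simp_thms)
    next
      case False
      then have "gated_sum {-e..e} x n \<in> {-e..e}" by auto
      with False Suc show ?thesis by (simp add: less_Suc_eq all_conj_distrib imp_conjL)
    qed
  qed simp
  from this[of n] show ?thesis
  proof
    assume *: "gated_sum {-e..e} x n = sum x {..<n} \<and> (\<forall>i<n. \<bar>sum x {..<i}\<bar> \<le> e)"
    then have "\<not> k < n" using assms(2) by (meson not_le)
    then show ?thesis using * assms by simp
  qed
qed

context prob_space
begin

text \<open>
  Whether \<open>X n\<close> is added depends on the earlier terms only, hence is independent of \<open>X n\<close>. As \<open>X n\<close> is
  centred, the mixed term in the square of the sum vanishes, and gating only omits variances.
\<close>

lemma gated_sum_second_moment:
  fixes X :: "nat \<Rightarrow> 'a \<Rightarrow> real"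
  assumes ind: "indep_vars (\<lambda>_. borel) X UNIV"
    and sq: "\<And>i. integrable M (\<lambda>w. (X i w)\<^sup>2)" and mean: "\<And>i. expectation (X i) = 0"
    and Q [measurable]: "Q \<in> sets borel"
  shows "integrable M (\<lambda>w. (gated_sum Q (\<lambda>i. X i w) n)\<^sup>2)"
    "expectation (\<lambda>w. (gated_sum Q (\<lambda>i. X i w) n)\<^sup>2) \<le> (\<Sum>i<n. expectation (\<lambda>w. (X i w)\<^sup>2))"
proof -
  let ?v = "\<lambda>i. expectation (\<lambda>w. (X i w)\<^sup>2)"
  have rv [measurable]: "random_variable borel (X i)" for i
    using ind by (auto simp: indep_vars_def)
  have L1: "integrable M h" if [measurable]: "h \<in> borel_measurable M" and "integrable M (\<lambda>w. (h w)\<^sup>2)" for h :: "'a \<Rightarrow> real"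
    using that square_integrable_imp_integrable by blast
  have "integrable M (\<lambda>w. (gated_sum Q (\<lambda>i. X i w) n)\<^sup>2) \<and>
    expectation (\<lambda>w. (gated_sum Q (\<lambda>i. X i w) n)\<^sup>2) \<le> (\<Sum>i<n. ?v i)"
  proof (induction n)
    case (Suc n)
    define W where "W = (\<lambda>w. gated_sum Q (\<lambda>i. X i w) n)"
    define H where "H = (\<lambda>w::real. if w \<in> Q then w else 0)"
    have H [measurable]: "H \<in> borel_measurable borel" unfolding H_def by simp
    have indep: "indep_var borel (\<lambda>w. H (W w)) borel (X n)"
    proof -
      have "indep_var (PiM {..<n} (\<lambda>_. borel)) (\<lambda>w. \<lambda>i\<in>{..<n}. X i w) (PiM {n} (\<lambda>_. borel)) (\<lambda>w. \<lambda>i\<in>{n}. X i w)"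
        by (rule indep_var_restrict[OF ind]) auto
      then have "indep_var borel ((\<lambda>x. H (gated_sum Q x n)) \<circ> (\<lambda>w. \<lambda>i\<in>{..<n}. X i w)) borel ((\<lambda>x. x n) \<circ> (\<lambda>w. \<lambda>i\<in>{n}. X i w))"
      proof (rule indep_var_compose)
        have [measurable]: "(\<lambda>x. gated_sum Q x n) \<in> borel_measurable (PiM {..<n} (\<lambda>_. borel))"
          by (rule gated_sum_measurable[where X="\<lambda>i x. x i"]) auto
        show "(\<lambda>x. H (gated_sum Q x n)) \<in> borel_measurable (PiM {..<n} (\<lambda>_. borel))"
          by measurable
      qed auto
      moreover have "(\<lambda>x. H (gated_sum Q x n)) \<circ> (\<lambda>w. \<lambda>i\<in>{..<n}. X i w) = (\<lambda>w. H (W w))"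
        unfolding W_def o_def by (intro ext arg_cong[where f=H] gated_sum_cong) auto
      moreover have "(\<lambda>x. x n) \<circ> (\<lambda>w. \<lambda>i\<in>{n}. X i w) = X n" by auto
      ultimately show ?thesis by simp
    qed
    have Wm [measurable]: "W \<in> borel_measurable M"
      unfolding W_def by (rule gated_sum_measurable) simp_all
    have W2: "integrable M (\<lambda>w. (W w)\<^sup>2)" using Suc unfolding W_def by simp
    have HW2: "integrable M (\<lambda>w. (H (W w))\<^sup>2)"
      by (rule Bochner_Integration.integrable_bound[OF W2]) (auto simp: H_def)
    have prod: "integrable M (\<lambda>w. H (W w) * X n w)" "expectation (\<lambda>w. H (W w) * X n w) = 0"
    proof -
      have "integrable M (\<lambda>w. H (W w))" "integrable M (X n)"
        by (rule L1[OF _ HW2], simp, rule L1[OF _ sq[of n]], simp)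
      from indep_var_integrable[OF indep this] indep_var_lebesgue_integral[OF indep this]
      show "integrable M (\<lambda>w. H (W w) * X n w)" "expectation (\<lambda>w. H (W w) * X n w) = 0"
        by (simp_all add: mean)
    qed
    define G where "G = (\<lambda>w. if W w \<in> Q then (X n w)\<^sup>2 else 0)"
    have G: "integrable M G"
      by (rule Bochner_Integration.integrable_bound[OF sq[of n]]) (auto simp: G_def)
    have eq: "(gated_sum Q (\<lambda>i. X i w) (Suc n))\<^sup>2 = (W w)\<^sup>2 + 2 * (H (W w) * X n w) + G w" for w
      by (simp add: H_def G_def W_def power2_eq_square algebra_simps)
    have "expectation G \<le> ?v n"
      by (intro integral_mono G sq) (auto simp: G_def)
    moreover have "expectation (\<lambda>w. (W w)\<^sup>2 + 2 * (H (W w) * X n w) + G w) = expectation (\<lambda>w. (W w)\<^sup>2) + expectation G"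
      using W2 prod G by simp
    moreover have "expectation (\<lambda>w. (W w)\<^sup>2) \<le> (\<Sum>i<n. ?v i)"
      using Suc unfolding W_def by simp
    ultimately show ?case unfolding eq using W2 prod G by simp
  qed simp
  then show "integrable M (\<lambda>w. (gated_sum Q (\<lambda>i. X i w) n)\<^sup>2)"
    "expectation (\<lambda>w. (gated_sum Q (\<lambda>i. X i w) n)\<^sup>2) \<le> (\<Sum>i<n. ?v i)" by auto
qed

text \<open>
  Kolmogorov's maximal inequality: Chebyshev's inequality for the sum stopped at its first exit.
\<close>

lemma maximal_inequality:
  fixes X :: "nat \<Rightarrow> 'a \<Rightarrow> real"
  assumes ind: "indep_vars (\<lambda>_. borel) X UNIV"
    and sq: "\<And>i. integrable M (\<lambda>w. (X i w)\<^sup>2)" and mean: "\<And>i. expectation (X i) = 0" and e: "0 < e"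
  shows "prob {w\<in>space M. \<exists>k\<le>n. \<bar>\<Sum>i<k. X i w\<bar> > e} \<le> (\<Sum>i<n. expectation (\<lambda>w. (X i w)\<^sup>2)) / e\<^sup>2"
proof -
  let ?v = "\<lambda>i. expectation (\<lambda>w. (X i w)\<^sup>2)"
  have rv [measurable]: "random_variable borel (X i)" for i
    using ind by (auto simp: indep_vars_def)
  define W where "W = (\<lambda>w. gated_sum {-e..e} (\<lambda>i. X i w) n)"
  have Wm [measurable]: "W \<in> borel_measurable M"
    unfolding W_def by (rule gated_sum_measurable) simp_all
  note gs = gated_sum_second_moment[OF ind sq mean, of "{-e..e}" n]
  have W2: "integrable M (\<lambda>w. (W w)\<^sup>2)"
    and W2le: "expectation (\<lambda>w. (W w)\<^sup>2) \<le> (\<Sum>i<n. ?v i)"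
    using gs unfolding W_def by auto
  have "prob {w\<in>space M. \<exists>k\<le>n. \<bar>\<Sum>i<k. X i w\<bar> > e} \<le> prob {w\<in>space M. (W w)\<^sup>2 \<ge> e\<^sup>2}"
  proof (intro finite_measure_mono subsetI CollectI conjI; clarsimp)
    fix w k assume "k \<le> n" "e < \<bar>\<Sum>i<k. X i w\<bar>"
    then have "e < \<bar>W w\<bar>" unfolding W_def by (rule gated_sum_exceeds)
    then show "e\<^sup>2 \<le> (W w)\<^sup>2" using e by (metis abs_le_square_iff abs_of_pos less_le)
  qed
  also have "\<dots> \<le> expectation (\<lambda>w. (W w)\<^sup>2) / e\<^sup>2"
    using W2 e by (intro integral_Markov_inequality_measure[where A="{}"]) auto
  also have "\<dots> \<le> (\<Sum>i<n. ?v i) / e\<^sup>2"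
    using W2le by (intro divide_right_mono) auto
  finally show ?thesis .
qed

text \<open>
  The maximal inequality for the tail of the series bounds the probability that the partial sums
  after \<open>m\<close> ever move away by more than \<open>e\<close> from the one at \<open>m\<close>. These bounds tend to 0, so almost
  surely some \<open>m\<close> works for each \<open>e = 1 / Suc j\<close>, and the partial sums are Cauchy.
\<close>

lemma AE_summable_of_summable_variances:
  fixes X :: "nat \<Rightarrow> 'a \<Rightarrow> real"
  assumes ind: "indep_vars (\<lambda>_. borel) X UNIV"
    and sq: "\<And>i. integrable M (\<lambda>w. (X i w)\<^sup>2)" and mean: "\<And>i. expectation (X i) = 0"
    and summ: "summable (\<lambda>i. expectation (\<lambda>w. (X i w)\<^sup>2))"
  shows "AE w in M. summable (\<lambda>i. X i w)"
proof -
  have rv [measurable]: "random_variable borel (X i)" for i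
    using ind by (auto simp: indep_vars_def)
  define v where "v = (\<lambda>i. expectation (\<lambda>w. (X i w)\<^sup>2))"
  have v0: "0 \<le> v i" for i unfolding v_def by simp
  have AE_small: "AE w in M. \<exists>m. \<forall>k. \<bar>\<Sum>i<k. X (m + i) w\<bar> \<le> e" if e: "0 < e" for e
  proof -
    define R where "R = (\<lambda>m. {w\<in>space M. \<exists>k. \<bar>\<Sum>i<k. X (m + i) w\<bar> > e})"
    have Rm [measurable]: "R m \<in> sets M" for m unfolding R_def by measurable
    have Rle: "prob (R m) \<le> (\<Sum>i. v (m + i)) / e\<^sup>2" for m
    proof -
      have ind': "indep_vars (\<lambda>_. borel) (\<lambda>i. X (m + i)) UNIV"
      proof -
        have "indep_vars (\<lambda>_. borel) (\<lambda>i. (\<lambda>x. x (m + i)) \<circ> (\<lambda>w. \<lambda>j\<in>{m + i}. X j w)) UNIV"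
          by (rule indep_vars_compose, rule indep_vars_restrict[OF ind, where K="\<lambda>i. {m + i}"])
             (auto simp: disjoint_family_on_def)
        then show ?thesis by (simp add: o_def)
      qed
      define S where "S = (\<lambda>n. {w\<in>space M. \<exists>k\<le>n. \<bar>\<Sum>i<k. X (m + i) w\<bar> > e})"
      have "(\<lambda>n. prob (S n)) \<longlonglongrightarrow> prob (\<Union>n. S n)"
        by (intro finite_Lim_measure_incseq) (auto simp: S_def incseq_def intro: order_trans)
      moreover have "(\<Union>n. S n) = R m" unfolding S_def R_def by auto
      moreover have "prob (S n) \<le> (\<Sum>i. v (m + i)) / e\<^sup>2" for n
      proof -
        have "prob (S n) \<le> (\<Sum>i<n. v (m + i)) / e\<^sup>2"
          unfolding S_def v_def by (rule maximal_inequality[OF ind']) (use sq mean e in auto)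
        also have "\<dots> \<le> (\<Sum>i. v (m + i)) / e\<^sup>2"
          using summ v0 unfolding v_def[symmetric]
          by (intro divide_right_mono sum_le_suminf) (auto simp: summable_iff_shift[of v] add.commute[of m])
        finally show ?thesis .
      qed
      ultimately show ?thesis by (metis LIMSEQ_le_const2)
    qed
    have "(\<lambda>m. (\<Sum>i. v (i + m)) / e\<^sup>2) \<longlonglongrightarrow> 0 / e\<^sup>2"
      using summ e unfolding v_def[symmetric] by (intro tendsto_divide suminf_exist_split2 tendsto_const) auto
    then have lim: "(\<lambda>m. (\<Sum>i. v (m + i)) / e\<^sup>2) \<longlonglongrightarrow> 0" by (simp add: add.commute)
    have "prob (\<Inter>m. R m) \<le> (\<Sum>i. v (m + i)) / e\<^sup>2" for m
      by (rule order_trans[OF _ Rle[of m]]) (intro finite_measure_mono, auto)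
    then have "prob (\<Inter>m. R m) \<le> 0" using LIMSEQ_le_const[OF lim] by blast
    then have "prob (\<Inter>m. R m) = 0" by (simp add: measure_le_0_iff)
    then have "AE w in M. w \<notin> (\<Inter>m. R m)"
      by (subst (asm) prob_eq_0) auto
    then show ?thesis
      using AE_space
    proof eventually_elim
      case (elim w)
      then obtain m where "w \<notin> R m" by auto
      then show ?case using elim(2) by (auto simp: R_def not_less intro!: exI[of _ m])
    qed
  qed
  have "AE w in M. \<forall>j. \<exists>m. \<forall>k. \<bar>\<Sum>i<k. X (m + i) w\<bar> \<le> 1 / real (Suc j)"
    by (subst AE_all_countable) (intro allI AE_small, simp)
  then show ?thesis
  proof eventually_elim
    case (elim w)
    show ?case unfolding summable_Cauchy
    proof (intro allI impI)
      fix e :: real assume "0 < e"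
      then obtain j where j: "1 / real (Suc j) < e / 2" using nat_approx_posE[of "e/2"] by auto
      obtain m where m: "\<And>k. \<bar>\<Sum>i<k. X (m + i) w\<bar> \<le> 1 / real (Suc j)" using elim by auto
      have shift: "(\<Sum>i = m..<p. X i w) = (\<Sum>i<p - m. X (m + i) w)" for p
        by (rule sum.reindex_bij_witness[of _ "\<lambda>i. m + i" "\<lambda>i. i - m"]) auto
      have "norm (\<Sum>i = p..<q. X i w) < e" if p: "p \<ge> m" for p q
      proof (cases "p \<le> q")
        case True
        have "(\<Sum>i = p..<q. X i w) = (\<Sum>i = m..<q. X i w) - (\<Sum>i = m..<p. X i w)"
          using sum.atLeastLessThan_concat[OF p True, of "\<lambda>i. X i w"] by simp
        then have eq: "(\<Sum>i = p..<q. X i w) = (\<Sum>i<q - m. X (m + i) w) - (\<Sum>i<p - m. X (m + i) w)"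
          unfolding shift .
        have "\<bar>u - v\<bar> < e" if "\<bar>u\<bar> \<le> r" "\<bar>v\<bar> \<le> r" "r < e / 2" for u v r :: real using that by linarith
        from this[OF m[of "q - m"] m[of "p - m"] j] show ?thesis unfolding eq real_norm_def .
      qed (use \<open>0 < e\<close> in auto)
      then show "\<exists>N. \<forall>m\<ge>N. \<forall>n. norm (\<Sum>i = m..<n. X i w) < e" by blast
    qed
  qed
qed

end

section \<open>Laws of processes and characteristic functions\<close>

text \<open>
  After division by the common total mass, which is the value of the transforms at 0, this is Levy's
  uniqueness theorem.
\<close>

lemma weighted_char_uniqueness:
  fixes A1 :: "'v \<Rightarrow> real" and A2 :: "'w \<Rightarrow> real"
  assumes [measurable]: "A1 \<in> borel_measurable M1" "A2 \<in> borel_measurable M2"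
    and w1: "integrable M1 w1" "\<And>x. 0 \<le> w1 x" and w2: "integrable M2 w2" "\<And>x. 0 \<le> w2 x"
    and eq: "\<And>s. (\<integral>x. w1 x *\<^sub>R iexp (s * A1 x) \<partial>M1) = (\<integral>x. w2 x *\<^sub>R iexp (s * A2 x) \<partial>M2)"
  shows "distr (density M1 (\<lambda>x. ennreal (w1 x))) borel A1 = distr (density M2 (\<lambda>x. ennreal (w2 x))) borel A2"
proof -
  have [measurable]: "w1 \<in> borel_measurable M1" "w2 \<in> borel_measurable M2" using w1 w2 by auto
  define c where "c = (\<integral>x. w1 x \<partial>M1)"
  have c2: "c = (\<integral>x. w2 x \<partial>M2)"
    using eq[of 0] by (simp add: c_def integral_complex_of_real scaleR_conv_of_real)
  have c0: "0 \<le> c" unfolding c_def using w1 by (intro integral_nonneg_AE) auto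
  let ?D1 = "distr (density M1 (\<lambda>x. ennreal (w1 x))) borel A1" and ?D2 = "distr (density M2 (\<lambda>x. ennreal (w2 x))) borel A2"
  show ?thesis
  proof (cases "c = 0")
    case True
    have "emeasure (?D1) B = 0" if "B \<in> sets borel" for B
    proof -
      have "AE x in M1. w1 x = 0" using integral_nonneg_eq_0_iff_AE[OF w1(1)] w1(2) True by (simp add: c_def)
      then show ?thesis using that
        by (auto simp: emeasure_distr emeasure_density nn_integral_0_iff_AE)
    qed
    moreover have "emeasure (?D2) B = 0" if "B \<in> sets borel" for B
    proof -
      have "AE x in M2. w2 x = 0" using integral_nonneg_eq_0_iff_AE[OF w2(1)] w2(2) True by (simp add: c2)
      then show ?thesis using that
        by (auto simp: emeasure_distr emeasure_density nn_integral_0_iff_AE)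
    qed
    ultimately show ?thesis by (intro measure_eqI) auto
  next
    case False
    with c0 have c: "0 < c" by simp
    let ?N1 = "distr (density M1 (\<lambda>x. ennreal (w1 x / c))) borel A1" and ?N2 = "distr (density M2 (\<lambda>x. ennreal (w2 x / c))) borel A2"
    have P1: "prob_space (density M1 (\<lambda>x. ennreal (w1 x / c)))"
      using w1 c by (intro prob_spaceI) (simp add: emeasure_density nn_integral_eq_integral c_def)
    have P2: "prob_space (density M2 (\<lambda>x. ennreal (w2 x / c)))"
      using w2 c by (intro prob_spaceI) (simp add: emeasure_density nn_integral_eq_integral c2)
    have "?N1 = ?N2"
    proof (rule Levy_uniqueness)
      show "real_distribution (?N1)"
        using prob_space.prob_space_distr[OF P1, of A1 borel] by (simp add: real_distribution_def real_distribution_axioms_def)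
      show "real_distribution (?N2)"
        using prob_space.prob_space_distr[OF P2, of A2 borel] by (simp add: real_distribution_def real_distribution_axioms_def)
      show "char (?N1) = char (?N2)"
      proof
        fix s
        have "char (?N1) s = (\<integral>x. (w1 x / c) *\<^sub>R iexp (s * A1 x) \<partial>M1)"
          unfolding char_def using w1(2) c by (simp add: integral_distr integral_density)
        also have "\<dots> = (\<integral>x. (1 / c) *\<^sub>R (w1 x *\<^sub>R iexp (s * A1 x)) \<partial>M1)" by simp
        also have "\<dots> = (1 / c) *\<^sub>R (\<integral>x. w1 x *\<^sub>R iexp (s * A1 x) \<partial>M1)" by (rule integral_scaleR_right)
        also have "\<dots> = (1 / c) *\<^sub>R (\<integral>x. w2 x *\<^sub>R iexp (s * A2 x) \<partial>M2)" unfolding eq ..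
        also have "\<dots> = (\<integral>x. (1 / c) *\<^sub>R (w2 x *\<^sub>R iexp (s * A2 x)) \<partial>M2)" by (rule integral_scaleR_right[symmetric])
        also have "\<dots> = (\<integral>x. (w2 x / c) *\<^sub>R iexp (s * A2 x) \<partial>M2)" by simp
        also have "\<dots> = char (?N2) s"
          unfolding char_def using w2(2) c by (simp add: integral_distr integral_density)
        finally show "char (?N1) s = \<dots>" .
      qed
    qed
    note * = this
    show ?thesis
    proof (rule measure_eqI)
      fix B assume "B \<in> sets (?D1)"
      then have [measurable]: "B \<in> sets borel" by simp
      have D1: "emeasure (?D1) B =
        ennreal c * emeasure (?N1) B"
        using c w1(2)
        by (simp add: emeasure_distr emeasure_density nn_integral_cmult[symmetric] mult.assoc[symmetric] ennreal_mult'[symmetric])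
      have D2: "emeasure (?D2) B =
        ennreal c * emeasure (?N2) B"
        using c w2(2)
        by (simp add: emeasure_distr emeasure_density nn_integral_cmult[symmetric] mult.assoc[symmetric] ennreal_mult'[symmetric])
      show "emeasure (?D1) B = emeasure (?D2) B"
        unfolding D1 D2 * ..
    qed simp
  qed
qed

lemma integral_weighted_eqI:
  fixes f :: "real \<Rightarrow> 'b::{banach, second_countable_topology}"
  assumes "distr (density M1 (\<lambda>x. ennreal (w1 x))) borel A1 = distr (density M2 (\<lambda>x. ennreal (w2 x))) borel A2"
    and [measurable]: "A1 \<in> borel_measurable M1" "A2 \<in> borel_measurable M2" "f \<in> borel_measurable borel"
      "w1 \<in> borel_measurable M1" "w2 \<in> borel_measurable M2"
    and w: "\<And>x. 0 \<le> w1 x" "\<And>x. 0 \<le> w2 x"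
  shows "(\<integral>x. w1 x *\<^sub>R f (A1 x) \<partial>M1) = (\<integral>x. w2 x *\<^sub>R f (A2 x) \<partial>M2)"
proof -
  have "(\<integral>x. w1 x *\<^sub>R f (A1 x) \<partial>M1) = (\<integral>y. f y \<partial>distr (density M1 (\<lambda>x. ennreal (w1 x))) borel A1)"
    using w by (simp add: integral_distr integral_density)
  also have "\<dots> = (\<integral>x. w2 x *\<^sub>R f (A2 x) \<partial>M2)"
    unfolding assms(1) using w by (simp add: integral_distr integral_density)
  finally show ?thesis .
qed

lemma integrable_times_iexp:
  assumes g: "integrable M (g :: 'w \<Rightarrow> complex)" and [measurable]: "A \<in> borel_measurable M"
  shows "integrable M (\<lambda>x. g x * iexp (s * A x))"
proof (rule Bochner_Integration.integrable_bound[OF integrable_norm[OF g]])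
  have [measurable]: "g \<in> borel_measurable M" using g by auto
  show "(\<lambda>x. g x * iexp (s * A x)) \<in> borel_measurable M" by measurable
qed (simp add: norm_mult)

text \<open>
  A signed weight \<open>p (g1 x)\<close>, with \<open>p\<close> the real or the imaginary part, becomes nonnegative when the
  dominating weight \<open>h1\<close> is added, so the real case applies to \<open>h1 + p \<circ> g1\<close> and to \<open>h1\<close>; their
  difference gives the claim. The conjugate weights enter because \<open>p\<close> is a combination of the identity
  and conjugation.
\<close>

lemma complex_weighted_char_uniqueness:
  fixes A1 :: "'v \<Rightarrow> real" and A2 :: "'w \<Rightarrow> real" and g1 :: "'v \<Rightarrow> complex" and g2 :: "'w \<Rightarrow> complex"
    and f :: "real \<Rightarrow> real"
  assumes [measurable]: "A1 \<in> borel_measurable M1" "A2 \<in> borel_measurable M2" "f \<in> borel_measurable borel"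
    and [measurable]: "g1 \<in> borel_measurable M1" "g2 \<in> borel_measurable M2"
    and h1: "integrable M1 h1" "\<And>x. norm (g1 x) \<le> h1 x" and h2: "integrable M2 h2" "\<And>x. norm (g2 x) \<le> h2 x"
    and f1: "integrable M1 (\<lambda>x. f (A1 x) * h1 x)" and f2: "integrable M2 (\<lambda>x. f (A2 x) * h2 x)"
    and eqh: "\<And>s. (\<integral>x. h1 x *\<^sub>R iexp (s * A1 x) \<partial>M1) = (\<integral>x. h2 x *\<^sub>R iexp (s * A2 x) \<partial>M2)"
    and eqg: "\<And>s. (\<integral>x. g1 x * iexp (s * A1 x) \<partial>M1) = (\<integral>x. g2 x * iexp (s * A2 x) \<partial>M2)"
    and eqc: "\<And>s. (\<integral>x. cnj (g1 x) * iexp (s * A1 x) \<partial>M1) = (\<integral>x. cnj (g2 x) * iexp (s * A2 x) \<partial>M2)"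
  shows "(\<integral>x. f (A1 x) *\<^sub>R g1 x \<partial>M1) = (\<integral>x. f (A2 x) *\<^sub>R g2 x \<partial>M2)"
proof -
  let ?e1 = "\<lambda>s x. iexp (s * A1 x)" and ?e2 = "\<lambda>s x. iexp (s * A2 x)"
  have [measurable]: "h1 \<in> borel_measurable M1" "h2 \<in> borel_measurable M2" using h1 h2 by auto
  have h0: "0 \<le> h1 x" "0 \<le> h2 y" for x y using h1(2)[of x] h2(2)[of y] norm_ge_zero order_trans by blast+
  have gi: "integrable M1 g1" "integrable M2 g2"
    by (rule Bochner_Integration.integrable_bound[OF h1(1)], use h1(2) h0 in auto)
       (rule Bochner_Integration.integrable_bound[OF h2(1)], use h2(2) h0 in auto)
  have fg: "integrable M1 (\<lambda>x. f (A1 x) *\<^sub>R g1 x)" "integrable M2 (\<lambda>x. f (A2 x) *\<^sub>R g2 x)"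
    by (rule Bochner_Integration.integrable_bound[OF f1], use h1(2) h0 in \<open>auto simp: abs_mult intro!: mult_left_mono\<close>)
       (rule Bochner_Integration.integrable_bound[OF f2], use h2(2) h0 in \<open>auto simp: abs_mult intro!: mult_left_mono\<close>)
  have real_part: "(\<integral>x. f (A1 x) * p (g1 x) \<partial>M1) = (\<integral>x. f (A2 x) * p (g2 x) \<partial>M2)"
    if p: "p = Re \<or> p = Im" for p
  proof -
    have [measurable]: "p \<in> borel_measurable borel" using p by auto
    have ple: "\<bar>p z\<bar> \<le> norm z" for z using p abs_Re_le_cmod abs_Im_le_cmod by auto
    have pi: "integrable M1 (\<lambda>x. p (g1 x))" "integrable M2 (\<lambda>x. p (g2 x))" using gi p by auto
    obtain a b :: complex where ab: "\<And>z. complex_of_real (p z) = a * z + b * cnj z"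
    proof (cases "p = Re")
      case True
      have "complex_of_real (Re z) = (1/2) * z + (1/2) * cnj z" for z by (simp add: complex_eq_iff)
      with that True show ?thesis by blast
    next
      case False
      have "complex_of_real (Im z) = (- \<i> / 2) * z + (\<i> / 2) * cnj z" for z by (simp add: complex_eq_iff)
      with that False p show ?thesis by blast
    qed
    have gie: "integrable M1 (\<lambda>x. g1 x * ?e1 s x)" "integrable M1 (\<lambda>x. cnj (g1 x) * ?e1 s x)"
       "integrable M2 (\<lambda>x. g2 x * ?e2 s x)" "integrable M2 (\<lambda>x. cnj (g2 x) * ?e2 s x)"
       "integrable M1 (\<lambda>x. complex_of_real (h1 x) * ?e1 s x)"
       "integrable M2 (\<lambda>x. complex_of_real (h2 x) * ?e2 s x)" for s
      by (rule integrable_times_iexp; use gi h1(1) h2(1) in simp)+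
    have eqp: "(\<integral>x. complex_of_real (p (g1 x)) * ?e1 s x \<partial>M1) = (\<integral>x. complex_of_real (p (g2 x)) * ?e2 s x \<partial>M2)" for s
    proof -
      have "(\<integral>x. complex_of_real (p (g1 x)) * ?e1 s x \<partial>M1) =
        (\<integral>x. a * (g1 x * ?e1 s x) + b * (cnj (g1 x) * ?e1 s x) \<partial>M1)"
        unfolding ab by (simp add: algebra_simps)
      also have "\<dots> = a * (\<integral>x. g1 x * ?e1 s x \<partial>M1) + b * (\<integral>x. cnj (g1 x) * ?e1 s x \<partial>M1)"
        using gie by simp
      also have "\<dots> = a * (\<integral>x. g2 x * ?e2 s x \<partial>M2) + b * (\<integral>x. cnj (g2 x) * ?e2 s x \<partial>M2)"
        unfolding eqg eqc ..
      also have "\<dots> = (\<integral>x. a * (g2 x * ?e2 s x) + b * (cnj (g2 x) * ?e2 s x) \<partial>M2)"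
        using gie by simp
      also have "\<dots> = (\<integral>x. complex_of_real (p (g2 x)) * ?e2 s x \<partial>M2)"
        unfolding ab by (simp add: algebra_simps)
      finally show ?thesis .
    qed
    have gip: "integrable M1 (\<lambda>x. complex_of_real (p (g1 x)) * ?e1 s x)"
       "integrable M2 (\<lambda>x. complex_of_real (p (g2 x)) * ?e2 s x)" for s
      by (rule integrable_times_iexp; use pi in simp)+
    define w1 where "w1 = (\<lambda>x. h1 x + p (g1 x))"
    define w2 where "w2 = (\<lambda>x. h2 x + p (g2 x))"
    have [measurable]: "w1 \<in> borel_measurable M1" "w2 \<in> borel_measurable M2" unfolding w1_def w2_def by simp_all
    have w0: "0 \<le> w1 x" "0 \<le> w2 y" for x y
      using ple[of "g1 x"] ple[of "g2 y"] h1(2)[of x] h2(2)[of y] unfolding w1_def w2_def by linarith+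
    have wi: "integrable M1 w1" "integrable M2 w2" unfolding w1_def w2_def using h1(1) h2(1) pi by auto
    have D: "distr (density M1 (\<lambda>x. ennreal (w1 x))) borel A1 = distr (density M2 (\<lambda>x. ennreal (w2 x))) borel A2"
    proof (rule weighted_char_uniqueness)
      fix s
      have "(\<integral>x. w1 x *\<^sub>R ?e1 s x \<partial>M1) = (\<integral>x. h1 x *\<^sub>R ?e1 s x + complex_of_real (p (g1 x)) * ?e1 s x \<partial>M1)"
        by (simp add: w1_def scaleR_conv_of_real algebra_simps)
      also have "\<dots> = (\<integral>x. h1 x *\<^sub>R ?e1 s x \<partial>M1) + (\<integral>x. complex_of_real (p (g1 x)) * ?e1 s x \<partial>M1)"
        using gip gie(5) unfolding scaleR_conv_of_real by (intro Bochner_Integration.integral_add)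
      also have "\<dots> = (\<integral>x. h2 x *\<^sub>R ?e2 s x \<partial>M2) + (\<integral>x. complex_of_real (p (g2 x)) * ?e2 s x \<partial>M2)"
        unfolding eqh eqp ..
      also have "\<dots> = (\<integral>x. h2 x *\<^sub>R ?e2 s x + complex_of_real (p (g2 x)) * ?e2 s x \<partial>M2)"
        using gip gie(6) unfolding scaleR_conv_of_real by (intro Bochner_Integration.integral_add[symmetric])
      also have "\<dots> = (\<integral>x. w2 x *\<^sub>R ?e2 s x \<partial>M2)"
        by (simp add: w2_def scaleR_conv_of_real algebra_simps)
      finally show "(\<integral>x. w1 x *\<^sub>R ?e1 s x \<partial>M1) = (\<integral>x. w2 x *\<^sub>R ?e2 s x \<partial>M2)" .
    qed (use wi w0 in auto)
    have Dh: "distr (density M1 (\<lambda>x. ennreal (h1 x))) borel A1 = distr (density M2 (\<lambda>x. ennreal (h2 x))) borel A2"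
      by (rule weighted_char_uniqueness) (use h1 h2 h0 eqh in auto)
    have fp: "integrable M1 (\<lambda>x. f (A1 x) * p (g1 x))" "integrable M2 (\<lambda>x. f (A2 x) * p (g2 x))"
      using fg p by (auto dest: integrable_Re integrable_Im simp: integrable_Re integrable_Im)
    have "(\<integral>x. w1 x *\<^sub>R f (A1 x) \<partial>M1) = (\<integral>x. w2 x *\<^sub>R f (A2 x) \<partial>M2)"
      by (rule integral_weighted_eqI[OF D]) (use w0 in auto)
    moreover have "(\<integral>x. h1 x *\<^sub>R f (A1 x) \<partial>M1) = (\<integral>x. h2 x *\<^sub>R f (A2 x) \<partial>M2)"
      by (rule integral_weighted_eqI[OF Dh]) (use h0 in auto)
    moreover have "(\<integral>x. w1 x *\<^sub>R f (A1 x) \<partial>M1) = (\<integral>x. h1 x *\<^sub>R f (A1 x) \<partial>M1) + (\<integral>x. f (A1 x) * p (g1 x) \<partial>M1)"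
      using fp f1 by (subst Bochner_Integration.integral_add[symmetric]) (auto simp: w1_def algebra_simps)
    moreover have "(\<integral>x. w2 x *\<^sub>R f (A2 x) \<partial>M2) = (\<integral>x. h2 x *\<^sub>R f (A2 x) \<partial>M2) + (\<integral>x. f (A2 x) * p (g2 x) \<partial>M2)"
      using fp f2 by (subst Bochner_Integration.integral_add[symmetric]) (auto simp: w2_def algebra_simps)
    ultimately show ?thesis by simp
  qed
  show ?thesis
  proof (rule complex_eqI)
    show "Re (\<integral>x. f (A1 x) *\<^sub>R g1 x \<partial>M1) = Re (\<integral>x. f (A2 x) *\<^sub>R g2 x \<partial>M2)"
      using real_part[of Re] fg by (simp flip: integral_Re)
    show "Im (\<integral>x. f (A1 x) *\<^sub>R g1 x \<partial>M1) = Im (\<integral>x. f (A2 x) *\<^sub>R g2 x \<partial>M2)"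
      using real_part[of Im] fg by (simp flip: integral_Im)
  qed
qed

lemma borel_measurable_lincomb:
  fixes u :: "'i \<Rightarrow> real"
  assumes "\<And>i. i \<in> F \<Longrightarrow> X i \<in> borel_measurable K"
  shows "(\<lambda>x. \<Sum>i\<in>F. u i * X i x) \<in> borel_measurable K"
  using assms by (intro borel_measurable_sum borel_measurable_times borel_measurable_const)

text \<open>
  The coordinates are treated one at a time. At each stage the coordinates in \<open>J\<close> occur through the
  indicators of the sets \<open>A i\<close> and the others through their exponentials. Moving one more coordinate to
  \<open>J\<close> is an application of one-dimensional uniqueness, with the remaining factors as complex weights
  and the product of the indicators as dominating weight. This reduces the multivariate uniqueness
  theorem to the univariate one.
\<close>

lemma joint_law_eq_of_char_eq:
  fixes X1 :: "'i \<Rightarrow> 'v \<Rightarrow> real" and X2 :: "'i \<Rightarrow> 'w \<Rightarrow> real"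
  assumes "prob_space M1" "prob_space M2" and F: "finite F"
    and X1 [measurable]: "\<And>i. i \<in> F \<Longrightarrow> X1 i \<in> borel_measurable M1"
    and X2 [measurable]: "\<And>i. i \<in> F \<Longrightarrow> X2 i \<in> borel_measurable M2"
    and A: "\<And>i. i \<in> F \<Longrightarrow> A i \<in> sets borel"
    and char: "\<And>u. (\<integral>x. iexp (\<Sum>i\<in>F. u i * X1 i x) \<partial>M1) = (\<integral>x. iexp (\<Sum>i\<in>F. u i * X2 i x) \<partial>M2)"
  shows "measure M1 {x\<in>space M1. \<forall>i\<in>F. X1 i x \<in> A i} = measure M2 {x\<in>space M2. \<forall>i\<in>F. X2 i x \<in> A i}"
proof -
  interpret M1: prob_space M1 by fact
  interpret M2: prob_space M2 by fact
  define I1 where "I1 = (\<lambda>J x. \<Prod>i\<in>J. indicator (A i) (X1 i x) :: real)"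
  define I2 where "I2 = (\<lambda>J x. \<Prod>i\<in>J. indicator (A i) (X2 i x) :: real)"
  have I1m: "I1 J \<in> borel_measurable M1" if "J \<subseteq> F" for J
    unfolding I1_def using that A by (intro borel_measurable_prod borel_measurable_indicator measurable_compose[OF X1]) auto
  have I2m: "I2 J \<in> borel_measurable M2" if "J \<subseteq> F" for J
    unfolding I2_def using that A by (intro borel_measurable_prod measurable_compose[OF X2]) auto
  have I01: "0 \<le> I1 J x" "I1 J x \<le> 1" "0 \<le> I2 J y" "I2 J y \<le> 1" for J x y
    unfolding I1_def I2_def by (auto intro!: prod_nonneg prod_le_1)
  have main: "(\<integral>x. I1 J x *\<^sub>R iexp (\<Sum>i\<in>F - J. u i * X1 i x) \<partial>M1) = (\<integral>x. I2 J x *\<^sub>R iexp (\<Sum>i\<in>F - J. u i * X2 i x) \<partial>M2)"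
    if "J \<subseteq> F" for J u
    using finite_subset[OF that F] that
  proof (induction J arbitrary: u rule: finite_induct)
    case empty
    show ?case using char[of u] by (simp add: I1_def I2_def)
  next
    case (insert k J)
    then have kF: "k \<in> F" "k \<notin> J" and JF: "J \<subseteq> F" by auto
    note [measurable] = I1m[OF JF] I2m[OF JF] A[OF kF(1)] X1[OF kF(1)] X2[OF kF(1)]
    have split: "(\<Sum>i\<in>F - J. v i * c i) = v k * c k + (\<Sum>i\<in>F - insert k J. v i * c i)" for v c :: "'i \<Rightarrow> real"
    proof -
      have "F - J = insert k (F - insert k J)" using kF by auto
      moreover have "sum (\<lambda>i. v i * c i) (insert k (F - insert k J)) = v k * c k + (\<Sum>i\<in>F - insert k J. v i * c i)"
        by (rule sum.insert) (use F in auto)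
      ultimately show ?thesis by (simp only:)
    qed
    have IH: "(\<integral>x. I1 J x *\<^sub>R (iexp (s * X1 k x) * iexp (\<Sum>i\<in>F - insert k J. v i * X1 i x)) \<partial>M1) =
      (\<integral>x. I2 J x *\<^sub>R (iexp (s * X2 k x) * iexp (\<Sum>i\<in>F - insert k J. v i * X2 i x)) \<partial>M2)" for s v
    proof -
      have *: "iexp (\<Sum>i\<in>F - J. (v(k := s)) i * c i) = iexp (s * c k) * iexp (\<Sum>i\<in>F - insert k J. v i * c i)" for c
      proof -
        have "(\<Sum>i\<in>F - insert k J. (v(k := s)) i * c i) = (\<Sum>i\<in>F - insert k J. v i * c i)"
          by (rule sum.cong) auto
        then have "(\<Sum>i\<in>F - J. (v(k := s)) i * c i) = s * c k + (\<Sum>i\<in>F - insert k J. v i * c i)"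
          using split[of "v(k := s)" c] by (simp only: fun_upd_same)
        then show ?thesis by (simp only: of_real_add distrib_left exp_add)
      qed
      show ?thesis using insert.IH[OF JF, of "v(k := s)"] unfolding * .
    qed
    define g1 where "g1 = (\<lambda>x. I1 J x *\<^sub>R iexp (\<Sum>i\<in>F - insert k J. u i * X1 i x))"
    define g2 where "g2 = (\<lambda>x. I2 J x *\<^sub>R iexp (\<Sum>i\<in>F - insert k J. u i * X2 i x))"
    have [measurable]: "(\<lambda>x. \<Sum>i\<in>F - insert k J. u i * X1 i x) \<in> borel_measurable M1"
      "(\<lambda>x. \<Sum>i\<in>F - insert k J. u i * X2 i x) \<in> borel_measurable M2"
      by (intro borel_measurable_lincomb X1 X2; blast)+
    have [measurable]: "g1 \<in> borel_measurable M1" "g2 \<in> borel_measurable M2" unfolding g1_def g2_def by measurable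
    have "(\<integral>x. indicator (A k) (X1 k x) *\<^sub>R g1 x \<partial>M1) = (\<integral>x. indicator (A k) (X2 k x) *\<^sub>R g2 x \<partial>M2)"
    proof (rule complex_weighted_char_uniqueness[where f="indicator (A k)" and ?A1.0="X1 k" and ?A2.0="X2 k" and ?h1.0="I1 J" and ?h2.0="I2 J"])
      show "(\<integral>x. I1 J x *\<^sub>R iexp (s * X1 k x) \<partial>M1) = (\<integral>x. I2 J x *\<^sub>R iexp (s * X2 k x) \<partial>M2)" for s
        using IH[of s "\<lambda>_. 0"] by simp
      show "(\<integral>x. g1 x * iexp (s * X1 k x) \<partial>M1) = (\<integral>x. g2 x * iexp (s * X2 k x) \<partial>M2)" for s
        using IH[of s u] by (simp add: g1_def g2_def mult.commute)
      show "(\<integral>x. cnj (g1 x) * iexp (s * X1 k x) \<partial>M1) = (\<integral>x. cnj (g2 x) * iexp (s * X2 k x) \<partial>M2)" for s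
        using IH[of s "\<lambda>i. - u i"] by (simp add: g1_def g2_def mult.commute exp_cnj sum_negf)
      show "norm (g1 x) \<le> I1 J x" for x using I01 by (simp add: g1_def)
      show "norm (g2 x) \<le> I2 J x" for x using I01 by (simp add: g2_def)
      show "integrable M1 (I1 J)" "integrable M2 (I2 J)"
        using I01 by (auto intro!: M1.integrable_const_bound[where B=1] M2.integrable_const_bound[where B=1])
      show "integrable M1 (\<lambda>x. indicator (A k) (X1 k x) * I1 J x)"
      proof (rule M1.integrable_const_bound[where B=1])
        show "AE x in M1. norm (indicator (A k) (X1 k x) * I1 J x) \<le> 1"
          using I01 by (auto simp: indicator_def)
      qed simp
      show "integrable M2 (\<lambda>x. indicator (A k) (X2 k x) * I2 J x)"
      proof (rule M2.integrable_const_bound[where B=1])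
        show "AE x in M2. norm (indicator (A k) (X2 k x) * I2 J x) \<le> 1"
          using I01 by (auto simp: indicator_def)
      qed simp
    qed simp_all
    then show ?case
      using insert.hyps by (simp add: g1_def g2_def I1_def I2_def mult.commute mult.assoc)
  qed
  have ind: "I1 F x = indicator {x\<in>space M1. \<forall>i\<in>F. X1 i x \<in> A i} x" if "x \<in> space M1" for x
    using that F by (auto simp: I1_def indicator_def intro!: prod.neutral)
  have ind2: "I2 F x = indicator {x\<in>space M2. \<forall>i\<in>F. X2 i x \<in> A i} x" if "x \<in> space M2" for x
    using that F by (auto simp: I2_def indicator_def intro!: prod.neutral)
  have S: "{x\<in>space M1. \<forall>i\<in>F. X1 i x \<in> A i} \<in> sets M1" "{x\<in>space M2. \<forall>i\<in>F. X2 i x \<in> A i} \<in> sets M2"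
    using F A X1 X2 by (auto intro!: sets.sets_Collect_finite_All' sets.sets_Collect_finite_All measurable_sets_Collect)
  have "complex_of_real (\<integral>x. I1 F x \<partial>M1) = complex_of_real (\<integral>x. I2 F x \<partial>M2)"
    using main[of F] by (simp add: scaleR_conv_of_real)
  moreover have "(\<integral>x. I1 F x \<partial>M1) = measure M1 {x\<in>space M1. \<forall>i\<in>F. X1 i x \<in> A i}"
    using S(1) by (simp cong: Bochner_Integration.integral_cong add: ind) 
  moreover have "(\<integral>x. I2 F x \<partial>M2) = measure M2 {x\<in>space M2. \<forall>i\<in>F. X2 i x \<in> A i}"
    using S(2) by (simp cong: Bochner_Integration.integral_cong add: ind2)
  ultimately show ?thesis by simp
qed

lemma process_law_eq_of_char_eq:
  fixes X1 :: "'i \<Rightarrow> 'v \<Rightarrow> real" and X2 :: "'i \<Rightarrow> 'w \<Rightarrow> real"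
  assumes M: "prob_space M1" "prob_space M2"
    and X1 [measurable]: "\<And>i. i \<in> I \<Longrightarrow> X1 i \<in> borel_measurable M1"
    and X2 [measurable]: "\<And>i. i \<in> I \<Longrightarrow> X2 i \<in> borel_measurable M2"
    and char: "\<And>F u. finite F \<Longrightarrow> F \<subseteq> I \<Longrightarrow>
      (\<integral>x. iexp (\<Sum>i\<in>F. u i * X1 i x) \<partial>M1) = (\<integral>x. iexp (\<Sum>i\<in>F. u i * X2 i x) \<partial>M2)"
  shows "distr M1 (PiM I (\<lambda>_. borel)) (\<lambda>x. \<lambda>i\<in>I. X1 i x) = distr M2 (PiM I (\<lambda>_. borel)) (\<lambda>x. \<lambda>i\<in>I. X2 i x)"
proof (rule measure_eqI_PiM_infinite)
  interpret M1: prob_space M1 by fact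
  interpret M2: prob_space M2 by fact
  have m1: "(\<lambda>x. \<lambda>i\<in>I. X1 i x) \<in> measurable M1 (PiM I (\<lambda>_. borel))" by (rule measurable_restrict) (rule X1)
  have m2: "(\<lambda>x. \<lambda>i\<in>I. X2 i x) \<in> measurable M2 (PiM I (\<lambda>_. borel))" by (rule measurable_restrict) (rule X2)
  show "finite_measure (distr M1 (PiM I (\<lambda>_. borel)) (\<lambda>x. \<lambda>i\<in>I. X1 i x))"
    using M1.prob_space_distr[OF m1] by (simp add: prob_space_def)
  fix A and F assume F: "finite F" "F \<subseteq> I" and A: "\<And>i. i \<in> F \<Longrightarrow> A i \<in> sets (borel :: real measure)"
  let ?E = "prod_emb I (\<lambda>_. borel) F (Pi\<^sub>E F A)"
  have E: "?E \<in> sets (PiM I (\<lambda>_. borel))" using F A by (intro sets_PiM_I) auto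
  have cyl: "(\<lambda>i\<in>I. f i) \<in> ?E \<longleftrightarrow> (\<forall>i\<in>F. f i \<in> A i)" for f :: "'i \<Rightarrow> real"
    using F(2) by (auto simp: prod_emb_def PiE_iff restrict_def extensional_def subset_iff)
  have "emeasure (distr M1 (PiM I (\<lambda>_. borel)) (\<lambda>x. \<lambda>i\<in>I. X1 i x)) ?E = ennreal (measure M1 {x\<in>space M1. \<forall>i\<in>F. X1 i x \<in> A i})"
    unfolding emeasure_distr[OF m1 E] M1.emeasure_eq_measure
    by (intro arg_cong[where f="\<lambda>S. ennreal (measure M1 S)"]) (auto simp: cyl)
  also have "\<dots> = ennreal (measure M2 {x\<in>space M2. \<forall>i\<in>F. X2 i x \<in> A i})"
    by (intro arg_cong[where f=ennreal] joint_law_eq_of_char_eq M F(1) A char F) (use F in auto)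
  also have "\<dots> = emeasure (distr M2 (PiM I (\<lambda>_. borel)) (\<lambda>x. \<lambda>i\<in>I. X2 i x)) ?E"
    unfolding emeasure_distr[OF m2 E] M2.emeasure_eq_measure
    by (intro arg_cong[where f="\<lambda>S. ennreal (measure M2 S)"]) (auto simp: cyl)
  finally show "emeasure (distr M1 (PiM I (\<lambda>_. borel)) (\<lambda>x. \<lambda>i\<in>I. X1 i x)) ?E =
    emeasure (distr M2 (PiM I (\<lambda>_. borel)) (\<lambda>x. \<lambda>i\<in>I. X2 i x)) ?E" .
qed simp_all

section \<open>Gaussian exponentials and the Brownian bridge\<close>

text \<open>
  Completing the square: the density times \<open>exp (s * x)\<close> is a multiple of the density shifted by
  \<open>v * s\<close>. This reduces the formula at the complex argument \<open>s + \<i> r\<close> to the characteristic function of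
  the standard normal law.
\<close>

lemma centered_normal_exp:
  assumes "prob_space M" and Y: "centered_normal M Y v"
  shows "integrable M (\<lambda>w. exp (s * Y w))"
    and "(\<integral>w. exp (s * Y w) *\<^sub>R iexp (r * Y w) \<partial>M) = exp ((of_real s + \<i> * of_real r)\<^sup>2 * of_real v / 2)"
proof -
  interpret prob_space M by fact
  have [measurable]: "Y \<in> borel_measurable M" using Y by (simp add: centered_normal_def)
  have "integrable M (\<lambda>w. exp (s * Y w)) \<and>
    (\<integral>w. exp (s * Y w) *\<^sub>R iexp (r * Y w) \<partial>M) = exp ((of_real s + \<i> * of_real r)\<^sup>2 * of_real v / 2)"
  proof (cases "v = 0")
    case True
    then have AE: "AE w in M. Y w = 0" using Y by (simp add: centered_normal_def)
    have "integrable M (\<lambda>w. exp (s * Y w)) \<longleftrightarrow> integrable M (\<lambda>w. 1 :: real)"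
      by (rule integrable_cong_AE) (use AE in auto)
    moreover have "(\<integral>w. exp (s * Y w) *\<^sub>R iexp (r * Y w) \<partial>M) = (\<integral>w. 1 \<partial>M)"
      by (rule integral_cong_AE) (use AE in auto)
    ultimately show ?thesis using True by (simp add: prob_space)
  next
    case False
    then have v: "0 < v" and D: "distributed M lborel Y (\<lambda>x. ennreal (normal_density 0 (sqrt v) x))"
      using Y by (auto simp: centered_normal_def)
    define \<sigma> where "\<sigma> = sqrt v"
    have \<sigma>: "0 < \<sigma>" "\<sigma>\<^sup>2 = v" using v by (auto simp: \<sigma>_def)
    have law: "distr M lborel Y = density lborel (\<lambda>x. ennreal (normal_density 0 \<sigma> x))"
      using distributed_distr_eq_density[OF D] by (simp add: \<sigma>_def)
    have dens: "normal_density 0 \<sigma> (v * s + \<sigma> * z) * exp (s * (v * s + \<sigma> * z)) = exp (s\<^sup>2 * v / 2) / \<sigma> * std_normal_density z" for z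
    proof -
      have "- (v * s + \<sigma> * z)\<^sup>2 / (2 * \<sigma>\<^sup>2) + s * (v * s + \<sigma> * z) = s\<^sup>2 * v / 2 + - z\<^sup>2 / 2"
        using \<sigma> by (simp add: \<sigma>(2)[symmetric] field_simps power2_eq_square)
      then have "exp (- (v * s + \<sigma> * z)\<^sup>2 / (2 * \<sigma>\<^sup>2)) * exp (s * (v * s + \<sigma> * z)) = exp (s\<^sup>2 * v / 2) * exp (- z\<^sup>2 / 2)"
        by (simp only: exp_add[symmetric])
      then show ?thesis
        using \<sigma>(1) by (simp add: normal_density_def real_sqrt_mult field_simps)
    qed
    have "integrable lborel (\<lambda>x. normal_density 0 \<sigma> x * exp (s * x))"
    proof -
      have "integrable lborel (\<lambda>z. exp (s\<^sup>2 * v / 2) / \<sigma> * std_normal_density z)" by simp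
      then have "integrable lborel (\<lambda>z. normal_density 0 \<sigma> (v * s + \<sigma> * z) * exp (s * (v * s + \<sigma> * z)))"
        by (simp only: dens)
      then show ?thesis using \<sigma> by (subst (asm) lborel_integrable_real_affine_iff) auto
    qed
    then have int: "integrable M (\<lambda>w. exp (s * Y w))"
    proof -
      assume "integrable lborel (\<lambda>x. normal_density 0 \<sigma> x * exp (s * x))"
      then have "integrable (distr M lborel Y) (\<lambda>x. exp (s * x))"
        unfolding law by (subst integrable_density) auto
      then show ?thesis by (subst (asm) integrable_distr_eq) auto
    qed
    have "(\<integral>w. exp (s * Y w) *\<^sub>R iexp (r * Y w) \<partial>M) = (\<integral>x. exp (s * x) *\<^sub>R iexp (r * x) \<partial>distr M lborel Y)"
      by (rule integral_distr[symmetric]) auto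
    also have "\<dots> = (\<integral>x. (normal_density 0 \<sigma> x * exp (s * x)) *\<^sub>R iexp (r * x) \<partial>lborel)"
      unfolding law by (subst integral_density) auto
    also have "\<dots> = \<bar>\<sigma>\<bar> *\<^sub>R (\<integral>z. (normal_density 0 \<sigma> (v * s + \<sigma> * z) * exp (s * (v * s + \<sigma> * z))) *\<^sub>R iexp (r * (v * s + \<sigma> * z)) \<partial>lborel)"
      using \<sigma> by (intro lborel_integral_real_affine) auto
    also have "\<dots> = \<sigma> *\<^sub>R (\<integral>z. (of_real (exp (s\<^sup>2 * v / 2) / \<sigma>) * iexp (r * v * s)) * (std_normal_density z *\<^sub>R iexp (r * \<sigma> * z)) \<partial>lborel)"
      unfolding dens using \<sigma> by (simp add: scaleR_conv_of_real exp_add distrib_left mult_ac)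
    also have "\<dots> = \<sigma> *\<^sub>R ((of_real (exp (s\<^sup>2 * v / 2) / \<sigma>) * iexp (r * v * s)) * (\<integral>z. std_normal_density z *\<^sub>R iexp (r * \<sigma> * z) \<partial>lborel))"
      by (simp only: integral_mult_right_zero)
    also have "(\<integral>z. std_normal_density z *\<^sub>R iexp (r * \<sigma> * z) \<partial>lborel) = char std_normal_distribution (r * \<sigma>)"
      unfolding char_def by (subst integral_density) auto
    also have "\<dots> = of_real (exp (- (r * \<sigma>)\<^sup>2 / 2))" unfolding char_std_normal_distribution by simp
    also have "\<sigma> *\<^sub>R ((of_real (exp (s\<^sup>2 * v / 2) / \<sigma>) * iexp (r * v * s)) * of_real (exp (- (r * \<sigma>)\<^sup>2 / 2))) =
       of_real (exp (s\<^sup>2 * v / 2)) * iexp (r * v * s) * of_real (exp (- (r * \<sigma>)\<^sup>2 / 2))"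
      using \<sigma> by (simp add: scaleR_conv_of_real)
    also have "\<dots> = exp (of_real (s\<^sup>2 * v / 2) + \<i> * of_real (r * v * s) + of_real (- (r * \<sigma>)\<^sup>2 / 2))"
      by (simp only: exp_of_real[symmetric] exp_add)
    also have "of_real (s\<^sup>2 * v / 2) + \<i> * of_real (r * v * s) + of_real (- (r * \<sigma>)\<^sup>2 / 2) = (of_real s + \<i> * of_real r)\<^sup>2 * of_real v / 2"
      unfolding power_mult_distrib \<sigma>(2) by (simp add: complex_eq_iff power2_eq_square field_simps)
    finally show ?thesis using int by simp
  qed
  then show "integrable M (\<lambda>w. exp (s * Y w))"
    "(\<integral>w. exp (s * Y w) *\<^sub>R iexp (r * Y w) \<partial>M) = exp ((of_real s + \<i> * of_real r)\<^sup>2 * of_real v / 2)" by auto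
qed

text \<open>
  If \<open>A\<close> and \<open>L\<close> are jointly normal, then \<open>L - (c / a) * A\<close> is independent of \<open>A\<close>, so under the
  expectation and next to a function of \<open>A\<close> the factor \<open>exp (\<i> L)\<close> may be replaced by
  \<open>C * exp (\<i> (c / a) * A)\<close>, where \<open>C\<close> is the characteristic function of the difference at 1. This
  replacement is valid for the exponentials \<open>exp (\<i> s * A)\<close>, where it compares two characteristic
  functions, and uniqueness extends it to \<open>exp (\<theta> * A)\<close>.
\<close>

lemma gaussian_pair_exp:
  assumes "prob_space M"
    and normal: "\<And>s r. centered_normal M (\<lambda>w. s * A w + r * L w) (s\<^sup>2 * a + 2 * s * r * c + r\<^sup>2 * l)"
    and a: "0 < a"
  shows "(\<integral>w. exp (\<theta> * A w) *\<^sub>R iexp (L w) \<partial>M) = exp ((of_real (\<theta>\<^sup>2 * a - l) + 2 * \<i> * of_real (\<theta> * c)) / 2)"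
proof -
  interpret prob_space M by fact
  have NA: "centered_normal M A a" using normal[of 1 0] by simp
  have NL: "centered_normal M L l" using normal[of 0 1] by simp
  have [measurable]: "A \<in> borel_measurable M" "L \<in> borel_measurable M"
    using NA NL by (auto simp: centered_normal_def)
  define C where "C = exp (- (l - c\<^sup>2 / a) / 2)"
  have C: "0 < C" by (simp add: C_def)
  have charL: "(\<integral>w. iexp (s * A w + r * L w) \<partial>M) = of_real (exp (- (s\<^sup>2 * a + 2 * s * r * c + r\<^sup>2 * l) / 2))" for s r
    using centered_normal_exp(2)[OF \<open>prob_space M\<close> normal[of s r], of 0 1]
    by (simp only: mult_zero_left exp_zero scaleR_one mult_1_left of_real_0 of_real_1 add_0_left mult_1_right power2_i exp_of_real[symmetric])
       (simp add: power_mult_distrib)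
  have charA: "(\<integral>w. iexp (s * A w) \<partial>M) = of_real (exp (- (s\<^sup>2 * a) / 2))" for s
    using charL[of s 0] by simp
  have square: "exp (- (s\<^sup>2 * a + 2 * s * r * c + r\<^sup>2 * l) / 2) = C * exp (- ((s + r * (c / a))\<^sup>2 * a) / 2)" if "r\<^sup>2 = 1" for s r
  proof -
    have "- (s\<^sup>2 * a + 2 * s * r * c + r\<^sup>2 * l) / 2 = - (l - c\<^sup>2 / a) / 2 + - ((s + r * (c / a))\<^sup>2 * a) / 2"
    proof -
      have "(s + r * (c / a))\<^sup>2 * a = s\<^sup>2 * a + 2 * s * r * c + r\<^sup>2 * (c\<^sup>2 / a)"
        using a by (simp add: power2_eq_square field_simps)
      then show ?thesis using that by (simp add: field_simps)
    qed
    then show ?thesis by (simp only: C_def exp_add[symmetric])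
  qed
  have match: "(\<integral>w. iexp (r * L w) * iexp (s * A w) \<partial>M) = (\<integral>w. (C * iexp (r * (c / a * A w))) * iexp (s * A w) \<partial>M)"
    if r: "r\<^sup>2 = 1" for r s
  proof -
    have "(\<integral>w. iexp (r * L w) * iexp (s * A w) \<partial>M) = (\<integral>w. iexp (s * A w + r * L w) \<partial>M)"
      by (simp add: exp_add distrib_left mult.commute)
    also have "\<dots> = of_real C * (\<integral>w. iexp ((s + r * (c / a)) * A w) \<partial>M)"
      unfolding charL charA square[OF r] by (simp only: of_real_mult)
    also have "\<dots> = (\<integral>w. of_real C * iexp ((s + r * (c / a)) * A w) \<partial>M)"
      by (simp only: integral_mult_right_zero)
    also have "\<dots> = (\<integral>w. (C * iexp (r * (c / a * A w))) * iexp (s * A w) \<partial>M)"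
      by (simp add: exp_add distrib_left distrib_right mult_ac)
    finally show ?thesis .
  qed
  have "(\<integral>w. exp (\<theta> * A w) *\<^sub>R iexp (L w) \<partial>M) = (\<integral>w. exp (\<theta> * A w) *\<^sub>R (C * iexp (c / a * A w)) \<partial>M)"
  proof (rule complex_weighted_char_uniqueness[where f="\<lambda>x. exp (\<theta> * x)" and ?A1.0=A and ?A2.0=A and ?h1.0="\<lambda>_. 1 + C" and ?h2.0="\<lambda>_. 1 + C"])
    show "(\<integral>w. iexp (L w) * iexp (s * A w) \<partial>M) = (\<integral>w. (C * iexp (c / a * A w)) * iexp (s * A w) \<partial>M)" for s
      using match[of 1 s] by simp
    show "(\<integral>w. cnj (iexp (L w)) * iexp (s * A w) \<partial>M) = (\<integral>w. cnj (C * iexp (c / a * A w)) * iexp (s * A w) \<partial>M)" for s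
      using match[of "-1" s] by (simp add: exp_cnj)
    show "integrable M (\<lambda>w. exp (\<theta> * A w) * (1 + C))"
      using centered_normal_exp(1)[OF \<open>prob_space M\<close> NA] by simp
    then show "integrable M (\<lambda>w. exp (\<theta> * A w) * (1 + C))" .
  qed (use C in \<open>auto simp: norm_mult\<close>)
  also have "\<dots> = C * (\<integral>w. exp (\<theta> * A w) *\<^sub>R iexp (c / a * A w) \<partial>M)"
    by (simp add: scaleR_conv_of_real mult.left_commute)
  also have "\<dots> = exp (of_real (- (l - c\<^sup>2 / a) / 2) + (of_real \<theta> + \<i> * of_real (c / a))\<^sup>2 * of_real a / 2)"
    unfolding centered_normal_exp(2)[OF \<open>prob_space M\<close> NA] by (simp only: C_def exp_of_real[symmetric] exp_add)
  also have "of_real (- (l - c\<^sup>2 / a) / 2) + (of_real \<theta> + \<i> * of_real (c / a))\<^sup>2 * of_real a / 2 =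
     (of_real (\<theta>\<^sup>2 * a - l) + 2 * \<i> * of_real (\<theta> * c)) / 2"
    using a by (simp add: complex_eq_iff power2_eq_square field_simps)
  finally show ?thesis .
qed

definition bridge_cov :: "real \<Rightarrow> real \<Rightarrow> real" where
  "bridge_cov s t = min s t - s * t"

abbreviation bridge_var :: "real set \<Rightarrow> (real \<Rightarrow> real) \<Rightarrow> real" where
  "bridge_var F u \<equiv> \<Sum>s\<in>F. \<Sum>t\<in>F. u s * u t * bridge_cov s t"

text \<open>
  The case \<open>A = b T\<close> and \<open>L = (\<Sum>t\<in>F. u t * b t)\<close>. As \<open>T \<in> F\<close>, every combination of \<open>A\<close> and \<open>L\<close> is a linear
  combination of the values of \<open>b\<close> on \<open>F\<close>, hence normal.
\<close>

lemma bridge_tilted_char: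
  assumes M: "prob_space M" and b: "brownian_bridge M b" and F: "finite F" "F \<subseteq> {0..1}" and T: "T \<in> F" "0 < T" "T < 1"
  shows "(\<integral>w. exp (\<theta> * b T w) *\<^sub>R iexp (\<Sum>t\<in>F. u t * b t w) \<partial>M) =
    exp ((of_real (\<theta>\<^sup>2 * (T * (1 - T)) - bridge_var F u)
        + 2 * \<i> * of_real (\<theta> * (\<Sum>t\<in>F. u t * bridge_cov T t))) / 2)"
proof (rule gaussian_pair_exp[OF M])
  fix s r :: real
  let ?c = "\<lambda>t. s * of_bool (t = T) + r * u t"
  have "centered_normal M (\<lambda>w. \<Sum>t\<in>F. ?c t * b t w) (\<Sum>s\<in>F. \<Sum>t\<in>F. ?c s * ?c t * (min s t - s * t))"
    using b F by (simp add: brownian_bridge_def)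
  moreover have "(\<Sum>t\<in>F. ?c t * b t w) = s * b T w + r * (\<Sum>t\<in>F. u t * b t w)" for w
  proof -
    have "(\<Sum>t\<in>F. ?c t * b t w) = (\<Sum>t\<in>F. (if t = T then s * b t w else 0)) + (\<Sum>t\<in>F. r * (u t * b t w))"
      unfolding sum.distrib[symmetric] by (intro sum.cong) (auto simp: algebra_simps)
    then show ?thesis using F T by (simp add: sum_distrib_left)
  qed
  moreover have "(\<Sum>p\<in>F. \<Sum>t\<in>F. ?c p * ?c t * (min p t - p * t)) =
    s\<^sup>2 * (T * (1 - T)) + 2 * s * r * (\<Sum>t\<in>F. u t * bridge_cov T t) + r\<^sup>2 * bridge_var F u"
  proof -
    have in1: "(\<Sum>t\<in>F. ?c t * k t) = s * k T + r * (\<Sum>t\<in>F. u t * k t)" for k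
    proof -
      have "(\<Sum>t\<in>F. ?c t * k t) = (\<Sum>t\<in>F. (if t = T then s * k t else 0)) + (\<Sum>t\<in>F. r * (u t * k t))"
        unfolding sum.distrib[symmetric] by (intro sum.cong) (auto simp: algebra_simps)
      then show ?thesis using F T by (simp add: sum_distrib_left)
    qed
    have "(\<Sum>p\<in>F. \<Sum>t\<in>F. ?c p * ?c t * (min p t - p * t)) = (\<Sum>p\<in>F. ?c p * (\<Sum>t\<in>F. ?c t * bridge_cov p t))"
      by (simp only: bridge_cov_def sum_distrib_left mult.assoc)
    also have "\<dots> = s * (s * bridge_cov T T + r * (\<Sum>t\<in>F. u t * bridge_cov T t)) +
        r * (\<Sum>p\<in>F. u p * (s * bridge_cov p T + r * (\<Sum>t\<in>F. u t * bridge_cov p t)))"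
      by (simp only: in1)
    also have "(\<Sum>p\<in>F. u p * (s * bridge_cov p T + r * (\<Sum>t\<in>F. u t * bridge_cov p t))) =
        s * (\<Sum>t\<in>F. u t * bridge_cov T t) + r * bridge_var F u"
      by (simp add: sum_distrib_left distrib_left sum.distrib bridge_cov_def min.commute mult_ac)
    finally show ?thesis by (simp add: bridge_cov_def power2_eq_square algebra_simps)
  qed
  ultimately show "centered_normal M (\<lambda>w. s * b T w + r * (\<Sum>t\<in>F. u t * b t w))
    (s\<^sup>2 * (T * (1 - T)) + 2 * s * r * (\<Sum>t\<in>F. u t * bridge_cov T t) + r\<^sup>2 * bridge_var F u)"
    by simp
qed (use T in simp)

lemma bridge_char:
  assumes M: "prob_space M" and b: "brownian_bridge M b" and F: "finite F" "F \<subseteq> {0..1}"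
  shows "(\<integral>w. iexp (\<Sum>t\<in>F. u t * b t w) \<partial>M) = exp (of_real (- bridge_var F u / 2))"
proof -
  have "centered_normal M (\<lambda>w. \<Sum>t\<in>F. u t * b t w) (bridge_var F u)"
    using b F by (simp add: brownian_bridge_def bridge_cov_def)
  from centered_normal_exp(2)[OF M this, of 0 1] show ?thesis by simp
qed

lemma bridge_exp:
  assumes M: "prob_space M" and b: "brownian_bridge M b" and t: "t \<in> {0..1}"
  shows "integrable M (\<lambda>w. exp (\<theta> * b t w))" "(\<integral>w. exp (\<theta> * b t w) \<partial>M) = exp (\<theta>\<^sup>2 * (t * (1 - t)) / 2)"
proof -
  have *: "\<And>F c. finite F \<Longrightarrow> F \<subseteq> {0..1} \<Longrightarrow> centered_normal M (\<lambda>w. \<Sum>t\<in>F. c t * b t w)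
          (\<Sum>s\<in>F. \<Sum>t\<in>F. c s * c t * (min s t - s * t))"
    using b by (simp add: brownian_bridge_def)
  have N: "centered_normal M (b t) (t * (1 - t))"
    using *[of "{t}" "\<lambda>_. 1"] t by (simp add: algebra_simps)
  show "integrable M (\<lambda>w. exp (\<theta> * b t w))" by (rule centered_normal_exp(1)[OF M N])
  have "complex_of_real (\<integral>w. exp (\<theta> * b t w) \<partial>M) = (\<integral>w. exp (\<theta> * b t w) *\<^sub>R iexp (0 * b t w) \<partial>M)"
    by (simp only: mult_zero_left of_real_0 mult_zero_right exp_zero scaleR_conv_of_real mult_1_right integral_complex_of_real)
  also have "\<dots> = exp ((of_real \<theta> + \<i> * of_real 0)\<^sup>2 * of_real (t * (1 - t)) / 2)"
    by (rule centered_normal_exp(2)[OF M N])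
  also have "\<dots> = complex_of_real (exp (\<theta>\<^sup>2 * (t * (1 - t)) / 2))"
    by (simp flip: exp_of_real)
  finally have "complex_of_real (\<integral>w. exp (\<theta> * b t w) \<partial>M) = complex_of_real (exp (\<theta>\<^sup>2 * (t * (1 - t)) / 2))" .
  then show "(\<integral>w. exp (\<theta> * b t w) \<partial>M) = exp (\<theta>\<^sup>2 * (t * (1 - t)) / 2)" by (simp only: of_real_eq_iff)
qed

section \<open>Independence and properties that depend on laws only\<close>

lemma indep_rvs_iff:
  assumes "prob_space M"
  shows "indep_rvs M S f R g \<longleftrightarrow> f \<in> measurable M S \<and> g \<in> measurable M R \<and>
    (\<forall>A\<in>sets S. \<forall>B\<in>sets R. measure M {w\<in>space M. f w \<in> A \<and> g w \<in> B} =
      measure M {w\<in>space M. f w \<in> A} * measure M {w\<in>space M. g w \<in> B})"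
proof -
  interpret prob_space M by fact
  have eq: "f -` A \<inter> space M = {w\<in>space M. f w \<in> A}" "g -` B \<inter> space M = {w\<in>space M. g w \<in> B}"
    "{w\<in>space M. f w \<in> A} \<inter> {w\<in>space M. g w \<in> B} = {w\<in>space M. f w \<in> A \<and> g w \<in> B}" for A B
    by auto
  show ?thesis
  proof (intro iffI conjI ballI)
    assume *: "indep_rvs M S f R g"
    then show "f \<in> measurable M S" "g \<in> measurable M R" by (auto simp: indep_rvs_def)
    fix A B assume "A \<in> sets S" "B \<in> sets R"
    then show "prob {w\<in>space M. f w \<in> A \<and> g w \<in> B} = prob {w\<in>space M. f w \<in> A} * prob {w\<in>space M. g w \<in> B}"
      using * unfolding indep_rvs_def eq
      by (metis (mono_tags, lifting) eq(3) indep_setD mem_Collect_eq)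
  next
    assume *: "f \<in> measurable M S \<and> g \<in> measurable M R \<and>
    (\<forall>A\<in>sets S. \<forall>B\<in>sets R. measure M {w\<in>space M. f w \<in> A \<and> g w \<in> B} =
      measure M {w\<in>space M. f w \<in> A} * measure M {w\<in>space M. g w \<in> B})"
    then have [measurable]: "f \<in> measurable M S" "g \<in> measurable M R" by auto
    have "indep_set {f -` A \<inter> space M | A. A \<in> sets S} {g -` A \<inter> space M | A. A \<in> sets R}"
    proof (rule indep_setI)
      fix a b assume "a \<in> {f -` A \<inter> space M | A. A \<in> sets S}" "b \<in> {g -` A \<inter> space M | A. A \<in> sets R}"
      then show "prob (a \<inter> b) = prob a * prob b" using * by (auto simp: eq)
    qed (auto intro: measurable_sets)
    then show "indep_rvs M S f R g" by (simp add: indep_rvs_def)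
  qed
qed

lemma indep_rvs_compose:
  assumes "prob_space M" and ind: "indep_rvs M S f R g"
    and F: "F \<in> measurable S S'" and G: "G \<in> measurable R R'"
  shows "indep_rvs M S' (\<lambda>w. F (f w)) R' (\<lambda>w. G (g w))"
  unfolding indep_rvs_iff[OF assms(1)]
proof (intro conjI ballI)
  have f: "f \<in> measurable M S" and g: "g \<in> measurable M R" using ind by (auto simp: indep_rvs_def)
  show "(\<lambda>w. F (f w)) \<in> measurable M S'" "(\<lambda>w. G (g w)) \<in> measurable M R'"
    using measurable_compose[OF f F] measurable_compose[OF g G] by auto
  fix A B assume A: "A \<in> sets S'" and B: "B \<in> sets R'"
  have eq: "F (f w) \<in> A \<longleftrightarrow> f w \<in> F -` A \<inter> space S" "G (g w) \<in> B \<longleftrightarrow> g w \<in> G -` B \<inter> space R"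
    if "w \<in> space M" for w
    using measurable_space[OF f that] measurable_space[OF g that] by auto
  have sets: "F -` A \<inter> space S \<in> sets S" "G -` B \<inter> space R \<in> sets R"
    using measurable_sets[OF F A] measurable_sets[OF G B] by auto
  have "{w\<in>space M. F (f w) \<in> A \<and> G (g w) \<in> B} = {w\<in>space M. f w \<in> F -` A \<inter> space S \<and> g w \<in> G -` B \<inter> space R}"
    "{w\<in>space M. F (f w) \<in> A} = {w\<in>space M. f w \<in> F -` A \<inter> space S}"
    "{w\<in>space M. G (g w) \<in> B} = {w\<in>space M. g w \<in> G -` B \<inter> space R}"
    using eq by blast+
  then show "measure M {w\<in>space M. F (f w) \<in> A \<and> G (g w) \<in> B} =
      measure M {w\<in>space M. F (f w) \<in> A} * measure M {w\<in>space M. G (g w) \<in> B}"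
    using ind[unfolded indep_rvs_iff[OF assms(1)], THEN conjunct2, THEN conjunct2, rule_format, OF sets] by (simp only:)
qed

lemma indep_rvs_integral_mult:
  fixes f g :: "'w \<Rightarrow> 'b::{real_normed_field, banach, second_countable_topology}"
  assumes "prob_space M" and ind: "indep_rvs M borel f borel g" and int: "integrable M f" "integrable M g"
  shows "integrable M (\<lambda>w. f w * g w)" "(\<integral>w. f w * g w \<partial>M) = (\<integral>w. f w \<partial>M) * (\<integral>w. g w \<partial>M)"
proof -
  interpret prob_space M by fact
  have m [measurable]: "f \<in> borel_measurable M" "g \<in> borel_measurable M"
    using ind by (auto simp: indep_rvs_def)
  have sig: "sigma_sets (space M) {h -` A \<inter> space M | A. A \<in> sets borel} = {h -` A \<inter> space M | A. A \<in> sets borel}"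
    for h :: "'w \<Rightarrow> 'b"
    using sigma_sets_vimage_commute[of h "space M" UNIV "sets borel"] sets.sigma_sets_eq[of "borel :: 'b measure"] by simp
  have "indep_var borel f borel g"
    using ind m unfolding indep_var_eq sig indep_rvs_def by simp
  from indep_var_integrable[OF this int] indep_var_lebesgue_integral[OF this int]
  show "integrable M (\<lambda>w. f w * g w)" "(\<integral>w. f w * g w \<partial>M) = (\<integral>w. f w \<partial>M) * (\<integral>w. g w \<partial>M)"
    by auto
qed

lemma indep_rvs_law_cong:
  assumes M: "prob_space M" and N: "prob_space N" and ind: "indep_rvs M S f R g"
    and f' [measurable]: "f' \<in> measurable N S" and g' [measurable]: "g' \<in> measurable N R"
    and law: "distr N (S \<Otimes>\<^sub>M R) (\<lambda>w. (f' w, g' w)) = distr M (S \<Otimes>\<^sub>M R) (\<lambda>w. (f w, g w))"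
  shows "indep_rvs N S f' R g'"
  unfolding indep_rvs_iff[OF N]
proof (intro conjI ballI f' g')
  have [measurable]: "f \<in> measurable M S" "g \<in> measurable M R" using ind by (auto simp: indep_rvs_def)
  fix A B assume [measurable]: "A \<in> sets S" "B \<in> sets R"
  have ev: "measure N {w\<in>space N. f' w \<in> A' \<and> g' w \<in> B'} = measure M {w\<in>space M. f w \<in> A' \<and> g w \<in> B'}"
    if [measurable]: "A' \<in> sets S" "B' \<in> sets R" for A' B'
  proof -
    have "measure N {w\<in>space N. f' w \<in> A' \<and> g' w \<in> B'} = measure (distr N (S \<Otimes>\<^sub>M R) (\<lambda>w. (f' w, g' w))) (A' \<times> B')"
      by (subst measure_distr) (auto intro!: arg_cong[where f="measure N"])
    also have "\<dots> = measure M {w\<in>space M. f w \<in> A' \<and> g w \<in> B'}"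
      unfolding law by (subst measure_distr) (auto intro!: arg_cong[where f="measure M"])
    finally show ?thesis .
  qed
  have marg: "{w\<in>space N. f' w \<in> A} = {w\<in>space N. f' w \<in> A \<and> g' w \<in> space R}"
     "{w\<in>space N. g' w \<in> B} = {w\<in>space N. f' w \<in> space S \<and> g' w \<in> B}"
     "{w\<in>space M. f w \<in> A} = {w\<in>space M. f w \<in> A \<and> g w \<in> space R}"
     "{w\<in>space M. g w \<in> B} = {w\<in>space M. f w \<in> space S \<and> g w \<in> B}"
    using measurable_space[of f M S] measurable_space[of g M R] measurable_space[OF f'] measurable_space[OF g'] by auto
  have "measure M {w\<in>space M. f w \<in> A \<and> g w \<in> B} = measure M {w\<in>space M. f w \<in> A} * measure M {w\<in>space M. g w \<in> B}"
    using ind[unfolded indep_rvs_iff[OF M]] by auto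
  then show "measure N {w\<in>space N. f' w \<in> A \<and> g' w \<in> B} = measure N {w\<in>space N. f' w \<in> A} * measure N {w\<in>space N. g' w \<in> B}"
    unfolding marg by (simp add: ev)
qed

lemma centered_normal_law_cong:
  assumes Y: "centered_normal M Y v" and [measurable]: "Y' \<in> borel_measurable N"
    and law: "distr N borel Y' = distr M borel Y"
  shows "centered_normal N Y' v"
proof -
  have [measurable]: "Y \<in> borel_measurable M" using Y by (simp add: centered_normal_def)
  have lb: "distr K lborel h = distr K borel h" for K and h :: "'x \<Rightarrow> real"
    by (rule distr_cong) auto
  show ?thesis
  proof (cases "v = 0")
    case True
    then have "AE y in distr M borel Y. y = 0" using Y by (simp add: centered_normal_def AE_distr_iff)
    then have "AE w in N. Y' w = 0" unfolding law[symmetric] by (simp add: AE_distr_iff)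
    then show ?thesis using True by (simp add: centered_normal_def)
  next
    case False
    then show ?thesis using Y law by (simp add: centered_normal_def distributed_def lb)
  qed
qed

abbreviation "bridge_space \<equiv> PiM {0..1::real} (\<lambda>_. borel :: real measure)"
abbreviation "jump_space \<equiv> PiM (UNIV :: nat set) (\<lambda>_. borel :: real measure)"

abbreviation "noise_space \<equiv> bridge_space \<Otimes>\<^sub>M jump_space"

text \<open>
  Apart from measurability and continuity of the paths, being a bridge with independent uniforms is a
  property of the joint law. This allows the noise to be moved to another probability space.
\<close>

lemma bridge_and_uniforms_law_cong:
  assumes M: "prob_space M" and N: "prob_space N" and bu: "bridge_and_uniforms M b U"
    and b' [measurable]: "\<And>t. t \<in> {0..1} \<Longrightarrow> b' t \<in> borel_measurable N"
    and cont: "\<And>w. w \<in> space N \<Longrightarrow> continuous_on {0..1} (\<lambda>t. b' t w)"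
    and U' [measurable]: "\<And>i. U' i \<in> borel_measurable N"
    and law: "distr N noise_space (\<lambda>w. (\<lambda>t\<in>{0..1}. b' t w, \<lambda>i. U' i w)) =
      distr M noise_space (\<lambda>w. (\<lambda>t\<in>{0..1}. b t w, \<lambda>i. U i w))"
  shows "bridge_and_uniforms N b' U'"
proof -
  interpret M: prob_space M by fact
  interpret N: prob_space N by fact
  have b [measurable]: "\<And>t. t \<in> {0..1} \<Longrightarrow> b t \<in> borel_measurable M"
    and ind: "indep_rvs M bridge_space (\<lambda>w. \<lambda>t\<in>{0..1}. b t w) jump_space (\<lambda>w i. U i w)"
    and indU: "M.indep_vars (\<lambda>_. borel) U UNIV" and unif: "\<And>i. distr M borel (U i) = uniform_measure lborel {0<..<1}"
    and N01: "\<And>F c. finite F \<Longrightarrow> F \<subseteq> {0..1} \<Longrightarrow> centered_normal M (\<lambda>w. \<Sum>t\<in>F. c t * b t w)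
          (\<Sum>s\<in>F. \<Sum>t\<in>F. c s * c t * (min s t - s * t))"
    using bu by (auto simp: bridge_and_uniforms_def brownian_bridge_def)
  have U [measurable]: "\<And>i. U i \<in> borel_measurable M" using indU by (auto simp: M.indep_vars_def)
  have Jb: "(\<lambda>w. \<lambda>t\<in>{0..1}. b t w) \<in> measurable M bridge_space" "(\<lambda>w. \<lambda>t\<in>{0..1}. b' t w) \<in> measurable N bridge_space"
    by (auto intro!: measurable_restrict)
  have JU: "(\<lambda>w i. U i w) \<in> measurable M jump_space" "(\<lambda>w i. U' i w) \<in> measurable N jump_space"
    by (auto intro!: measurable_PiM_single')
  have J: "(\<lambda>w. (\<lambda>t\<in>{0..1}. b t w, \<lambda>i. U i w)) \<in> measurable M noise_space"
     "(\<lambda>w. (\<lambda>t\<in>{0..1}. b' t w, \<lambda>i. U' i w)) \<in> measurable N noise_space"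
    using Jb JU by (auto intro: measurable_Pair)
  have push: "distr N K (\<lambda>w. h (\<lambda>t\<in>{0..1}. b' t w) (\<lambda>i. U' i w)) = distr M K (\<lambda>w. h (\<lambda>t\<in>{0..1}. b t w) (\<lambda>i. U i w))"
    if h: "(\<lambda>(p, u). h p u) \<in> measurable noise_space K" for K h
    using distr_distr[OF h J(1)] distr_distr[OF h J(2)] unfolding law by (simp add: o_def)
  have "brownian_bridge N b'"
    unfolding brownian_bridge_def
  proof (intro conjI ballI allI impI b' cont)
    fix F c assume F: "finite F \<and> F \<subseteq> {0..1::real}"
    let ?h = "\<lambda>p. \<Sum>t\<in>F. c t * p t :: real"
    have [measurable]: "?h \<in> borel_measurable bridge_space"
      using F by (intro borel_measurable_lincomb) (auto intro!: measurable_component_singleton)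
    have eq: "?h (\<lambda>t\<in>{0..1}. q t) = (\<Sum>t\<in>F. c t * q t)" for q
      using F by (intro sum.cong) auto
    show "centered_normal N (\<lambda>w. \<Sum>t\<in>F. c t * b' t w) (\<Sum>s\<in>F. \<Sum>t\<in>F. c s * c t * (min s t - s * t))"
    proof (rule centered_normal_law_cong[OF N01])
      show "(\<lambda>w. \<Sum>t\<in>F. c t * b' t w) \<in> borel_measurable N"
        using F by (intro borel_measurable_lincomb b') auto
      show "distr N borel (\<lambda>w. \<Sum>t\<in>F. c t * b' t w) = distr M borel (\<lambda>w. \<Sum>t\<in>F. c t * b t w)"
        using push[of "\<lambda>p u. ?h p" borel] unfolding eq by simp
    qed (use F in auto)
  qed
  moreover have lawU: "distr N borel (U' i) = distr M borel (U i)" for i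
    using push[of "\<lambda>p u. u i" borel] by simp
  moreover have "N.indep_vars (\<lambda>_. borel) U' UNIV"
  proof -
    have "distr N jump_space (\<lambda>w. \<lambda>i\<in>UNIV. U' i w) = distr M jump_space (\<lambda>w. \<lambda>i\<in>UNIV. U i w)"
      using push[of "\<lambda>p u. u" jump_space] by (simp add: restrict_UNIV)
    then show ?thesis
      using indU by (simp add: M.indep_vars_iff_distr_eq_PiM N.indep_vars_iff_distr_eq_PiM lawU)
  qed
  moreover have "indep_rvs N bridge_space (\<lambda>w. \<lambda>t\<in>{0..1}. b' t w) jump_space (\<lambda>w i. U' i w)"
    by (rule indep_rvs_law_cong[OF M N ind Jb(2) JU(2) law])
  ultimately show ?thesis using unif by (simp add: bridge_and_uniforms_def)
qed

section \<open>Tilting a uniform variable\<close>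

abbreviation "unif \<equiv> uniform_measure lborel {0<..<1::real}"

lemma prob_space_unif: "prob_space unif"
  by (rule prob_space_uniform_measure) auto

lemma integral_unif:
  fixes g :: "real \<Rightarrow> 'b::{banach, second_countable_topology}"
  assumes [measurable]: "g \<in> borel_measurable borel"
  shows "(\<integral>u. g u \<partial>unif) = (\<integral>u. indicator {0<..<1} u *\<^sub>R g u \<partial>lborel)"
proof -
  have "unif = density lborel (\<lambda>u. ennreal (indicator {0<..<1} u))"
    by (simp add: uniform_measure_def divide_ennreal_def ennreal_indicator)
  then show ?thesis by (simp add: integral_density)
qed

lemma expectation_unif_le:
  assumes t: "t \<in> {0..1}"
  shows "(\<integral>u. of_bool (u \<le> t) \<partial>unif) = (t::real)"
proof -
  have "(\<integral>u. of_bool (u \<le> t) \<partial>unif) = (\<integral>u. indicator {0<..<1} u *\<^sub>R of_bool (u \<le> t) \<partial>lborel :: real)"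
    by (rule integral_unif) (simp add: of_bool_def)
  also have "\<dots> = (\<integral>u. indicator {0<..t} u \<partial>lborel)"
  proof (rule integral_cong_AE)
    show "AE u in lborel. indicator {0<..<1} u *\<^sub>R of_bool (u \<le> t) = (indicator {0<..t} u :: real)"
      using AE_lborel_singleton[of 1] by eventually_elim (use t in \<open>auto simp: indicator_def\<close>)
  qed (simp_all add: of_bool_def)
  finally show ?thesis using t by simp
qed

text \<open>
  The tilting density is constant on \<open>(0, T)\<close> and on \<open>(T, 1)\<close>. So the tilted variable falls into \<open>(0, T)\<close>
  with probability \<open>tilted_success_prob T \<theta> \<beta>\<close> and is uniform there, and where it lies in \<open>(T, 1)\<close> does
  not matter for a function that is constant after time \<open>T\<close>.
\<close>

lemma expectation_unif_tilted:
  fixes \<phi> :: "real \<Rightarrow> 'b::{banach, second_countable_topology}"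
  assumes T: "0 < T" "T < 1" and [measurable]: "\<phi> \<in> borel_measurable borel"
    and bd: "\<And>u. norm (\<phi> u) \<le> K" and late: "\<And>u. T < u \<Longrightarrow> \<phi> u = z"
  shows "(\<integral>u. exp (\<theta> * (\<beta> * (of_bool (u \<le> T) - T))) *\<^sub>R \<phi> u \<partial>unif) =
    (exp (- \<theta> * \<beta> * T) * (1 - T) + exp (\<theta> * \<beta> * (1 - T)) * T) *\<^sub>R
    (tilted_success_prob T \<theta> \<beta> *\<^sub>R (\<integral>v. \<phi> (T * v) \<partial>unif) + (1 - tilted_success_prob T \<theta> \<beta>) *\<^sub>R z)"
proof -
  let ?a = "exp (\<theta> * \<beta> * (1 - T))" and ?b = "exp (- \<theta> * \<beta> * T)"
  have ib: "integrable lborel (\<lambda>u. indicator S u *\<^sub>R \<psi> u)" if [measurable]: "\<psi> \<in> borel_measurable borel" "S \<in> sets borel" and S: "S \<subseteq> {0..1}"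
    and "\<And>u. norm (\<psi> u) \<le> K" for S and \<psi> :: "real \<Rightarrow> 'b"
  proof -
    have "integrable lborel (\<lambda>u::real. indicator {0..1} u *\<^sub>R K)" by (intro integrable_scaleR_left integrable_real_indicator) auto
    then show ?thesis
      by (rule Bochner_Integration.integrable_bound) (use that order_trans[OF norm_ge_zero that(4)] in \<open>auto simp: indicator_def subset_iff\<close>)
  qed
  have I1: "integrable lborel (\<lambda>u. ?a *\<^sub>R (indicator {0<..T} u *\<^sub>R \<phi> u))"
    by (intro integrable_scaleR_right ib) (use T bd in auto)
  have I2: "integrable lborel (\<lambda>u. ?b *\<^sub>R (indicator {T<..<1} u *\<^sub>R z))"
    by (intro integrable_scaleR_right integrable_scaleR_left) (use T in auto)
  have "(\<integral>u. exp (\<theta> * (\<beta> * (of_bool (u \<le> T) - T))) *\<^sub>R \<phi> u \<partial>unif) =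
      (\<integral>u. indicator {0<..<1} u *\<^sub>R (exp (\<theta> * (\<beta> * (of_bool (u \<le> T) - T))) *\<^sub>R \<phi> u) \<partial>lborel)"
    by (rule integral_unif) (simp add: of_bool_def)
  also have "\<dots> = (\<integral>u. ?a *\<^sub>R (indicator {0<..T} u *\<^sub>R \<phi> u) + ?b *\<^sub>R (indicator {T<..<1} u *\<^sub>R z) \<partial>lborel)"
    using T late by (intro Bochner_Integration.integral_cong refl) (auto simp: indicator_def algebra_simps)
  also have "\<dots> = ?a *\<^sub>R (\<integral>u. indicator {0<..T} u *\<^sub>R \<phi> u \<partial>lborel) + ?b *\<^sub>R (\<integral>u. indicator {T<..<1} u *\<^sub>R z \<partial>lborel)"
    using I1 I2 by (subst Bochner_Integration.integral_add) (simp_all only: integral_scaleR_right)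
  also have "(\<integral>u. indicator {T<..<1} u *\<^sub>R z \<partial>lborel) = (1 - T) *\<^sub>R z"
    using T by (subst integral_scaleR_left) auto
  also have "(\<integral>u. indicator {0<..T} u *\<^sub>R \<phi> u \<partial>lborel) = \<bar>T\<bar> *\<^sub>R (\<integral>v. indicator {0<..T} (0 + T * v) *\<^sub>R \<phi> (0 + T * v) \<partial>lborel)"
    using T by (intro lborel_integral_real_affine) auto
  also have "(\<integral>v. indicator {0<..T} (0 + T * v) *\<^sub>R \<phi> (0 + T * v) \<partial>lborel) = (\<integral>v. indicator {0<..<1} v *\<^sub>R \<phi> (T * v) \<partial>lborel)"
  proof (rule integral_cong_AE)
    show "AE v in lborel. indicator {0<..T} (0 + T * v) *\<^sub>R \<phi> (0 + T * v) = indicator {0<..<1} v *\<^sub>R \<phi> (T * v)"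
      using AE_lborel_singleton[of 1] by eventually_elim (use T in \<open>auto simp: indicator_def zero_less_mult_iff\<close>)
  qed simp_all
  also have "\<dots> = (\<integral>v. \<phi> (T * v) \<partial>unif)" by (rule integral_unif[symmetric]) simp
  finally have eq: "(\<integral>u. exp (\<theta> * (\<beta> * (of_bool (u \<le> T) - T))) *\<^sub>R \<phi> u \<partial>unif) =
    (?a * T) *\<^sub>R (\<integral>v. \<phi> (T * v) \<partial>unif) + (?b * (1 - T)) *\<^sub>R z"
    using T by simp
  define E where "E = exp (\<theta> * \<beta>)"
  have E: "0 < T * E + (1 - T)" using T by (simp add: E_def add_pos_pos)
  have a: "?a = ?b * E" by (simp add: E_def algebra_simps flip: exp_add)
  have "(?b * (1 - T) + ?a * T) * tilted_success_prob T \<theta> \<beta> = ?a * T"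
    using E unfolding a tilted_success_prob_def E_def[symmetric] by (simp add: field_simps)
  moreover have "(?b * (1 - T) + ?a * T) * (1 - tilted_success_prob T \<theta> \<beta>) = ?b * (1 - T)"
    using calculation by (simp add: right_diff_distrib)
  ultimately show ?thesis unfolding eq by (simp add: scaleR_right_distrib)
qed

section \<open>The product of the exponential moments of the jumps\<close>

text \<open>
  For a uniform variable \<open>U\<close> this is the expectation of \<open>exp (\<theta> * x * (1{U \<le> t} - t))\<close>.
\<close>

definition tilt_factor :: "real \<Rightarrow> real \<Rightarrow> real \<Rightarrow> real" where
  "tilt_factor t \<theta> x = exp (- \<theta> * x * t) * (1 - t) + exp (\<theta> * x * (1 - t)) * t"

text \<open>
  Jensen's inequality for the centred variable in the exponent.
\<close>

lemma tilt_factor_ge_1: "t \<in> {0..1} \<Longrightarrow> 1 \<le> tilt_factor t \<theta> x"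
proof -
  assume t: "t \<in> {0..1}"
  have "(1 + - \<theta> * x * t) * (1 - t) + (1 + \<theta> * x * (1 - t)) * t \<le> tilt_factor t \<theta> x"
    unfolding tilt_factor_def using t by (intro add_mono mult_right_mono exp_ge_add_one_self) auto
  moreover have "(1 + - \<theta> * x * t) * (1 - t) + (1 + \<theta> * x * (1 - t)) * t = 1" by (simp add: algebra_simps)
  ultimately show ?thesis by linarith
qed

lemma exp_le_quadratic:
  fixes y :: real
  assumes "y \<le> 1"
  shows "exp y \<le> 1 + y + y\<^sup>2"
proof (cases "0 \<le> y")
  case True
  then show ?thesis using exp_bound[of y] assms by simp
next
  case False
  define z where "z = - y"
  have z: "0 < z" using False by (simp add: z_def)
  \<comment> \<open>The product equals \<open>1 + z ^ 3\<close>.\<close>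
  have "1 \<le> (1 - z + z\<^sup>2) * (1 + z)" using z by (simp add: algebra_simps power2_eq_square)
  then have *: "1 / (1 + z) \<le> 1 - z + z\<^sup>2" using z by (simp add: divide_le_eq)
  have "exp y = 1 / exp z" by (simp add: z_def exp_minus divide_inverse)
  also have "\<dots> \<le> 1 / (1 + z)" using z exp_ge_add_one_self[of z] by (intro divide_left_mono) (auto simp: add_pos_pos)
  also have "\<dots> \<le> 1 + y + y\<^sup>2" using * by (simp add: z_def)
  finally show ?thesis .
qed

lemma tilt_factor_le:
  assumes t: "t \<in> {0..1}" and x: "\<bar>\<theta> * x\<bar> \<le> 1"
  shows "tilt_factor t \<theta> x \<le> 1 + (\<theta> * x)\<^sup>2"
proof -
  define y where "y = \<theta> * x"
  have y: "\<bar>y\<bar> \<le> 1" using x by (simp add: y_def)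
  have "\<bar>y\<bar> * t \<le> 1 * 1" "\<bar>y\<bar> * (1 - t) \<le> 1 * 1" using y t by (intro mult_mono; simp)+
  then have b: "- y * t \<le> 1" "y * (1 - t) \<le> 1"
    using t abs_le_iff[of "y * t" 1] abs_le_iff[of "y * (1 - t)" 1] by (auto simp: abs_mult)
  have "tilt_factor t \<theta> x = exp (- y * t) * (1 - t) + exp (y * (1 - t)) * t" by (simp add: tilt_factor_def y_def)
  also have "\<dots> \<le> (1 + - y * t + (- y * t)\<^sup>2) * (1 - t) + (1 + y * (1 - t) + (y * (1 - t))\<^sup>2) * t"
    using t b by (intro add_mono mult_right_mono exp_le_quadratic) auto
  also have "\<dots> = 1 + y\<^sup>2 * (t * (1 - t))" by (simp add: algebra_simps power2_eq_square)
  also have "\<dots> \<le> 1 + y\<^sup>2 * 1"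
    using t by (intro add_left_mono mult_left_mono mult_le_one) auto
  finally show ?thesis by (simp add: y_def)
qed

lemma eventually_scaled_le_1:
  assumes "summable (\<lambda>i. (\<beta> i)\<^sup>2)"
  shows "\<forall>\<^sub>F j in sequentially. \<bar>\<theta> * \<beta> j\<bar> \<le> (1::real)"
proof -
  have "(\<lambda>j. sqrt ((\<beta> j)\<^sup>2)) \<longlonglongrightarrow> sqrt 0"
    by (intro tendsto_real_sqrt summable_LIMSEQ_zero assms)
  then have "(\<lambda>j. \<bar>\<theta>\<bar> * \<bar>\<beta> j\<bar>) \<longlonglongrightarrow> \<bar>\<theta>\<bar> * 0" by (intro tendsto_mult tendsto_const) simp
  then have "\<forall>\<^sub>F j in sequentially. \<bar>\<theta>\<bar> * \<bar>\<beta> j\<bar> < 1" by (intro order_tendstoD) auto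
  then show ?thesis by eventually_elim (simp add: abs_mult)
qed

lemma tilt_factor_convergent_prod:
  assumes s: "summable (\<lambda>i. (\<beta> i)\<^sup>2)" and t: "t \<in> {0..1}"
  shows "convergent_prod (\<lambda>j. tilt_factor t \<theta> (\<beta> j))"
proof (rule abs_convergent_prod_imp_convergent_prod, rule summable_imp_abs_convergent_prod)
  show "summable (\<lambda>j. norm (tilt_factor t \<theta> (\<beta> j) - 1))"
  proof (rule summable_comparison_test_ev)
    show "\<forall>\<^sub>F j in sequentially. norm (norm (tilt_factor t \<theta> (\<beta> j) - 1)) \<le> \<theta>\<^sup>2 * (\<beta> j)\<^sup>2"
      using eventually_scaled_le_1[OF s, of \<theta>]
    proof eventually_elim
      case (elim j)
      then show ?case using tilt_factor_le[OF t elim] tilt_factor_ge_1[OF t, of \<theta> "\<beta> j"]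
        by (simp add: power_mult_distrib)
    qed
  qed (intro summable_mult s)
qed

lemma tilt_factor_prod_LIMSEQ:
  assumes s: "summable (\<lambda>i. (\<beta> i)\<^sup>2)" and t: "t \<in> {0..1}"
  shows "(\<lambda>n. \<Prod>j<n. tilt_factor t \<theta> (\<beta> j)) \<longlonglongrightarrow> (\<Prod>j. tilt_factor t \<theta> (\<beta> j))"
  using convergent_prod_LIMSEQ[OF tilt_factor_convergent_prod[OF s t, of \<theta>]]
  unfolding lessThan_Suc_atMost[symmetric] filterlim_sequentially_Suc[of "\<lambda>n. \<Prod>j<n. tilt_factor t \<theta> (\<beta> j)"] .

text \<open>
  Omitting factors decreases the product, because all of them are at least 1. The empty product and
  the one-element products give the lower bounds for the exponential moments, and the initial products
  the uniform upper bound for the partial sums.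
\<close>

lemma tilt_factor_prod_le:
  assumes s: "summable (\<lambda>i. (\<beta> i)\<^sup>2)" and t: "t \<in> {0..1}" and J: "finite J"
  shows "(\<Prod>j\<in>J. tilt_factor t \<theta> (\<beta> j)) \<le> (\<Prod>j. tilt_factor t \<theta> (\<beta> j))"
proof -
  from J obtain m where m: "J \<subseteq> {..<m}" using finite_nat_iff_bounded by blast
  have "(\<Prod>j\<in>J. tilt_factor t \<theta> (\<beta> j)) \<le> (\<Prod>j<n. tilt_factor t \<theta> (\<beta> j))" if "n \<ge> m" for n
    using m that tilt_factor_ge_1[OF t] by (intro prod_mono2) (auto intro: order_trans[OF zero_le_one])
  then show ?thesis by (intro LIMSEQ_le_const[OF tilt_factor_prod_LIMSEQ[OF s t]]) auto
qed

lemma tilt_factor_at_top: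
  assumes t: "0 < t" "t < 1" and x: "x \<noteq> 0"
  shows "filterlim (\<lambda>\<theta>. tilt_factor t \<theta> x) at_top at_top"
proof (cases "0 < x")
  case True
  have "filterlim (\<lambda>\<theta>. exp (\<theta> * (x * (1 - t))) * t) at_top at_top"
  proof (rule filterlim_at_top_mult_tendsto_pos[OF tendsto_const])
    show "filterlim (\<lambda>\<theta>. exp (\<theta> * (x * (1 - t)))) at_top at_top"
      using True t by (intro filterlim_compose[OF exp_at_top] filterlim_at_top_mult_tendsto_pos[OF tendsto_const] filterlim_ident) auto
  qed (use t in simp)
  then show ?thesis
    by (rule filterlim_at_top_mono) (use t in \<open>simp add: tilt_factor_def mult.assoc\<close>)
next
  case False
  have "filterlim (\<lambda>\<theta>. exp (\<theta> * (- x * t)) * (1 - t)) at_top at_top"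
  proof (rule filterlim_at_top_mult_tendsto_pos[OF tendsto_const])
    show "filterlim (\<lambda>\<theta>. exp (\<theta> * (- x * t))) at_top at_top"
      using False x t by (intro filterlim_compose[OF exp_at_top] filterlim_at_top_mult_tendsto_pos[OF tendsto_const] filterlim_ident) 
        (auto simp: mult_neg_pos)
  qed (use t in simp)
  then show ?thesis
    by (rule filterlim_at_top_mono) (use t in \<open>simp add: tilt_factor_def mult.assoc\<close>)
qed

section \<open>Partial sums of an extremal process\<close>

locale ei_noise = prob_space M for M :: "'a measure" +
  fixes b :: "real \<Rightarrow> 'a \<Rightarrow> real" and U :: "nat \<Rightarrow> 'a \<Rightarrow> real" and \<alpha> \<sigma> :: real and \<beta> :: "nat \<Rightarrow> real"
  assumes noise: "bridge_and_uniforms M b U"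
begin

lemma bridge: "brownian_bridge M b"
  and b_measurable [measurable]: "t \<in> {0..1} \<Longrightarrow> b t \<in> borel_measurable M"
  and b_continuous: "w \<in> space M \<Longrightarrow> continuous_on {0..1} (\<lambda>t. b t w)"
  and U_indep: "indep_vars (\<lambda>_. borel) U UNIV"
  and U_unif: "distr M borel (U i) = unif"
  and b_U_indep: "indep_rvs M bridge_space (\<lambda>w. \<lambda>t\<in>{0..1}. b t w) jump_space (\<lambda>w i. U i w)"
  using noise by (auto simp: bridge_and_uniforms_def brownian_bridge_def)

lemma U_measurable [measurable]: "U i \<in> borel_measurable M"
  using U_indep by (auto simp: indep_vars_def)

lemma expectation_U:
  fixes g :: "real \<Rightarrow> 'b::{banach, second_countable_topology}"
  assumes [measurable]: "g \<in> borel_measurable borel"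
  shows "(\<integral>w. g (U j w) \<partial>M) = (\<integral>u. g u \<partial>unif)"
  unfolding U_unif[of j, symmetric] by (rule integral_distr[symmetric]) auto

text \<open>
  All expectations of partial sums, tilted or not, real or complex, are instances of this
  factorisation.
\<close>

lemma expectation_bridge_times_jumps:
  fixes G :: "(real \<Rightarrow> real) \<Rightarrow> 'b::{real_normed_field, banach, second_countable_topology}"
  assumes G [measurable]: "G \<in> borel_measurable bridge_space" and intG: "integrable M (\<lambda>w. G (\<lambda>t\<in>{0..1}. b t w))"
    and H [measurable]: "\<And>j. H j \<in> borel_measurable borel" and bd: "\<And>j u. norm (H j u) \<le> K j"
  shows "integrable M (\<lambda>w. G (\<lambda>t\<in>{0..1}. b t w) * (\<Prod>j<n. H j (U j w)))"
    and "(\<integral>w. G (\<lambda>t\<in>{0..1}. b t w) * (\<Prod>j<n. H j (U j w)) \<partial>M) =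
      (\<integral>w. G (\<lambda>t\<in>{0..1}. b t w) \<partial>M) * (\<Prod>j<n. \<integral>u. H j u \<partial>unif)"
proof -
  have intH: "integrable M (\<lambda>w. H j (U j w))" for j
    by (rule integrable_const_bound[where B="K j"]) (use bd in auto)
  have "indep_vars (\<lambda>_. borel) (\<lambda>j w. H j (U j w)) {..<n}"
    by (rule indep_vars_compose2[OF indep_vars_subset[OF U_indep]]) auto
  note prod = indep_vars_lebesgue_integral[OF _ this intH] indep_vars_integrable[OF _ this intH]
  have ind: "indep_rvs M borel (\<lambda>w. G (\<lambda>t\<in>{0..1}. b t w)) borel (\<lambda>w. \<Prod>j<n. H j (U j w))"
    by (rule indep_rvs_compose[OF prob_space_axioms b_U_indep, where G="\<lambda>u. \<Prod>j<n. H j (u j)"]) auto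
  show "integrable M (\<lambda>w. G (\<lambda>t\<in>{0..1}. b t w) * (\<Prod>j<n. H j (U j w)))"
    by (rule indep_rvs_integral_mult[OF prob_space_axioms ind intG prod(2)]) auto
  show "(\<integral>w. G (\<lambda>t\<in>{0..1}. b t w) * (\<Prod>j<n. H j (U j w)) \<partial>M) =
      (\<integral>w. G (\<lambda>t\<in>{0..1}. b t w) \<partial>M) * (\<Prod>j<n. \<integral>u. H j u \<partial>unif)"
    using indep_rvs_integral_mult(2)[OF prob_space_axioms ind intG prod(2)] prod(1)
    by (simp add: expectation_U)
qed

lemma AE_summable_jumps:
  assumes c: "summable (\<lambda>j. (c j)\<^sup>2)" and t: "t \<in> {0..1}"
  shows "AE w in M. summable (\<lambda>j. c j * (of_bool (U j w \<le> t) - t))"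
proof (rule AE_summable_of_summable_variances)
  have [measurable]: "(\<lambda>u. c j * (of_bool (u \<le> t) - t)) \<in> borel_measurable borel" for j
    by (simp add: of_bool_def)
  show "indep_vars (\<lambda>_. borel) (\<lambda>j w. c j * (of_bool (U j w \<le> t) - t)) UNIV"
    by (rule indep_vars_compose2[OF U_indep]) simp
  have le: "(c j * (of_bool (U j w \<le> t) - t))\<^sup>2 \<le> (c j)\<^sup>2" for j w
  proof -
    have "(of_bool (U j w \<le> t) - t)\<^sup>2 \<le> 1" using t by (auto simp: abs_square_le_1)
    then show ?thesis unfolding power_mult_distrib by (intro mult_left_le) auto
  qed
  show int: "integrable M (\<lambda>w. (c j * (of_bool (U j w \<le> t) - t))\<^sup>2)" for j
    by (rule integrable_const_bound[where B="(c j)\<^sup>2"]) (use le in \<open>auto simp: of_bool_def\<close>)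
  show "expectation (\<lambda>w. c j * (of_bool (U j w \<le> t) - t)) = 0" for j
  proof -
    interpret unif: prob_space unif by (rule prob_space_unif)
    have "integrable unif (\<lambda>u. of_bool (u \<le> t) :: real)"
      by (rule unif.integrable_const_bound[where B=1]) (auto simp: of_bool_def)
    then have "(\<integral>u. c j * (of_bool (u \<le> t) - t) \<partial>unif) = 0"
      by (simp add: expectation_unif_le[OF t] unif.prob_space)
    then show ?thesis by (subst expectation_U[of "\<lambda>u. c j * (of_bool (u \<le> t) - t)" j]) auto
  qed
  show "summable (\<lambda>j. expectation (\<lambda>w. (c j * (of_bool (U j w \<le> t) - t))\<^sup>2))"
  proof (rule summable_comparison_test[OF _ c], intro exI allI impI)
    fix j
    have "expectation (\<lambda>w. (c j * (of_bool (U j w \<le> t) - t))\<^sup>2) \<le> expectation (\<lambda>w. (c j)\<^sup>2)"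
      by (intro integral_mono int le) auto
    then show "norm (expectation (\<lambda>w. (c j * (of_bool (U j w \<le> t) - t))\<^sup>2)) \<le> (c j)\<^sup>2"
      by (simp add: prob_space)
  qed
qed

definition partial_ei :: "nat \<Rightarrow> real \<Rightarrow> 'a \<Rightarrow> real" where
  "partial_ei n t w = \<alpha> * t + \<sigma> * b t w + (\<Sum>j<n. \<beta> j * (of_bool (U j w \<le> t) - t))"

lemma partial_ei_measurable [measurable]: "t \<in> {0..1} \<Longrightarrow> partial_ei n t \<in> borel_measurable M"
  unfolding partial_ei_def of_bool_def by measurable

lemma partial_ei_exp:
  assumes t: "t \<in> {0..1}"
  shows "integrable M (\<lambda>w. exp (\<theta> * partial_ei n t w))"
    and "(\<integral>w. exp (\<theta> * partial_ei n t w) \<partial>M) =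
      exp (\<alpha> * \<theta> * t + \<theta>\<^sup>2 * \<sigma>\<^sup>2 * t * (1 - t) / 2) * (\<Prod>j<n. tilt_factor t \<theta> (\<beta> j))"
proof -
  let ?G = "\<lambda>p. exp (\<theta> * \<sigma> * p t) :: real" and ?H = "\<lambda>j u. exp (\<theta> * (\<beta> j * (of_bool (u \<le> t) - t))) :: real"
  have G: "?G \<in> borel_measurable bridge_space"
    using t by (auto intro!: borel_measurable_exp borel_measurable_times measurable_component_singleton)
  have H: "?H j \<in> borel_measurable borel" for j by (simp add: of_bool_def)
  have bd: "norm (?H j u) \<le> exp (\<bar>\<theta> * \<beta> j\<bar>)" for j u
  proof -
    have "\<theta> * (\<beta> j * (of_bool (u \<le> t) - t)) \<le> \<bar>\<theta> * \<beta> j\<bar> * \<bar>of_bool (u \<le> t) - t\<bar>"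
      using abs_ge_self[of "\<theta> * \<beta> j * (of_bool (u \<le> t) - t)"] by (simp add: abs_mult mult.assoc)
    also have "\<dots> \<le> \<bar>\<theta> * \<beta> j\<bar>" using t by (intro mult_left_le) auto
    finally show ?thesis by simp
  qed
  have intG: "integrable M (\<lambda>w. ?G (\<lambda>t\<in>{0..1}. b t w))"
    using bridge_exp(1)[OF prob_space_axioms bridge t, of "\<theta> * \<sigma>"] t by simp
  note * = expectation_bridge_times_jumps[of ?G ?H, OF G intG H bd, of n]
  have eq: "exp (\<theta> * partial_ei n t w) =
    exp (\<alpha> * \<theta> * t) * (?G (\<lambda>t\<in>{0..1}. b t w) * (\<Prod>j<n. ?H j (U j w)))" for w
    using t by (simp add: partial_ei_def exp_sum[symmetric] exp_add[symmetric] sum_distrib_left algebra_simps)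
  show "integrable M (\<lambda>w. exp (\<theta> * partial_ei n t w))"
    unfolding eq using *(1) by (rule integrable_mult_right)
  have Hint: "(\<integral>u. ?H j u \<partial>unif) = tilt_factor t \<theta> (\<beta> j)" for j
  proof -
    interpret unif: prob_space unif by (rule prob_space_unif)
    have i: "integrable unif (\<lambda>u. of_bool (u \<le> t) :: real)"
      by (rule unif.integrable_const_bound[where B=1]) (auto simp: of_bool_def)
    have "?H j u = (exp (\<theta> * \<beta> j * (1 - t)) - exp (- \<theta> * \<beta> j * t)) * of_bool (u \<le> t) + exp (- \<theta> * \<beta> j * t)" for u
      by (auto simp: algebra_simps)
    then have "(\<integral>u. ?H j u \<partial>unif) = (\<integral>u. (exp (\<theta> * \<beta> j * (1 - t)) - exp (- \<theta> * \<beta> j * t)) * of_bool (u \<le> t) + exp (- \<theta> * \<beta> j * t) \<partial>unif)"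
      by (simp only:)
    also have "\<dots> = (exp (\<theta> * \<beta> j * (1 - t)) - exp (- \<theta> * \<beta> j * t)) * t + exp (- \<theta> * \<beta> j * t)"
      using i by (simp add: expectation_unif_le[OF t] unif.prob_space)
    finally show ?thesis by (simp add: tilt_factor_def algebra_simps)
  qed
  have "(\<integral>w. exp (\<theta> * partial_ei n t w) \<partial>M) =
    exp (\<alpha> * \<theta> * t) * (expectation (\<lambda>w. ?G (\<lambda>t\<in>{0..1}. b t w)) * (\<Prod>j<n. tilt_factor t \<theta> (\<beta> j)))"
    unfolding eq using *(2) by (simp add: Hint)
  also have "expectation (\<lambda>w. ?G (\<lambda>t\<in>{0..1}. b t w)) = exp (\<theta>\<^sup>2 * \<sigma>\<^sup>2 * t * (1 - t) / 2)"
    using bridge_exp(2)[OF prob_space_axioms bridge t, of "\<theta> * \<sigma>"] t by (simp add: power_mult_distrib mult.assoc)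
  finally show "(\<integral>w. exp (\<theta> * partial_ei n t w) \<partial>M) =
      exp (\<alpha> * \<theta> * t + \<theta>\<^sup>2 * \<sigma>\<^sup>2 * t * (1 - t) / 2) * (\<Prod>j<n. tilt_factor t \<theta> (\<beta> j))"
    by (simp add: exp_add)
qed

text \<open>
  The factor by which a jump of size \<open>x\<close> at time \<open>v\<close> enters the characteristic function of a linear
  combination of values of the process.
\<close>

definition jump_char :: "real set \<Rightarrow> (real \<Rightarrow> real) \<Rightarrow> real \<Rightarrow> real \<Rightarrow> complex" where
  "jump_char F u x v = iexp (\<Sum>t\<in>F. u t * (x * (of_bool (v \<le> t) - t)))"

lemma jump_char_measurable [measurable]: "jump_char F u x \<in> borel_measurable borel"
  unfolding jump_char_def of_bool_def by measurable

lemma norm_jump_char: "norm (jump_char F u x v) = 1"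
  by (simp add: jump_char_def)

text \<open>
  The characteristic functions of the tilted partial sums: a deterministic drift, the covariance of
  the bridge, and for each jump a mixture according to whether it occurs before time \<open>T\<close>. The summand
  \<open>\<theta> * \<sigma>\<^sup>2 * (1 - T)\<close> of the drift is the mean shift of the bridge, since
  \<open>bridge_cov T t = t * (1 - T)\<close> for \<open>t \<le> T\<close>.
\<close>

definition tilted_sum_char :: "real \<Rightarrow> real \<Rightarrow> nat \<Rightarrow> real set \<Rightarrow> (real \<Rightarrow> real) \<Rightarrow> complex" where
  "tilted_sum_char T \<theta> n F u =
    iexp ((\<alpha> + \<theta> * \<sigma>\<^sup>2 * (1 - T)) * (\<Sum>t\<in>F. u t * t)) *
      of_real (exp (- (\<sigma>\<^sup>2 * bridge_var F u) / 2)) *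
      (\<Prod>j<n. of_real (tilted_success_prob T \<theta> (\<beta> j)) * (\<integral>v. jump_char F u (\<beta> j) (T * v) \<partial>unif)
        + of_real (1 - tilted_success_prob T \<theta> (\<beta> j)) * iexp (- (\<Sum>t\<in>F. u t * (\<beta> j * t))))"

lemma partial_ei_tilted_char:
  assumes T: "0 < T" "T < 1" and F: "finite F" "F \<subseteq> {0..T}" "T \<in> F"
  shows "(\<integral>w. exp (\<theta> * partial_ei n T w) *\<^sub>R iexp (\<Sum>t\<in>F. u t * partial_ei n t w) \<partial>M) =
    of_real (\<integral>w. exp (\<theta> * partial_ei n T w) \<partial>M) *
    tilted_sum_char T \<theta> n F u"
proof -
  let ?G = "\<lambda>p. exp (\<theta> * \<sigma> * p T) *\<^sub>R iexp (\<Sum>t\<in>F. (u t * \<sigma>) * p t)"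
  let ?H = "\<lambda>j v. exp (\<theta> * (\<beta> j * (of_bool (v \<le> T) - T))) *\<^sub>R jump_char F u (\<beta> j) v"
  have T01: "T \<in> {0..1}" and F01: "F \<subseteq> {0..1}" using T F by auto
  have comp: "(\<lambda>p. p t) \<in> borel_measurable bridge_space" if "t \<in> {0..1}" for t
    using that by (rule measurable_component_singleton)
  have [measurable]: "(\<lambda>p. p T) \<in> borel_measurable bridge_space" by (rule comp[OF T01])
  have [measurable]: "(\<lambda>p. \<Sum>t\<in>F. (u t * \<sigma>) * p t) \<in> borel_measurable bridge_space"
    using F01 by (intro borel_measurable_lincomb comp) auto
  have G: "?G \<in> borel_measurable bridge_space" by measurable
  have H: "?H j \<in> borel_measurable borel" for j unfolding of_bool_def by measurable
  have bd: "norm (?H j v) \<le> exp (\<bar>\<theta> * \<beta> j\<bar>)" for j v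
  proof -
    have "\<theta> * (\<beta> j * (of_bool (v \<le> T) - T)) \<le> \<bar>\<theta> * \<beta> j\<bar> * \<bar>of_bool (v \<le> T) - T\<bar>"
      using abs_ge_self[of "\<theta> * \<beta> j * (of_bool (v \<le> T) - T)"] by (simp add: abs_mult mult.assoc)
    also have "\<dots> \<le> \<bar>\<theta> * \<beta> j\<bar>" using T by (intro mult_left_le) auto
    finally show ?thesis by (simp add: norm_jump_char)
  qed
  have restr: "?G (\<lambda>t\<in>{0..1}. b t w) = exp (\<theta> * \<sigma> * b T w) *\<^sub>R iexp (\<Sum>t\<in>F. (u t * \<sigma>) * b t w)" for w
  proof -
    have "(\<Sum>t\<in>F. (u t * \<sigma>) * (\<lambda>t\<in>{0..1}. b t w) t) = (\<Sum>t\<in>F. (u t * \<sigma>) * b t w)"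
      using F01 by (intro sum.cong) auto
    then show ?thesis using T01 by (simp only: restrict_apply if_True)
  qed
  have [measurable]: "b T \<in> borel_measurable M" "(\<lambda>w. \<Sum>t\<in>F. (u t * \<sigma>) * b t w) \<in> borel_measurable M"
    using F01 T01 by (auto intro!: borel_measurable_lincomb b_measurable)
  have intG: "integrable M (\<lambda>w. ?G (\<lambda>t\<in>{0..1}. b t w))"
    unfolding restr
  proof (rule Bochner_Integration.integrable_bound[OF bridge_exp(1)[OF prob_space_axioms bridge T01, of "\<theta> * \<sigma>"]])
    show "(\<lambda>w. exp (\<theta> * \<sigma> * b T w) *\<^sub>R iexp (\<Sum>t\<in>F. (u t * \<sigma>) * b t w)) \<in> borel_measurable M" by measurable
  qed simp
  note * = expectation_bridge_times_jumps[of ?G ?H, OF G intG H bd, of n]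
  have eq: "exp (\<theta> * partial_ei n T w) *\<^sub>R iexp (\<Sum>t\<in>F. u t * partial_ei n t w) =
    (of_real (exp (\<alpha> * \<theta> * T)) * iexp (\<alpha> * (\<Sum>t\<in>F. u t * t))) * (?G (\<lambda>t\<in>{0..1}. b t w) * (\<Prod>j<n. ?H j (U j w)))" for w
  proof -
    have r: "exp (\<theta> * partial_ei n T w) =
      exp (\<alpha> * \<theta> * T) * exp (\<theta> * \<sigma> * b T w) * (\<Prod>j<n. exp (\<theta> * (\<beta> j * (of_bool (U j w \<le> T) - T))))"
      by (simp add: partial_ei_def exp_sum[symmetric] exp_add[symmetric] sum_distrib_left algebra_simps)
    have s: "(\<Sum>t\<in>F. u t * partial_ei n t w) = \<alpha> * (\<Sum>t\<in>F. u t * t) + (\<Sum>t\<in>F. (u t * \<sigma>) * b t w)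
       + (\<Sum>j<n. \<Sum>t\<in>F. u t * (\<beta> j * (of_bool (U j w \<le> t) - t)))"
      by (subst sum.swap) (simp add: partial_ei_def distrib_left sum.distrib sum_distrib_left mult_ac)
    have "iexp (\<Sum>t\<in>F. u t * partial_ei n t w) = iexp (\<alpha> * (\<Sum>t\<in>F. u t * t)) * iexp (\<Sum>t\<in>F. (u t * \<sigma>) * b t w)
       * (\<Prod>j<n. jump_char F u (\<beta> j) (U j w))"
      unfolding s jump_char_def by (simp only: of_real_add distrib_left exp_add of_real_sum[of _ "{..<n}"] sum_distrib_left[of \<i> _ "{..<n}"] exp_sum[OF finite_lessThan])
    then show ?thesis
      unfolding restr unfolding r scaleR_conv_of_real of_real_mult of_real_prod prod.distrib by (simp only: mult_ac)
  qed
  define f where "f = (\<lambda>j. tilt_factor T \<theta> (\<beta> j))"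
  define q where "q = (\<lambda>j. of_real (tilted_success_prob T \<theta> (\<beta> j)) * (\<integral>v. jump_char F u (\<beta> j) (T * v) \<partial>unif)
        + of_real (1 - tilted_success_prob T \<theta> (\<beta> j)) * iexp (- (\<Sum>t\<in>F. u t * (\<beta> j * t))))"
  have HH: "(\<integral>v. ?H j v \<partial>unif) = of_real (f j) * q j" for j
  proof -
    have late: "jump_char F u (\<beta> j) v = iexp (- (\<Sum>t\<in>F. u t * (\<beta> j * t)))" if "T < v" for v
    proof -
      have "(\<Sum>t\<in>F. u t * (\<beta> j * (of_bool (v \<le> t) - t))) = (\<Sum>t\<in>F. - (u t * (\<beta> j * t)))"
        using F that by (intro sum.cong) auto
      then show ?thesis by (simp only: jump_char_def sum_negf)
    qed
    show ?thesis
      using expectation_unif_tilted[of T "jump_char F u (\<beta> j)" 1 "iexp (- (\<Sum>t\<in>F. u t * (\<beta> j * t)))" \<theta> "\<beta> j"] T late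
      unfolding norm_jump_char f_def tilt_factor_def q_def scaleR_conv_of_real by simp
  qed
  have GG: "expectation (\<lambda>w. ?G (\<lambda>t\<in>{0..1}. b t w)) =
    of_real (exp (\<theta>\<^sup>2 * \<sigma>\<^sup>2 * T * (1 - T) / 2)) * (iexp (\<theta> * \<sigma>\<^sup>2 * (1 - T) * (\<Sum>t\<in>F. u t * t)) *
      of_real (exp (- (\<sigma>\<^sup>2 * bridge_var F u) / 2)))"
  proof -
    have "expectation (\<lambda>w. ?G (\<lambda>t\<in>{0..1}. b t w)) =
      exp ((of_real ((\<theta> * \<sigma>)\<^sup>2 * (T * (1 - T)) - (\<Sum>s\<in>F. \<Sum>t\<in>F. (u s * \<sigma>) * (u t * \<sigma>) * bridge_cov s t))
        + 2 * \<i> * of_real (\<theta> * \<sigma> * (\<Sum>t\<in>F. (u t * \<sigma>) * bridge_cov T t))) / 2)"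
      unfolding restr by (rule bridge_tilted_char[OF prob_space_axioms bridge F(1) F01 F(3) T])
    also have "(\<Sum>s\<in>F. \<Sum>t\<in>F. (u s * \<sigma>) * (u t * \<sigma>) * bridge_cov s t) = \<sigma>\<^sup>2 * bridge_var F u"
      by (simp add: sum_distrib_left power2_eq_square mult_ac)
    also have "(\<Sum>t\<in>F. (u t * \<sigma>) * bridge_cov T t) = \<sigma> * (1 - T) * (\<Sum>t\<in>F. u t * t)"
      unfolding sum_distrib_left using F(2) by (intro sum.cong) (auto simp: bridge_cov_def min_def algebra_simps)
    also have "exp ((of_real ((\<theta> * \<sigma>)\<^sup>2 * (T * (1 - T)) - \<sigma>\<^sup>2 * bridge_var F u)
        + 2 * \<i> * of_real (\<theta> * \<sigma> * (\<sigma> * (1 - T) * (\<Sum>t\<in>F. u t * t)))) / 2) =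
       exp (of_real (\<theta>\<^sup>2 * \<sigma>\<^sup>2 * T * (1 - T) / 2) + (\<i> * of_real (\<theta> * \<sigma>\<^sup>2 * (1 - T) * (\<Sum>t\<in>F. u t * t))
        + of_real (- (\<sigma>\<^sup>2 * bridge_var F u) / 2)))"
      by (intro arg_cong[where f=exp]) (simp add: complex_eq_iff power2_eq_square field_simps)
    finally show ?thesis by (simp only: exp_add exp_of_real)
  qed
  have "(\<integral>w. exp (\<theta> * partial_ei n T w) *\<^sub>R iexp (\<Sum>t\<in>F. u t * partial_ei n t w) \<partial>M) =
    (of_real (exp (\<alpha> * \<theta> * T)) * iexp (\<alpha> * (\<Sum>t\<in>F. u t * t))) *
    (expectation (\<lambda>w. ?G (\<lambda>t\<in>{0..1}. b t w)) * (\<Prod>j<n. \<integral>v. ?H j v \<partial>unif))"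
    unfolding eq integral_mult_right_zero *(2) ..
  also have "\<dots> = of_real (exp (\<alpha> * \<theta> * T) * exp (\<theta>\<^sup>2 * \<sigma>\<^sup>2 * T * (1 - T) / 2) * (\<Prod>j<n. f j)) *
    ((iexp (\<alpha> * (\<Sum>t\<in>F. u t * t)) * iexp (\<theta> * \<sigma>\<^sup>2 * (1 - T) * (\<Sum>t\<in>F. u t * t))) *
      of_real (exp (- (\<sigma>\<^sup>2 * bridge_var F u) / 2)) * (\<Prod>j<n. q j))"
    unfolding GG HH prod.distrib of_real_mult of_real_prod by (simp only: mult_ac)
  also have "exp (\<alpha> * \<theta> * T) * exp (\<theta>\<^sup>2 * \<sigma>\<^sup>2 * T * (1 - T) / 2) * (\<Prod>j<n. f j) = (\<integral>w. exp (\<theta> * partial_ei n T w) \<partial>M)"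
    unfolding partial_ei_exp(2)[OF T01] exp_add f_def ..
  also have "iexp (\<alpha> * (\<Sum>t\<in>F. u t * t)) * iexp (\<theta> * \<sigma>\<^sup>2 * (1 - T) * (\<Sum>t\<in>F. u t * t)) =
    iexp ((\<alpha> + \<theta> * \<sigma>\<^sup>2 * (1 - T)) * (\<Sum>t\<in>F. u t * t))"
    by (simp only: exp_add[symmetric] distrib_left[symmetric] of_real_add[symmetric] distrib_right)
  finally show ?thesis unfolding q_def tilted_sum_char_def .
qed

end

section \<open>Exponential moments of an extremal process\<close>

locale extremal_ei = ei_noise +
  fixes X :: "real \<Rightarrow> 'a \<Rightarrow> real"
  assumes square_summable: "summable (\<lambda>i. (\<beta> i)\<^sup>2)"
    and series: "ei_series M 1 (\<lambda>_. \<alpha>) (\<lambda>_. \<sigma>) (\<lambda>i _. \<beta> i) b U X"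
begin

lemma X_measurable [measurable]: "t \<in> {0..1} \<Longrightarrow> X t \<in> borel_measurable M"
  using series by (simp add: ei_series_def)

lemma partial_ei_LIMSEQ:
  assumes t: "t \<in> {0..1}"
  shows "AE w in M. (\<lambda>n. partial_ei n t w) \<longlonglongrightarrow> X t w"
proof -
  have "AE w in M. (\<lambda>j. \<beta> j * (of_bool (U j w \<le> t) - t)) sums (X t w - (\<alpha> * t + \<sigma> * b t w))"
    using series t by (simp add: ei_series_def)
  then show ?thesis
  proof eventually_elim
    case (elim w)
    then have "(\<lambda>n. (\<alpha> * t + \<sigma> * b t w) + (\<Sum>j<n. \<beta> j * (of_bool (U j w \<le> t) - t)))
      \<longlonglongrightarrow> (\<alpha> * t + \<sigma> * b t w) + (X t w - (\<alpha> * t + \<sigma> * b t w))"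
      unfolding sums_def by (intro tendsto_add tendsto_const)
    then show ?case by (simp add: partial_ei_def)
  qed
qed

text \<open>
  At \<open>2 * \<theta>\<close> this bounds the second moments of the exponentials at \<open>\<theta>\<close>, uniformly in \<open>n\<close>.
\<close>

lemma partial_ei_exp_bounded:
  assumes t: "t \<in> {0..1}"
  shows "(\<integral>w. exp (\<theta> * partial_ei n t w) \<partial>M) \<le>
     exp (\<alpha> * \<theta> * t + \<theta>\<^sup>2 * \<sigma>\<^sup>2 * t * (1 - t) / 2) * (\<Prod>j. tilt_factor t \<theta> (\<beta> j))"
  unfolding partial_ei_exp(2)[OF t]
  by (intro mult_left_mono tilt_factor_prod_le square_summable t) auto

lemma X_exp:
  assumes t: "t \<in> {0..1}"
  shows "integrable M (\<lambda>w. exp (\<theta> * X t w))"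
    and "(\<lambda>n. \<integral>w. exp (\<theta> * partial_ei n t w) \<partial>M) \<longlonglongrightarrow> (\<integral>w. exp (\<theta> * X t w) \<partial>M)"
    and "(\<integral>w. exp (\<theta> * X t w) \<partial>M) =
      exp (\<alpha> * \<theta> * t + \<theta>\<^sup>2 * \<sigma>\<^sup>2 * t * (1 - t) / 2) * (\<Prod>j. tilt_factor t \<theta> (\<beta> j))"
proof -
  note [measurable] = X_measurable[OF t] partial_ei_measurable[OF t]
  have sq: "(norm (exp (\<theta> * y)))\<^sup>2 = exp (2 * \<theta> * y)" for y :: real
    by (simp add: power2_eq_square flip: exp_add)
  note L = L1_limit_of_L2_bounded[OF finite_measure_axioms, of "\<lambda>n w. exp (\<theta> * partial_ei n t w)" "\<lambda>w. exp (\<theta> * X t w)",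
    unfolded sq, OF _ _ _ partial_ei_exp(1)[OF t] partial_ei_exp_bounded[OF t]]
  have AE: "AE w in M. (\<lambda>n. exp (\<theta> * partial_ei n t w)) \<longlonglongrightarrow> exp (\<theta> * X t w)"
    using partial_ei_LIMSEQ[OF t] by eventually_elim (intro tendsto_intros)
  show "integrable M (\<lambda>w. exp (\<theta> * X t w))" by (rule L(1)[OF _ _ AE]) simp_all
  show lim: "(\<lambda>n. \<integral>w. exp (\<theta> * partial_ei n t w) \<partial>M) \<longlonglongrightarrow> (\<integral>w. exp (\<theta> * X t w) \<partial>M)"
    by (rule L(3)[OF _ _ AE]) simp_all
  have "(\<lambda>n. \<integral>w. exp (\<theta> * partial_ei n t w) \<partial>M) \<longlonglongrightarrow>
    exp (\<alpha> * \<theta> * t + \<theta>\<^sup>2 * \<sigma>\<^sup>2 * t * (1 - t) / 2) * (\<Prod>j. tilt_factor t \<theta> (\<beta> j))"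
    unfolding partial_ei_exp(2)[OF t]
    by (intro tendsto_mult tendsto_const tilt_factor_prod_LIMSEQ square_summable t)
  then show "(\<integral>w. exp (\<theta> * X t w) \<partial>M) =
      exp (\<alpha> * \<theta> * t + \<theta>\<^sup>2 * \<sigma>\<^sup>2 * t * (1 - t) / 2) * (\<Prod>j. tilt_factor t \<theta> (\<beta> j))"
    by (rule LIMSEQ_unique[OF lim])
qed

lemma X_tilted_char_LIMSEQ:
  assumes T: "T \<in> {0..1}" and F: "finite F" "F \<subseteq> {0..1}"
  shows "(\<lambda>n. \<integral>w. exp (\<theta> * partial_ei n T w) *\<^sub>R iexp (\<Sum>t\<in>F. u t * partial_ei n t w) \<partial>M)
    \<longlonglongrightarrow> (\<integral>w. exp (\<theta> * X T w) *\<^sub>R iexp (\<Sum>t\<in>F. u t * X t w) \<partial>M)"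
proof -
  note [measurable] = X_measurable[OF T] partial_ei_measurable[OF T]
  have [measurable]: "(\<lambda>w. \<Sum>t\<in>F. u t * X t w) \<in> borel_measurable M"
    using F by (intro borel_measurable_lincomb X_measurable) auto
  have [measurable]: "(\<lambda>w. \<Sum>t\<in>F. u t * partial_ei n t w) \<in> borel_measurable M" for n
    using F by (intro borel_measurable_lincomb partial_ei_measurable) auto
  have sq: "(norm (exp (\<theta> * y) *\<^sub>R iexp z))\<^sup>2 = exp (2 * \<theta> * y)" for y z :: real
    by (simp add: power2_eq_square flip: exp_add)
  note L = L1_limit_of_L2_bounded[OF finite_measure_axioms,
    of "\<lambda>n w. exp (\<theta> * partial_ei n T w) *\<^sub>R iexp (\<Sum>t\<in>F. u t * partial_ei n t w)"
       "\<lambda>w. exp (\<theta> * X T w) *\<^sub>R iexp (\<Sum>t\<in>F. u t * X t w)",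
    unfolded sq, OF _ _ _ partial_ei_exp(1)[OF T] partial_ei_exp_bounded[OF T]]
  have "AE w in M. \<forall>t\<in>F. (\<lambda>n. partial_ei n t w) \<longlonglongrightarrow> X t w"
    by (rule AE_finite_allI[OF F(1)]) (use F partial_ei_LIMSEQ in auto)
  with partial_ei_LIMSEQ[OF T]
  have AE: "AE w in M. (\<lambda>n. exp (\<theta> * partial_ei n T w) *\<^sub>R iexp (\<Sum>t\<in>F. u t * partial_ei n t w))
    \<longlonglongrightarrow> exp (\<theta> * X T w) *\<^sub>R iexp (\<Sum>t\<in>F. u t * X t w)"
    by eventually_elim (intro tendsto_intros; simp)
  show ?thesis by (rule L(3)[OF _ _ AE]) measurable
qed

end

section \<open>The tilted jump indicators\<close>

lemma tilted_success_prob_bounds: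
  assumes "0 < T" "T < 1"
  shows "0 \<le> tilted_success_prob T \<theta> x" "tilted_success_prob T \<theta> x \<le> 1"
  using assms by (auto simp: tilted_success_prob_def divide_le_eq_1 add_pos_pos intro!: divide_nonneg_nonneg)

text \<open>
  The probability equals \<open>T\<close> at \<open>\<theta> * x = 0\<close> and varies at a bounded rate. So replacing the mean of \<open>B j\<close>
  by \<open>T\<close> changes the series for the drift by terms of order \<open>(\<beta> j)\<^sup>2\<close>, which are summable.
\<close>

lemma tilted_success_prob_diff_le:
  assumes T: "0 < T" "T < 1" and x: "\<bar>\<theta> * x\<bar> \<le> 1"
  shows "\<bar>tilted_success_prob T \<theta> x - T\<bar> \<le> 2 * \<bar>\<theta> * x\<bar>"
proof -
  define y where "y = \<theta> * x"
  have y: "\<bar>y\<bar> \<le> 1" using x by (simp add: y_def)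
  define D where "D = T * exp y + (1 - T)"
  have D: "1 - T \<le> D" "0 < D" using T by (auto simp: D_def add_pos_pos)
  have e: "\<bar>exp y - 1\<bar> \<le> 2 * \<bar>y\<bar>"
  proof -
    have "y\<^sup>2 \<le> \<bar>y\<bar>"
      using mult_left_le[OF y, of "\<bar>y\<bar>"] by (simp add: power2_eq_square flip: abs_mult)
    then show ?thesis using exp_le_quadratic[of y] exp_ge_add_one_self[of y] y by (intro abs_leI) linarith+
  qed
  have "tilted_success_prob T \<theta> x - T = T * (1 - T) * (exp y - 1) / D"
  proof -
    have "tilted_success_prob T \<theta> x - T = T * exp y / D - T"
      by (simp add: tilted_success_prob_def y_def D_def)
    also have "\<dots> = (T * exp y - T * D) / D" using D by (simp add: diff_divide_distrib)
    also have "T * exp y - T * D = T * (1 - T) * (exp y - 1)" by (simp add: D_def algebra_simps)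
    finally show ?thesis .
  qed
  then have "\<bar>tilted_success_prob T \<theta> x - T\<bar> = T * (1 - T) * \<bar>exp y - 1\<bar> / D"
    using T D by (simp add: abs_mult)
  also have "\<dots> \<le> T * D * \<bar>exp y - 1\<bar> / D"
    using T D by (intro divide_right_mono mult_right_mono mult_left_mono) auto
  also have "\<dots> = T * \<bar>exp y - 1\<bar>" using D by simp
  also have "\<dots> \<le> \<bar>exp y - 1\<bar>" using T by (intro mult_left_le_one_le) auto
  also note e
  finally show ?thesis by (simp add: y_def)
qed

locale tilted_jumps = prob_space N for N :: "'v measure" +
  fixes B :: "nat \<Rightarrow> 'v \<Rightarrow> bool" and \<beta> :: "nat \<Rightarrow> real" and T \<theta> :: real
  assumes B_indep: "indep_vars (\<lambda>_. count_space UNIV) B UNIV"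
    and B_law: "\<And>j. distr N (count_space UNIV) (B j) = measure_pmf (bernoulli_pmf (tilted_success_prob T \<theta> (\<beta> j)))"
    and T: "0 < T" "T < 1" and square_summable: "summable (\<lambda>i. (\<beta> i)\<^sup>2)"
begin

abbreviation "success_prob j \<equiv> tilted_success_prob T \<theta> (\<beta> j)"

abbreviation "drift_term j \<eta> \<equiv> \<beta> j * (of_bool (B j \<eta>) - T)"

lemma B_measurable [measurable]: "B j \<in> measurable N (count_space UNIV)"
  using B_indep by (auto simp: indep_vars_def)

lemma expectation_B:
  fixes g :: "bool \<Rightarrow> 'b::{banach, second_countable_topology}"
  shows "(\<integral>\<eta>. g (B j \<eta>) \<partial>N) = success_prob j *\<^sub>R g True + (1 - success_prob j) *\<^sub>R g False"
proof -
  have "(\<integral>\<eta>. g (B j \<eta>) \<partial>N) = (\<integral>c. g c \<partial>distr N (count_space UNIV) (B j))"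
    by (rule integral_distr[symmetric]) auto
  also have "\<dots> = (\<Sum>c\<in>UNIV. pmf (bernoulli_pmf (success_prob j)) c *\<^sub>R g c)"
    unfolding B_law by (rule integral_measure_pmf) auto
  finally show ?thesis
    using tilted_success_prob_bounds[OF T] by (simp add: UNIV_bool add.commute)
qed

lemma summable_mean_shift: "summable (\<lambda>j. \<beta> j * (success_prob j - T))"
proof (rule summable_comparison_test_ev)
  show "\<forall>\<^sub>F j in sequentially. norm (\<beta> j * (success_prob j - T)) \<le> 2 * \<bar>\<theta>\<bar> * (\<beta> j)\<^sup>2"
    using eventually_scaled_le_1[OF square_summable, of \<theta>]
  proof eventually_elim
    case (elim j)
    have "\<bar>\<beta> j\<bar> * \<bar>success_prob j - T\<bar> \<le> \<bar>\<beta> j\<bar> * (2 * \<bar>\<theta> * \<beta> j\<bar>)"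
      by (intro mult_left_mono tilted_success_prob_diff_le T elim) auto
    also have "\<dots> = 2 * \<bar>\<theta>\<bar> * (\<beta> j)\<^sup>2" by (simp add: abs_mult power2_eq_square)
    finally show ?case by (simp add: abs_mult)
  qed
qed (intro summable_mult square_summable)

lemma centered_jumps:
  defines "C \<equiv> \<lambda>j \<eta>. \<beta> j * (of_bool (B j \<eta>) - success_prob j)"
  shows "AE \<eta> in N. summable (\<lambda>j. C j \<eta>)"
    and "integrable N (\<lambda>\<eta>. (\<Sum>j<n. C j \<eta>)\<^sup>2)" and "(\<integral>\<eta>. (\<Sum>j<n. C j \<eta>)\<^sup>2 \<partial>N) \<le> (\<Sum>j. (\<beta> j)\<^sup>2)"
proof -
  have ind: "indep_vars (\<lambda>_. borel) C UNIV"
    unfolding C_def by (rule indep_vars_compose2[OF B_indep]) simp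
  have Cm [measurable]: "C j \<in> borel_measurable N" for j using ind by (auto simp: indep_vars_def)
  have mean: "expectation (C j) = 0" for j
    unfolding C_def by (subst expectation_B) (simp add: algebra_simps)
  have le: "(C j \<eta>)\<^sup>2 \<le> (\<beta> j)\<^sup>2" for j \<eta>
  proof -
    have "(of_bool (B j \<eta>) - success_prob j)\<^sup>2 \<le> 1"
      using tilted_success_prob_bounds[OF T, of \<theta> "\<beta> j"] by (auto simp: abs_square_le_1)
    then show ?thesis unfolding C_def power_mult_distrib by (intro mult_left_le) auto
  qed
  have int: "integrable N (\<lambda>\<eta>. (C j \<eta>)\<^sup>2)" for j
    by (rule integrable_const_bound[where B="(\<beta> j)\<^sup>2"]) (use le in auto)
  have var: "expectation (\<lambda>\<eta>. (C j \<eta>)\<^sup>2) \<le> (\<beta> j)\<^sup>2" for j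
  proof -
    have "expectation (\<lambda>\<eta>. (C j \<eta>)\<^sup>2) \<le> expectation (\<lambda>\<eta>. (\<beta> j)\<^sup>2)" by (intro integral_mono int le) auto
    then show ?thesis by (simp add: prob_space)
  qed
  show "AE \<eta> in N. summable (\<lambda>j. C j \<eta>)"
    by (rule AE_summable_of_summable_variances[OF ind int mean])
       (rule summable_comparison_test[OF _ square_summable], use var in auto)
  show "integrable N (\<lambda>\<eta>. (\<Sum>j<n. C j \<eta>)\<^sup>2)"
    using gated_sum_second_moment(1)[OF ind int mean, of UNIV n] by (simp add: gated_sum_UNIV)
  have "(\<integral>\<eta>. (\<Sum>j<n. C j \<eta>)\<^sup>2 \<partial>N) \<le> (\<Sum>j<n. expectation (\<lambda>\<eta>. (C j \<eta>)\<^sup>2))"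
    using gated_sum_second_moment(2)[OF ind int mean, of UNIV n] by (simp add: gated_sum_UNIV)
  also have "\<dots> \<le> (\<Sum>j<n. (\<beta> j)\<^sup>2)" by (intro sum_mono var)
  also have "\<dots> \<le> (\<Sum>j. (\<beta> j)\<^sup>2)" by (intro sum_le_suminf square_summable) auto
  finally show "(\<integral>\<eta>. (\<Sum>j<n. C j \<eta>)\<^sup>2 \<partial>N) \<le> (\<Sum>j. (\<beta> j)\<^sup>2)" .
qed

text \<open>
  The series is a centred one, which converges almost surely and has bounded second moments, plus the
  convergent deterministic series of \<open>summable_mean_shift\<close>. The bound on the second moments turns
  almost sure convergence into convergence in \<open>L\<^sup>1\<close>.
\<close>

lemma drift_series:
  shows "AE \<eta> in N. summable (\<lambda>j. drift_term j \<eta>)"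
    and "integrable N (\<lambda>\<eta>. \<Sum>j. drift_term j \<eta>)"
    and "(\<lambda>n. \<integral>\<eta>. \<bar>(\<Sum>j<n. drift_term j \<eta>) - (\<Sum>j. drift_term j \<eta>)\<bar> \<partial>N) \<longlonglongrightarrow> 0"
proof -
  define C where "C = (\<lambda>j \<eta>. \<beta> j * (of_bool (B j \<eta>) - success_prob j))"
  define S where "S = (\<lambda>n \<eta>. \<Sum>j<n. drift_term j \<eta>)"
  have split: "drift_term j \<eta> = C j \<eta> + \<beta> j * (success_prob j - T)" for j \<eta>
    by (simp add: C_def algebra_simps)
  have [measurable]: "C j \<in> borel_measurable N" for j unfolding C_def by measurable
  show sm: "AE \<eta> in N. summable (\<lambda>j. drift_term j \<eta>)"
    using centered_jumps(1)[folded C_def]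
  proof eventually_elim
    case (elim \<eta>)
    then have "summable (\<lambda>j. C j \<eta>)" by (simp add: C_def)
    then show ?case unfolding split by (intro summable_add summable_mean_shift)
  qed
  have "convergent (\<lambda>n. \<Sum>j<n. \<beta> j * (success_prob j - T))"
    using summable_mean_shift by (simp add: summable_iff_convergent)
  then obtain D where D: "\<And>n. \<bar>\<Sum>j<n. \<beta> j * (success_prob j - T)\<bar> \<le> D"
    using convergent_imp_Bseq[of "\<lambda>n. \<Sum>j<n. \<beta> j * (success_prob j - T)"] by (auto simp: Bseq_def)
  have Cint: "integrable N (\<lambda>\<eta>. (\<Sum>j<n. C j \<eta>)\<^sup>2)" "(\<integral>\<eta>. (\<Sum>j<n. C j \<eta>)\<^sup>2 \<partial>N) \<le> (\<Sum>j. (\<beta> j)\<^sup>2)" for n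
    using centered_jumps(2,3) unfolding C_def by auto
  have [measurable]: "S n \<in> borel_measurable N" for n unfolding S_def by measurable
  have le: "(S n \<eta>)\<^sup>2 \<le> 2 * (\<Sum>j<n. C j \<eta>)\<^sup>2 + 2 * D\<^sup>2" for n \<eta>
  proof -
    let ?x = "\<Sum>j<n. C j \<eta>" and ?y = "\<Sum>j<n. \<beta> j * (success_prob j - T)"
    have "S n \<eta> = ?x + ?y" unfolding S_def split sum.distrib ..
    then have "(S n \<eta>)\<^sup>2 \<le> 2 * ?x\<^sup>2 + 2 * ?y\<^sup>2"
      using sum_squares_bound[of ?x ?y] by (simp add: power2_eq_square algebra_simps)
    moreover have "?y\<^sup>2 \<le> D\<^sup>2" using D[of n] by (metis abs_ge_zero power2_abs power_mono)
    ultimately show ?thesis by linarith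
  qed
  have Sint: "integrable N (\<lambda>\<eta>. (S n \<eta>)\<^sup>2)" for n
    by (rule Bochner_Integration.integrable_bound[where f="\<lambda>\<eta>. 2 * (\<Sum>j<n. C j \<eta>)\<^sup>2 + 2 * D\<^sup>2"])
       (use Cint le in \<open>auto intro: order_trans[OF le]\<close>)
  have Sbd: "(\<integral>\<eta>. (S n \<eta>)\<^sup>2 \<partial>N) \<le> 2 * (\<Sum>j. (\<beta> j)\<^sup>2) + 2 * D\<^sup>2" for n
  proof -
    have "(\<integral>\<eta>. (S n \<eta>)\<^sup>2 \<partial>N) \<le> (\<integral>\<eta>. 2 * (\<Sum>j<n. C j \<eta>)\<^sup>2 + 2 * D\<^sup>2 \<partial>N)"
      by (intro integral_mono Sint le) (use Cint in auto)
    also have "\<dots> \<le> 2 * (\<Sum>j. (\<beta> j)\<^sup>2) + 2 * D\<^sup>2" using Cint[of n] by (simp add: prob_space)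
    finally show ?thesis .
  qed
  have lim: "AE \<eta> in N. (\<lambda>n. S n \<eta>) \<longlonglongrightarrow> (\<Sum>j. drift_term j \<eta>)"
    using sm by eventually_elim (simp add: S_def summable_LIMSEQ)
  note L = L1_limit_of_L2_bounded[OF finite_measure_axioms, of S "\<lambda>\<eta>. \<Sum>j. drift_term j \<eta>",
    unfolded real_norm_def power2_abs, OF _ _ lim Sint Sbd]
  show "integrable N (\<lambda>\<eta>. \<Sum>j. drift_term j \<eta>)" by (rule L(1)) measurable
  show "(\<lambda>n. \<integral>\<eta>. \<bar>(\<Sum>j<n. drift_term j \<eta>) - (\<Sum>j. drift_term j \<eta>)\<bar> \<partial>N) \<longlonglongrightarrow> 0"
    using L(2) unfolding S_def by simp
qed

end

section \<open>Coupling of random characteristics with fresh noise\<close>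

lemma (in prob_space) distr_pair_snd:
  assumes "sigma_finite_measure K"
  shows "distr (M \<Otimes>\<^sub>M K) K snd = K"
proof (rule measure_eqI)
  interpret K: sigma_finite_measure K by fact
  fix A assume "A \<in> sets (distr (M \<Otimes>\<^sub>M K) K snd)"
  then have A: "A \<in> sets K" by simp
  have "emeasure (distr (M \<Otimes>\<^sub>M K) K snd) A = emeasure (M \<Otimes>\<^sub>M K) (space M \<times> A)"
    using A sets.sets_into_space[OF A]
    by (auto simp: emeasure_distr space_pair_measure intro!: arg_cong[where f="emeasure (M \<Otimes>\<^sub>M K)"])
  then show "emeasure (distr (M \<Otimes>\<^sub>M K) K snd) A = emeasure K A"
    using A by (simp add: K.emeasure_pair_measure_Times emeasure_space_1)
qed simp

lemma sets_Collect_summable: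
  fixes f :: "nat \<Rightarrow> 'w \<Rightarrow> real"
  assumes [measurable]: "\<And>j. f j \<in> borel_measurable M"
  shows "{w\<in>space M. summable (\<lambda>j. f j w)} \<in> sets M"
proof -
  have "{w\<in>space M. summable (\<lambda>j. f j w)} = {w\<in>space M. Cauchy (\<lambda>n. \<Sum>j<n. f j w)}"
    by (simp add: summable_iff_convergent Cauchy_convergent_iff)
  then show ?thesis by simp
qed

text \<open>
  Independence of the characteristics, which are functions on \<open>N\<close>, from the bridge and the uniforms,
  which are taken from \<open>M\<close>, is obtained by working on the product \<open>N \<Otimes>\<^sub>M M\<close>. The noise that builds the
  original process is thus used a second time, after rescaling \<open>[0, T]\<close> to the unit interval.
\<close>

locale tilted_coupling = extremal_ei M b U \<alpha> \<sigma> \<beta> X + jumps: tilted_jumps N B \<beta> T \<theta>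
  for M :: "'a measure" and b U \<alpha> \<sigma> \<beta> X and N :: "'v measure" and B T \<theta> +
  fixes Z :: "'v \<Rightarrow> real"
  assumes Z_law: "distributed N lborel Z (\<lambda>x. ennreal (std_normal_density x))"
    and Z_B_indep: "indep_rvs N borel Z (PiM UNIV (\<lambda>_. count_space UNIV)) (\<lambda>\<eta> j. B j \<eta>)"
begin

sublocale P: pair_prob_space N M ..

abbreviation "joint \<equiv> N \<Otimes>\<^sub>M M"

lemma Z_normal: "centered_normal N Z 1"
  using Z_law by (auto simp: centered_normal_def dest: distributed_measurable)

lemma Z_measurable [measurable]: "Z \<in> borel_measurable N"
  using Z_normal by (simp add: centered_normal_def)

lemma scaled_time: "t \<in> {0..T} \<Longrightarrow> t / T \<in> {0..1}"
  using jumps.T by auto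

lemma b_snd_measurable [measurable]: "t \<in> {0..T} \<Longrightarrow> (\<lambda>x. b (t / T) (snd x)) \<in> borel_measurable joint"
  by (intro measurable_compose[OF measurable_snd] b_measurable scaled_time)

definition gaussian_drift :: "'v \<Rightarrow> real" where
  "gaussian_drift \<eta> = \<theta> * \<sigma>\<^sup>2 * T * (1 - T) + \<sigma> * sqrt (T * (1 - T)) * Z \<eta>"

definition partial_tilted :: "nat \<Rightarrow> real \<Rightarrow> 'v \<times> 'a \<Rightarrow> real" where
  "partial_tilted n t x = \<alpha> * t + gaussian_drift (fst x) * (t / T) + \<sigma> * sqrt T * b (t / T) (snd x)
     + (\<Sum>j<n. \<beta> j * (of_bool (B j (fst x) \<and> U j (snd x) \<le> t / T) - t))"

definition tilted_limit :: "real \<Rightarrow> 'v \<times> 'a \<Rightarrow> real" where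
  "tilted_limit t x = tilted_drift \<alpha> \<sigma> \<beta> T \<theta> B Z (fst x) * (t / T) + \<sigma> * sqrt T * b (t / T) (snd x)
     + (\<Sum>j. \<beta> j * of_bool (B j (fst x)) * (of_bool (U j (snd x) \<le> t / T) - t / T))"

lemma gaussian_drift_measurable [measurable]: "gaussian_drift \<in> borel_measurable N"
  unfolding gaussian_drift_def by measurable

lemma tilted_drift_measurable [measurable]: "tilted_drift \<alpha> \<sigma> \<beta> T \<theta> B Z \<in> borel_measurable N"
  unfolding tilted_drift_def[abs_def] by measurable

lemma partial_tilted_measurable [measurable]: "t \<in> {0..T} \<Longrightarrow> partial_tilted n t \<in> borel_measurable joint"
  unfolding partial_tilted_def[abs_def] of_bool_def by measurable

lemma tilted_limit_measurable [measurable]: "t \<in> {0..T} \<Longrightarrow> tilted_limit t \<in> borel_measurable joint"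
  unfolding tilted_limit_def[abs_def] of_bool_def by measurable

abbreviation thinned_jump :: "real \<Rightarrow> nat \<Rightarrow> 'v \<times> 'a \<Rightarrow> real" where
  "thinned_jump s j x \<equiv> \<beta> j * of_bool (B j (fst x)) * (of_bool (U j (snd x) \<le> s) - s)"

text \<open>
  For fixed characteristics the coefficients are square summable and Kolmogorov's theorem applies on
  \<open>M\<close>; Fubini's theorem combines the exceptional sets.
\<close>

lemma AE_summable_thinned_jumps:
  assumes s: "s \<in> {0..1}"
  shows "AE x in joint. summable (\<lambda>j. thinned_jump s j x)"
proof (rule P.AE_pair_measure)
  show "{x \<in> space joint. summable (\<lambda>j. thinned_jump s j x)} \<in> sets joint"
    by (rule sets_Collect_summable) (unfold of_bool_def, measurable)
  have "AE w in M. summable (\<lambda>j. \<beta> j * of_bool (B j \<eta>) * (of_bool (U j w \<le> s) - s))" for \<eta>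
  proof (rule AE_summable_jumps[OF _ s])
    show "summable (\<lambda>j. (\<beta> j * of_bool (B j \<eta>))\<^sup>2)"
      by (rule summable_comparison_test[OF _ square_summable]) (auto simp: of_bool_def)
  qed
  then show "AE \<eta> in N. AE w in M. summable (\<lambda>j. \<beta> j * of_bool (B j (fst (\<eta>, w))) * (of_bool (U j (snd (\<eta>, w)) \<le> s) - s))"
    by simp
qed

lemma AE_summable_drift_pair: "AE x in joint. summable (\<lambda>j. jumps.drift_term j (fst x))"
proof (rule P.AE_pair_measure)
  show "{x \<in> space joint. summable (\<lambda>j. jumps.drift_term j (fst x))} \<in> sets joint"
    by (rule sets_Collect_summable) (unfold of_bool_def, measurable)
  show "AE \<eta> in N. AE w in M. summable (\<lambda>j. jumps.drift_term j (fst (\<eta>, w)))"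
    using jumps.drift_series(1) by eventually_elim simp
qed

lemma partial_tilted_LIMSEQ:
  assumes t: "t \<in> {0..T}"
  shows "AE x in joint. (\<lambda>n. partial_tilted n t x) \<longlonglongrightarrow> tilted_limit t x"
  using AE_summable_thinned_jumps[OF scaled_time[OF t]] AE_summable_drift_pair
proof eventually_elim
  case (elim x)
  have split: "\<beta> j * (of_bool (B j (fst x) \<and> U j (snd x) \<le> t / T) - t) =
    jumps.drift_term j (fst x) * (t / T) + thinned_jump (t / T) j x" for j
    using jumps.T by (auto simp: field_simps)
  have at: "\<alpha> * t = \<alpha> * T * (t / T)" using jumps.T by simp
  have "partial_tilted n t x = \<alpha> * t + gaussian_drift (fst x) * (t / T) + \<sigma> * sqrt T * b (t / T) (snd x)
     + ((\<Sum>j<n. jumps.drift_term j (fst x)) * (t / T)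
       + (\<Sum>j<n. thinned_jump (t / T) j x))" for n
    unfolding partial_tilted_def split sum.distrib sum_distrib_right ..
  then have eq: "partial_tilted n t x = (\<alpha> * T + gaussian_drift (fst x) + (\<Sum>j<n. jumps.drift_term j (fst x))) * (t / T)
     + \<sigma> * sqrt T * b (t / T) (snd x) + (\<Sum>j<n. thinned_jump (t / T) j x)" for n
    by (simp only: at distrib_right add_ac)
  show ?case
    unfolding eq tilted_limit_def tilted_drift_def gaussian_drift_def[symmetric]
    by (intro tendsto_intros summable_LIMSEQ elim)
qed

text \<open>
  For fixed characteristics the expectation over \<open>M\<close> factorises over bridge and jumps; the expectation
  over \<open>N\<close> then factorises over \<open>Z\<close> and the \<open>B j\<close>. A jump with \<open>B j\<close> true occurs at time \<open>T * U j\<close>, and one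
  with \<open>B j\<close> false has only its compensator. The variances of the scaled bridge and of the Gaussian
  drift add up to that of the original bridge on \<open>[0, T]\<close>.
\<close>

lemma partial_tilted_char:
  assumes F: "finite F" "F \<subseteq> {0..T}"
  shows "(\<integral>x. iexp (\<Sum>t\<in>F. u t * partial_tilted n t x) \<partial>joint) =
    tilted_sum_char T \<theta> n F u"
proof -
  let ?d = "\<lambda>j t x. of_bool (B j (fst x) \<and> U j (snd x) \<le> t / T) - t"
  define m where "m = (\<Sum>t\<in>F. u t * t)"
  define z where "z = (\<lambda>j. iexp (- (\<Sum>t\<in>F. u t * (\<beta> j * t))))"
  \<comment> \<open>The factor due to \<open>\<beta> j\<close> if \<open>B j = c\<close> and \<open>U j = v\<close>; averaging over \<open>v\<close> gives \<open>g j c\<close>.\<close>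
  define h where "h = (\<lambda>j c v. if c then jump_char F u (\<beta> j) (T * v) else z j)"
  define \<kappa> where "\<kappa> = \<sigma> * sqrt (T * (1 - T)) * (m / T)"
  define L where "L = (\<lambda>w. \<Sum>t\<in>F. (u t * (\<sigma> * sqrt T)) * b (t / T) w)"
  define g where "g = (\<lambda>j c. \<integral>v. h j c v \<partial>unif)"
  have T0: "T > 0" using jumps.T by simp
  have hm [measurable]: "h j c \<in> borel_measurable borel" for j c unfolding h_def by (cases c) simp_all
  have hbd: "norm (h j c v) \<le> 1" for j c v by (simp add: h_def norm_jump_char z_def)
  have jump: "iexp (\<Sum>t\<in>F. u t * (\<beta> j * (of_bool (c \<and> v \<le> t / T) - t))) = h j c v" for j c v
  proof (cases c)
    case True
    have "(v \<le> t / T) \<longleftrightarrow> (T * v \<le> t)" for t using T0 by (simp add: field_simps)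
    then show ?thesis using True by (simp add: h_def jump_char_def)
  qed (simp add: h_def z_def sum_negf)
  have lin: "(\<Sum>t\<in>F. u t * partial_tilted n t x) = (\<alpha> + \<theta> * \<sigma>\<^sup>2 * (1 - T)) * m + \<kappa> * Z (fst x) + L (snd x)
     + (\<Sum>j<n. \<Sum>t\<in>F. u t * (\<beta> j * ?d j t x))" for x
  proof -
    have "(\<Sum>t\<in>F. u t * partial_tilted n t x) =
      (\<Sum>t\<in>F. (\<alpha> + gaussian_drift (fst x) / T) * (u t * t)) + (\<Sum>t\<in>F. (u t * (\<sigma> * sqrt T)) * b (t / T) (snd x))
      + (\<Sum>t\<in>F. \<Sum>j<n. u t * (\<beta> j * ?d j t x))"
      unfolding sum.distrib[symmetric]
      by (intro sum.cong refl) (simp add: partial_tilted_def sum_distrib_left algebra_simps)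
    also have "(\<Sum>t\<in>F. (\<alpha> + gaussian_drift (fst x) / T) * (u t * t)) = (\<alpha> + \<theta> * \<sigma>\<^sup>2 * (1 - T)) * m + \<kappa> * Z (fst x)"
      using T0 unfolding sum_distrib_left[symmetric] m_def[symmetric]
      by (simp add: gaussian_drift_def \<kappa>_def field_simps)
    also have "(\<Sum>t\<in>F. \<Sum>j<n. u t * (\<beta> j * ?d j t x)) =
      (\<Sum>j<n. \<Sum>t\<in>F. u t * (\<beta> j * ?d j t x))"
      by (rule sum.swap)
    finally show ?thesis unfolding L_def .
  qed
  have fac: "iexp (\<Sum>t\<in>F. u t * partial_tilted n t x) = iexp ((\<alpha> + \<theta> * \<sigma>\<^sup>2 * (1 - T)) * m) *
     (iexp (\<kappa> * Z (fst x)) * (iexp (L (snd x)) * (\<Prod>j<n. h j (B j (fst x)) (U j (snd x)))))" for x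
  proof -
    have "iexp (\<Sum>j<n. \<Sum>t\<in>F. u t * (\<beta> j * ?d j t x)) =
      (\<Prod>j<n. h j (B j (fst x)) (U j (snd x)))"
      unfolding jump[symmetric]
      by (simp only: of_real_sum[of _ "{..<n}"] sum_distrib_left[of \<i> _ "{..<n}"] exp_sum[OF finite_lessThan])
    then show ?thesis unfolding lin by (simp only: of_real_add distrib_left exp_add mult.assoc)
  qed
  have [measurable]: "(\<lambda>x. \<Sum>t\<in>F. u t * partial_tilted n t x) \<in> borel_measurable joint"
    using F by (intro borel_measurable_lincomb partial_tilted_measurable) auto
  have int: "integrable joint (\<lambda>x. iexp (\<Sum>t\<in>F. u t * partial_tilted n t x))"
    by (rule P.integrable_const_bound[where B=1]) (simp, measurable)
  have inner: "(\<integral>w. iexp (L w) * (\<Prod>j<n. h j (B j \<eta>) (U j w)) \<partial>M) =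
    (\<integral>w. iexp (L w) \<partial>M) * (\<Prod>j<n. g j (B j \<eta>))" for \<eta>
  proof -
    let ?G = "\<lambda>p. iexp (\<Sum>t\<in>F. (u t * (\<sigma> * sqrt T)) * p (t / T))"
    have "(\<lambda>p. \<Sum>t\<in>F. (u t * (\<sigma> * sqrt T)) * p (t / T)) \<in> borel_measurable bridge_space"
      using F scaled_time by (intro borel_measurable_lincomb measurable_component_singleton) auto
    then have G: "?G \<in> borel_measurable bridge_space" by measurable
    have restr: "?G (\<lambda>t\<in>{0..1}. b t w) = iexp (L w)" for w
    proof -
      have "(\<Sum>t\<in>F. (u t * (\<sigma> * sqrt T)) * (\<lambda>t\<in>{0..1}. b t w) (t / T)) = L w"
        unfolding L_def using F scaled_time by (intro sum.cong refl arg_cong2[where f="(*)"]) auto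
      then show ?thesis by (simp only:)
    qed
    have Lm: "L \<in> borel_measurable M"
      unfolding L_def using F scaled_time by (intro borel_measurable_lincomb b_measurable) auto
    then have "(\<lambda>w. iexp (L w)) \<in> borel_measurable M" by measurable
    then have "integrable M (\<lambda>w. iexp (L w))" by (intro integrable_const_bound[where B=1]) auto
    then have intG: "integrable M (\<lambda>w. ?G (\<lambda>t\<in>{0..1}. b t w))" unfolding restr .
    show ?thesis
      using expectation_bridge_times_jumps(2)[of ?G "\<lambda>j. h j (B j \<eta>)", OF G intG hm hbd, of n]
      unfolding restr g_def .
  qed
  have outer: "(\<integral>\<eta>. iexp (\<kappa> * Z \<eta>) * (\<Prod>j<n. g j (B j \<eta>)) \<partial>N) =
    (\<integral>\<eta>. iexp (\<kappa> * Z \<eta>) \<partial>N) * (\<Prod>j<n. of_real (jumps.success_prob j) * g j True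
        + of_real (1 - jumps.success_prob j) * g j False)"
  proof -
    have gint: "integrable N (\<lambda>\<eta>. g j (B j \<eta>))" for j
    proof (rule jumps.integrable_const_bound[where B="max (norm (g j True)) (norm (g j False))"])
      have "norm (g j c) \<le> max (norm (g j True)) (norm (g j False))" for c by (cases c) auto
      then show "AE \<eta> in N. norm (g j (B j \<eta>)) \<le> max (norm (g j True)) (norm (g j False))" by simp
    qed measurable
    have "jumps.indep_vars (\<lambda>_. borel) (\<lambda>j \<eta>. g j (B j \<eta>)) {..<n}"
      by (rule jumps.indep_vars_compose2[OF jumps.indep_vars_subset[OF jumps.B_indep]]) auto
    note prod = jumps.indep_vars_lebesgue_integral[OF _ this gint] jumps.indep_vars_integrable[OF _ this gint]
    have "(\<lambda>\<eta>. iexp (\<kappa> * Z \<eta>)) \<in> borel_measurable N" by measurable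
    then have Zint: "integrable N (\<lambda>\<eta>. iexp (\<kappa> * Z \<eta>))" by (intro jumps.integrable_const_bound[where B=1]) auto
    have ind: "indep_rvs N borel (\<lambda>\<eta>. iexp (\<kappa> * Z \<eta>)) borel (\<lambda>\<eta>. \<Prod>j<n. g j (B j \<eta>))"
      by (rule indep_rvs_compose[OF jumps.prob_space_axioms Z_B_indep, where F="\<lambda>x. iexp (\<kappa> * x)" and G="\<lambda>c. \<Prod>j<n. g j (c j)"])
         measurable
    show ?thesis
      using indep_rvs_integral_mult(2)[OF jumps.prob_space_axioms ind Zint prod(2)] prod(1)
      by (simp add: jumps.expectation_B scaleR_conv_of_real)
  qed
  have gT: "g j True = (\<integral>v. jump_char F u (\<beta> j) (T * v) \<partial>unif)" for j by (simp add: g_def h_def)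
  have gF: "g j False = z j" for j
  proof -
    interpret unif: prob_space unif by (rule prob_space_unif)
    show ?thesis by (simp add: g_def h_def unif.prob_space)
  qed
  have charZ: "(\<integral>\<eta>. iexp (\<kappa> * Z \<eta>) \<partial>N) = of_real (exp (- \<kappa>\<^sup>2 / 2))"
    using centered_normal_exp(2)[OF jumps.prob_space_axioms Z_normal, of 0 \<kappa>]
    by (simp add: power_mult_distrib flip: exp_of_real)
  have charL: "(\<integral>w. iexp (L w) \<partial>M) = of_real (exp (- (\<sigma>\<^sup>2 * T * (\<Sum>s\<in>F. \<Sum>t\<in>F. u s * u t * bridge_cov (s / T) (t / T))) / 2))"
  proof -
    let ?F = "(\<lambda>t. t / T) ` F" and ?w = "\<lambda>r. u (r * T) * (\<sigma> * sqrt T)"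
    have inj: "inj_on (\<lambda>t. t / T) F" using T0 by (auto simp: inj_on_def)
    have L: "L = (\<lambda>w. \<Sum>r\<in>?F. ?w r * b r w)"
      unfolding L_def sum.reindex[OF inj] o_def using T0 by simp
    have "(\<integral>w. iexp (L w) \<partial>M) = exp (of_real (- (\<Sum>r\<in>?F. \<Sum>q\<in>?F. ?w r * ?w q * bridge_cov r q) / 2))"
      unfolding L by (rule bridge_char[OF prob_space_axioms bridge]) (use F scaled_time in auto)
    also have "(\<Sum>r\<in>?F. \<Sum>q\<in>?F. ?w r * ?w q * bridge_cov r q) = \<sigma>\<^sup>2 * T * (\<Sum>s\<in>F. \<Sum>t\<in>F. u s * u t * bridge_cov (s / T) (t / T))"
    proof -
      have q: "(\<sigma> * sqrt T) * (\<sigma> * sqrt T) = \<sigma>\<^sup>2 * T"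
        using T0 by (simp add: power2_eq_square mult.left_commute)
      have eq: "u s * (\<sigma> * sqrt T) * (u t * (\<sigma> * sqrt T)) * k = \<sigma>\<^sup>2 * T * (u s * u t * k)" for s t k
        unfolding q[symmetric] by (simp only: mult_ac)
      have "s / T * T = s" for s using T0 by simp
      then show ?thesis unfolding sum.reindex[OF inj] o_def sum_distrib_left eq by (simp only:)
    qed
    finally show ?thesis by (simp only: exp_of_real)
  qed
  have var: "\<sigma>\<^sup>2 * T * (\<Sum>s\<in>F. \<Sum>t\<in>F. u s * u t * bridge_cov (s / T) (t / T)) + \<kappa>\<^sup>2 = \<sigma>\<^sup>2 * bridge_var F u"
  proof -
    have min: "min (s / T) (t / T) = min s t / T" for s t using T0 by (simp add: min_def divide_le_cancel)
    have cov: "T * bridge_cov (s / T) (t / T) = bridge_cov s t - (1 - T) / T * (s * t)" for s t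
      unfolding bridge_cov_def min using T0 by (simp add: field_simps)
    have "T * (\<Sum>s\<in>F. \<Sum>t\<in>F. u s * u t * bridge_cov (s / T) (t / T)) = (\<Sum>s\<in>F. \<Sum>t\<in>F. u s * u t * (T * bridge_cov (s / T) (t / T)))"
      by (simp add: sum_distrib_left mult_ac)
    also have "\<dots> = (bridge_var F u) - (1 - T) / T * (\<Sum>s\<in>F. \<Sum>t\<in>F. (u s * s) * (u t * t))"
      unfolding cov by (simp add: right_diff_distrib sum_subtractf sum_distrib_left mult_ac)
    also have "(\<Sum>s\<in>F. \<Sum>t\<in>F. (u s * s) * (u t * t)) = m\<^sup>2"
      by (simp only: m_def power2_eq_square sum_product)
    finally have "T * (\<Sum>s\<in>F. \<Sum>t\<in>F. u s * u t * bridge_cov (s / T) (t / T)) =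
      (bridge_var F u) - (1 - T) / T * m\<^sup>2" .
    moreover have "\<kappa>\<^sup>2 = \<sigma>\<^sup>2 * ((1 - T) / T * m\<^sup>2)"
      unfolding \<kappa>_def using jumps.T by (simp add: power_mult_distrib power_divide power2_eq_square field_simps)
    ultimately show ?thesis by (simp only: mult.assoc) (simp add: algebra_simps)
  qed
  have "(\<integral>x. iexp (\<Sum>t\<in>F. u t * partial_tilted n t x) \<partial>joint) =
    (\<integral>\<eta>. \<integral>w. iexp (\<Sum>t\<in>F. u t * partial_tilted n t (\<eta>, w)) \<partial>M \<partial>N)"
    by (rule P.integral_fst'[OF int, symmetric])
  also have "\<dots> = iexp ((\<alpha> + \<theta> * \<sigma>\<^sup>2 * (1 - T)) * m) * ((\<integral>w. iexp (L w) \<partial>M) *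
      (\<integral>\<eta>. iexp (\<kappa> * Z \<eta>) * (\<Prod>j<n. g j (B j \<eta>)) \<partial>N))"
    unfolding fac fst_conv snd_conv integral_mult_right_zero inner
    by (simp only: mult.left_commute[of _ "\<integral>w. iexp (L w) \<partial>M"] integral_mult_right_zero)
  also have "\<dots> = iexp ((\<alpha> + \<theta> * \<sigma>\<^sup>2 * (1 - T)) * m) *
     of_real (exp (- (\<sigma>\<^sup>2 * T * (\<Sum>s\<in>F. \<Sum>t\<in>F. u s * u t * bridge_cov (s / T) (t / T))) / 2) * exp (- \<kappa>\<^sup>2 / 2)) *
     (\<Prod>j<n. of_real (jumps.success_prob j) * g j True + of_real (1 - jumps.success_prob j) * g j False)"
    unfolding outer charZ charL by (simp only: of_real_mult mult.assoc)
  also have "exp (- (\<sigma>\<^sup>2 * T * (\<Sum>s\<in>F. \<Sum>t\<in>F. u s * u t * bridge_cov (s / T) (t / T))) / 2) * exp (- \<kappa>\<^sup>2 / 2) =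
    exp (- (\<sigma>\<^sup>2 * bridge_var F u) / 2)"
    unfolding exp_add[symmetric] var[symmetric] by (intro arg_cong[where f=exp]) (simp add: field_simps)
  finally show ?thesis unfolding gT gF z_def m_def tilted_sum_char_def .
qed

text \<open>
  For partial sums the two sides agree exactly, so only the limits have to be taken: of the tilted
  characteristic functions by the second moment bound, and of those of the coupled process by
  dominated convergence.
\<close>

lemma tilted_char_eq:
  assumes F: "finite F" "F \<subseteq> {0..T}"
  shows "(\<integral>w. exp (\<theta> * X T w) *\<^sub>R iexp (\<Sum>t\<in>F. u t * X t w) \<partial>M) =
    of_real (\<integral>w. exp (\<theta> * X T w) \<partial>M) * (\<integral>x. iexp (\<Sum>t\<in>F. u t * tilted_limit t x) \<partial>joint)"
proof -
  \<comment> \<open>The tilting involves the value at \<open>T\<close>, so \<open>T\<close> is added to the set of times, with coefficient 0 if it is new.\<close>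
  define F' where "F' = insert T F"
  define v where "v = (\<lambda>t. if t \<in> F then u t else 0)"
  have F': "finite F'" "F' \<subseteq> {0..T}" "T \<in> F'" using F jumps.T by (auto simp: F'_def)
  have sums: "(\<Sum>t\<in>F'. v t * c t) = (\<Sum>t\<in>F. u t * c t)" for c
    unfolding F'_def v_def by (rule sum.mono_neutral_cong_right) (use F in auto)
  have T01: "T \<in> {0..1}" and F01: "F' \<subseteq> {0..1}" using jumps.T F' by auto
  have id: "(\<integral>w. exp (\<theta> * partial_ei n T w) *\<^sub>R iexp (\<Sum>t\<in>F'. v t * partial_ei n t w) \<partial>M) =
    of_real (\<integral>w. exp (\<theta> * partial_ei n T w) \<partial>M) * (\<integral>x. iexp (\<Sum>t\<in>F'. v t * partial_tilted n t x) \<partial>joint)" for n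
    unfolding partial_ei_tilted_char[OF jumps.T F'] partial_tilted_char[OF F'(1,2)] ..
  have [measurable]: "(\<lambda>x. \<Sum>t\<in>F'. v t * partial_tilted n t x) \<in> borel_measurable joint" for n
    using F' by (intro borel_measurable_lincomb partial_tilted_measurable) auto
  have [measurable]: "(\<lambda>x. \<Sum>t\<in>F'. v t * tilted_limit t x) \<in> borel_measurable joint"
    using F' by (intro borel_measurable_lincomb tilted_limit_measurable) auto
  have AE: "AE x in joint. \<forall>t\<in>F'. (\<lambda>n. partial_tilted n t x) \<longlonglongrightarrow> tilted_limit t x"
    by (rule AE_finite_allI[OF F'(1)]) (use F' partial_tilted_LIMSEQ in auto)
  have "(\<lambda>n. \<integral>x. iexp (\<Sum>t\<in>F'. v t * partial_tilted n t x) \<partial>joint) \<longlonglongrightarrow>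
    (\<integral>x. iexp (\<Sum>t\<in>F'. v t * tilted_limit t x) \<partial>joint)"
  proof (rule integral_dominated_convergence[where w="\<lambda>_. 1"])
    show "AE x in joint. (\<lambda>n. iexp (\<Sum>t\<in>F'. v t * partial_tilted n t x)) \<longlonglongrightarrow> iexp (\<Sum>t\<in>F'. v t * tilted_limit t x)"
      using AE by eventually_elim (intro tendsto_intros; simp)
  qed (simp_all del: of_real_sum)
  then have "(\<lambda>n. of_real (\<integral>w. exp (\<theta> * partial_ei n T w) \<partial>M) * (\<integral>x. iexp (\<Sum>t\<in>F'. v t * partial_tilted n t x) \<partial>joint))
    \<longlonglongrightarrow> of_real (\<integral>w. exp (\<theta> * X T w) \<partial>M) * (\<integral>x. iexp (\<Sum>t\<in>F'. v t * tilted_limit t x) \<partial>joint)"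
    by (intro tendsto_mult tendsto_of_real X_exp(2)[OF T01])
  from LIMSEQ_unique[OF X_tilted_char_LIMSEQ[OF T01 F'(1) F01, of \<theta> v] this[folded id]]
  show ?thesis unfolding sums .
qed

end

section \<open>The canonical sample space\<close>

context tilted_coupling
begin

text \<open>
  The paths of a bridge have to be continuous at every sample point, not only almost surely.
  Restricting the space, which is possible although the set of continuous paths is not measurable,
  ensures this.
\<close>

abbreviation continuous_paths :: "(real \<Rightarrow> real) measure" where
  "continuous_paths \<equiv> restrict_space bridge_space {p. continuous_on {0..1} p}"

abbreviation characteristics :: "'v \<Rightarrow> real \<times> real \<times> (nat \<Rightarrow> real)" where
  "characteristics \<eta> \<equiv> (tilted_drift \<alpha> \<sigma> \<beta> T \<theta> B Z \<eta>, \<sigma> * sqrt T, \<lambda>j. \<beta> j * of_bool (B j \<eta>))"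

abbreviation "sample_space \<equiv> char_space \<Otimes>\<^sub>M jump_space \<Otimes>\<^sub>M continuous_paths"

definition sample :: "'v \<times> 'a \<Rightarrow> ei_sample" where
  "sample x = (characteristics (fst x), \<lambda>i. U i (snd x), \<lambda>t\<in>{0..1}. b t (snd x))"

definition sample_law :: "ei_sample measure" where
  "sample_law = distr joint sample_space sample"

lemma characteristics_measurable [measurable]: "characteristics \<in> measurable N char_space"
proof -
  have "(\<lambda>\<eta> j. \<beta> j * of_bool (B j \<eta>)) \<in> measurable N jump_space"
    by (rule measurable_PiM_single') (auto simp: of_bool_def)
  then show ?thesis by measurable
qed

lemma U_path_measurable [measurable]: "(\<lambda>w i. U i w) \<in> measurable M jump_space"
  by (rule measurable_PiM_single') auto

lemma bridge_path_measurable [measurable]: "(\<lambda>w. \<lambda>t\<in>{0..1}. b t w) \<in> measurable M bridge_space"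
  by (rule measurable_restrict) auto

lemma continuous_path_measurable [measurable]: "(\<lambda>w. \<lambda>t\<in>{0..1}. b t w) \<in> measurable M continuous_paths"
proof (rule measurable_restrict_space2[OF _ bridge_path_measurable])
  have "continuous_on {0..1} (\<lambda>t\<in>{0..1}. b t w)" if "w \<in> space M" for w
    using b_continuous[OF that] by (rule continuous_on_eq) auto
  then show "(\<lambda>w. \<lambda>t\<in>{0..1}. b t w) \<in> space M \<rightarrow> {p. continuous_on {0..1} p}" by auto
qed

lemma sample_measurable [measurable]: "sample \<in> measurable joint sample_space"
  unfolding sample_def[abs_def]
  by (intro measurable_Pair measurable_compose[OF measurable_fst characteristics_measurable]
        measurable_compose[OF measurable_snd U_path_measurable] measurable_compose[OF measurable_snd continuous_path_measurable])

lemma prob_space_sample_law: "prob_space sample_law"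
  unfolding sample_law_def by (rule P.prob_space_distr) simp

lemma measurable_sample_law: "measurable sample_law K = measurable sample_space K"
  by (rule measurable_cong_sets) (simp_all add: sample_law_def)

lemma distr_sample_law:
  assumes "h \<in> measurable sample_law K"
  shows "distr sample_law K h = distr joint K (\<lambda>x. h (sample x))"
  using assms unfolding measurable_sample_law
  unfolding sample_law_def by (subst distr_distr) (auto simp: o_def)

lemma sample_fst_measurable: "fst \<in> measurable sample_law char_space"
  unfolding measurable_sample_law by simp

lemma sample_U_measurable: "(\<lambda>x. fst (snd x)) \<in> measurable sample_law jump_space"
  unfolding measurable_sample_law by simp

lemma sample_path_measurable: "(\<lambda>x. snd (snd x)) \<in> measurable sample_law bridge_space"
  unfolding measurable_sample_law
  by (intro measurable_compose[OF measurable_snd] measurable_compose[OF measurable_snd] measurable_restrict_space1) simp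

lemma sample_path_continuous: "x \<in> space sample_law \<Longrightarrow> continuous_on {0..1} (snd (snd x))"
  by (auto simp: sample_law_def space_pair_measure space_restrict_space)

lemma distr_snd: "distr joint M snd = M"
  by (rule jumps.distr_pair_snd) unfold_locales

lemma restrict_sample_path: "x \<in> space sample_law \<Longrightarrow> (\<lambda>t\<in>{0..1}. snd (snd x) t) = snd (snd x)"
  using measurable_space[OF sample_path_measurable, of x] by (auto simp: space_PiM PiE_def extensional_restrict)

abbreviation "sample_noise \<equiv> \<lambda>x. (\<lambda>t\<in>{0..1}. snd (snd x) t, \<lambda>i. fst (snd x) i)"

abbreviation "noise_path w \<equiv> (\<lambda>t\<in>{0..1}. b t w, \<lambda>i. U i w)"

lemma noise_law:
  "distr sample_law noise_space sample_noise =
   distr M noise_space noise_path"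
proof -
  have "distr sample_law noise_space sample_noise =
    distr sample_law noise_space (\<lambda>x. (snd (snd x), fst (snd x)))"
    by (rule distr_cong) (auto simp: restrict_sample_path)
  also have "\<dots> = distr joint noise_space (\<lambda>x. (\<lambda>t\<in>{0..1}. b t (snd x), \<lambda>i. U i (snd x)))"
    by (subst distr_sample_law)
       (auto intro!: measurable_Pair sample_path_measurable sample_U_measurable simp: sample_def)
  also have "\<dots> = distr (distr joint M snd) noise_space noise_path"
    by (subst distr_distr) (auto simp: o_def)
  finally show ?thesis unfolding distr_snd .
qed

lemma sample_bridge_and_uniforms: "bridge_and_uniforms sample_law (\<lambda>t x. snd (snd x) t) (\<lambda>i x. fst (snd x) i)"
proof (rule bridge_and_uniforms_law_cong[OF prob_space_axioms prob_space_sample_law noise _ _ _ noise_law])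
  show "(\<lambda>x. snd (snd x) t) \<in> borel_measurable sample_law" if "t \<in> {0..1}" for t
    using measurable_compose[OF sample_path_measurable measurable_component_singleton[OF that]] .
  show "(\<lambda>x. fst (snd x) i) \<in> borel_measurable sample_law" for i
    using measurable_compose[OF sample_U_measurable measurable_component_singleton[of i]] by simp
qed (use sample_path_continuous in simp)

lemma sample_indep:
  "indep_rvs sample_law char_space fst noise_space sample_noise"
proof (rule indep_rvs_law_cong[OF P.prob_space_axioms prob_space_sample_law])
  have J: "noise_path \<in> measurable M noise_space" by (intro measurable_Pair) auto
  show "indep_rvs joint char_space (\<lambda>x. characteristics (fst x)) noise_space (\<lambda>x. noise_path (snd x))"
    unfolding indep_rvs_iff[OF P.prob_space_axioms]
  proof (intro conjI ballI measurable_compose[OF measurable_fst characteristics_measurable] measurable_compose[OF measurable_snd J])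
    fix A E assume A: "A \<in> sets char_space" and E: "E \<in> sets noise_space"
    let ?A = "{\<eta>\<in>space N. characteristics \<eta> \<in> A}" and ?E = "{w\<in>space M. noise_path w \<in> E}"
    have sets: "?A \<in> sets N" "?E \<in> sets M"
      using measurable_sets[OF characteristics_measurable A] measurable_sets[OF J E] by (auto simp: vimage_def Int_def conj_commute)
    have rect: "measure joint (A' \<times> E') = measure N A' * measure M E'" if "A' \<in> sets N" "E' \<in> sets M" for A' E'
      using that by (simp add: measure_def emeasure_pair_measure_Times enn2real_mult)
    have eq: "{x\<in>space joint. characteristics (fst x) \<in> A \<and> noise_path (snd x) \<in> E} = ?A \<times> ?E"
      "{x\<in>space joint. characteristics (fst x) \<in> A} = ?A \<times> space M"
      "{x\<in>space joint. noise_path (snd x) \<in> E} = space N \<times> ?E"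
      by (auto simp: space_pair_measure)
    show "measure joint {x\<in>space joint. characteristics (fst x) \<in> A \<and> noise_path (snd x) \<in> E} =
      measure joint {x\<in>space joint. characteristics (fst x) \<in> A} * measure joint {x\<in>space joint. noise_path (snd x) \<in> E}"
      unfolding eq using sets by (simp add: rect prob_space jumps.prob_space)
  qed
  show path: "sample_noise \<in> measurable sample_law noise_space"
  proof -
    have "(\<lambda>x. (snd (snd x), fst (snd x))) \<in> measurable sample_law noise_space"
      by (intro measurable_Pair sample_path_measurable sample_U_measurable)
    then show ?thesis by (rule measurable_cong[THEN iffD1, rotated]) (simp add: restrict_sample_path)
  qed
  show "fst \<in> measurable sample_law char_space" by (rule sample_fst_measurable)
  have "sample x = (characteristics (fst x), \<lambda>i. U i (snd x), \<lambda>t\<in>{0..1}. b t (snd x))" for x by (simp add: sample_def)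
  then show "distr sample_law (char_space \<Otimes>\<^sub>M noise_space) (\<lambda>x. (fst x, \<lambda>t\<in>{0..1}. snd (snd x) t, \<lambda>i. fst (snd x) i)) =
    distr joint (char_space \<Otimes>\<^sub>M noise_space) (\<lambda>x. (characteristics (fst x), noise_path (snd x)))"
    by (subst distr_sample_law) (auto intro!: measurable_Pair sample_fst_measurable path distr_cong)
qed

definition sample_process :: "real \<Rightarrow> ei_sample \<Rightarrow> real" where
  "sample_process t x = fst (fst x) * (t / T) + fst (snd (fst x)) * snd (snd x) (t / T)
     + (\<Sum>j. snd (snd (fst x)) j * (of_bool (fst (snd x) j \<le> t / T) - t / T))"

lemma sample_process_sample: "t \<in> {0..T} \<Longrightarrow> sample_process t (sample x) = tilted_limit t x"
  using scaled_time[of t] by (simp add: sample_process_def sample_def tilted_limit_def)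

lemma sample_jump_measurable:
  "(\<lambda>x. snd (snd (fst x)) j * (of_bool (fst (snd x) j \<le> s) - s)) \<in> borel_measurable sample_law"
proof -
  have [measurable]: "(\<lambda>x. fst (snd x) j) \<in> borel_measurable sample_law"
    using measurable_compose[OF sample_U_measurable measurable_component_singleton[of j]] by simp
  have [measurable]: "(\<lambda>x. snd (snd (fst x)) j) \<in> borel_measurable sample_law"
    unfolding measurable_sample_law by measurable
  show ?thesis unfolding of_bool_def by measurable
qed

lemma sample_process_measurable:
  assumes t: "t \<in> {0..T}"
  shows "sample_process t \<in> borel_measurable sample_law"
proof -
  have [measurable]: "(\<lambda>x. snd (snd x) (t / T)) \<in> borel_measurable sample_law"
    using measurable_compose[OF sample_path_measurable measurable_component_singleton[OF scaled_time[OF t]]] .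
  have [measurable]: "(\<lambda>x. fst (fst x)) \<in> borel_measurable sample_law" "(\<lambda>x. fst (snd (fst x))) \<in> borel_measurable sample_law"
    unfolding measurable_sample_law by measurable
  note [measurable] = sample_jump_measurable
  show ?thesis unfolding sample_process_def[abs_def] by measurable
qed

lemma sample_ei_series:
  "ei_series sample_law T (\<lambda>x. fst (fst x)) (\<lambda>x. fst (snd (fst x))) (\<lambda>j x. snd (snd (fst x)) j)
     (\<lambda>t x. snd (snd x) t) (\<lambda>i x. fst (snd x) i) sample_process"
  unfolding ei_series_def
proof (intro ballI conjI sample_process_measurable)
  fix t assume t: "t \<in> {0..T}"
  let ?c = "\<lambda>x j. snd (snd (fst x)) j * (of_bool (fst (snd x) j \<le> t / T) - t / T)"
  have S: "{x\<in>space sample_law. summable (?c x)} \<in> sets sample_law"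
    by (rule sets_Collect_summable) (rule sample_jump_measurable)
  have "AE x in sample_law. summable (?c x)"
    unfolding sample_law_def
  proof (subst AE_distr_iff)
    show "AE x in joint. summable (?c (sample x))"
      using AE_summable_thinned_jumps[OF scaled_time[OF t]] by eventually_elim (simp add: sample_def)
    show "{x \<in> space sample_space. summable (?c x)}
      \<in> sets sample_space"
      using S by (simp add: sample_law_def)
  qed simp
  then show "AE x in sample_law. ?c x sums (sample_process t x - (fst (fst x) * (t / T) + fst (snd (fst x)) * snd (snd x) (t / T)))"
    by eventually_elim (simp add: sample_process_def summable_sums)
qed

lemma sample_char_law: "distr sample_law char_space fst = distr N char_space characteristics"
proof -
  have "distr sample_law char_space fst = distr joint char_space (\<lambda>x. characteristics (fst x))"
    by (subst distr_sample_law[OF sample_fst_measurable]) (simp add: sample_def)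
  also have "\<dots> = distr (distr joint N fst) char_space characteristics"
    by (subst distr_distr) (auto simp: o_def)
  finally show ?thesis unfolding distr_pair_fst .
qed

lemma sample_path_law: "path_law sample_law T sample_process = path_law joint T tilted_limit"
proof -
  have "(\<lambda>x. \<lambda>t\<in>{0..T}. sample_process t x) \<in> measurable sample_law (PiM {0..T} (\<lambda>_. borel))"
    by (rule measurable_restrict) (rule sample_process_measurable)
  then show ?thesis
    unfolding path_law_def by (subst distr_sample_law) (auto intro!: distr_cong simp: sample_process_sample restrict_def)
qed

section \<open>The law of the tilted process\<close>

abbreviation "mgf_T \<equiv> \<integral>w. exp (\<theta> * X T w) \<partial>M"

lemma mgf_T_pos: "0 < mgf_T"
proof -
  have T01: "T \<in> {0..1}" using jumps.T by auto
  have "0 < (\<Prod>j. tilt_factor T \<theta> (\<beta> j))"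
    using tilt_factor_prod_le[OF square_summable T01 finite.emptyI, of \<theta>] by simp
  then show ?thesis unfolding X_exp(3)[OF T01] by simp
qed

text \<open>
  The tilting density on all of \<open>M\<close>. The measure \<open>tilted_measure M X T \<theta>\<close> is its restriction to the past,
  which carries the law of the path up to \<open>T\<close>.
\<close>

definition tilted :: "'a measure" where
  "tilted = density M (\<lambda>w. ennreal (exp (\<theta> * X T w) / mgf_T))"

lemma X_le_T_measurable [measurable]: "t \<in> {0..T} \<Longrightarrow> X t \<in> borel_measurable M"
  using jumps.T by (intro X_measurable) auto

lemma X_T_measurable [measurable]: "X T \<in> borel_measurable M"
  using jumps.T by (intro X_measurable) auto

lemma exp_X_T_integrable: "integrable M (\<lambda>w. exp (\<theta> * X T w))"
  using jumps.T by (intro X_exp(1)) auto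

lemma prob_space_tilted: "prob_space tilted"
proof (rule prob_spaceI)
  have "emeasure tilted (space tilted) = (\<integral>\<^sup>+w. ennreal (exp (\<theta> * X T w) / mgf_T) \<partial>M)"
    unfolding tilted_def by (simp add: emeasure_density)
  also have "\<dots> = ennreal (\<integral>w. exp (\<theta> * X T w) / mgf_T \<partial>M)"
    using mgf_T_pos exp_X_T_integrable by (intro nn_integral_eq_integral) auto
  also have "\<dots> = 1" using mgf_T_pos by simp
  finally show "emeasure tilted (space tilted) = 1" .
qed

lemma emeasure_tilted:
  assumes A: "A \<in> sets M"
  shows "emeasure tilted A = ennreal ((\<integral>w. indicator A w * exp (\<theta> * X T w) \<partial>M) / mgf_T)"
proof -
  have "emeasure tilted A = (\<integral>\<^sup>+w. ennreal (exp (\<theta> * X T w) / mgf_T) * indicator A w \<partial>M)"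
    unfolding tilted_def using A by (simp add: emeasure_density)
  also have "\<dots> = (\<integral>\<^sup>+w. ennreal (indicator A w * exp (\<theta> * X T w) / mgf_T) \<partial>M)"
    by (intro nn_integral_cong) (auto simp: indicator_def)
  also have "\<dots> = ennreal (\<integral>w. indicator A w * exp (\<theta> * X T w) / mgf_T \<partial>M)"
    using mgf_T_pos integrable_real_mult_indicator[OF A exp_X_T_integrable]
    by (intro nn_integral_eq_integral integrable_divide) (auto simp: mult.commute)
  finally show ?thesis by simp
qed

definition past_space :: "'a measure" where
  "past_space = sigma (space M) {X s -` A \<inter> space M | s A. s \<in> {0..T} \<and> A \<in> sets borel}"

lemma sets_past_space: "sets past_space = past M X T"
  unfolding past_space_def past_def by (rule sets_measure_of) auto

lemma past_subalgebra: "subalgebra tilted past_space"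
  unfolding subalgebra_def
proof
  show "space past_space = space tilted" by (simp add: past_space_def tilted_def space_measure_of_conv)
  have "past M X T \<subseteq> sets M"
    unfolding past_def by (rule sets.sigma_sets_subset) (auto intro!: measurable_sets X_le_T_measurable)
  then show "sets past_space \<subseteq> sets tilted" by (simp add: sets_past_space tilted_def)
qed

lemma tilted_measure_eq: "tilted_measure M X T \<theta> = restr_to_subalg tilted past_space"
  unfolding tilted_measure_def restr_to_subalg_def sets_past_space
proof (subst space_density[symmetric, of M "\<lambda>w. ennreal (exp (\<theta> * X T w) / mgf_T)", folded tilted_def], rule measure_of_eq)
  show "past M X T \<subseteq> Pow (space tilted)"
    using past_subalgebra sets.space_closed[of past_space] by (auto simp: subalgebra_def sets_past_space)
  fix A assume "A \<in> sigma_sets (space tilted) (past M X T)"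
  then have "A \<in> past M X T"
    using past_subalgebra sets.sigma_sets_eq[of past_space] by (simp add: subalgebra_def sets_past_space)
  then have "A \<in> sets M"
    using past_subalgebra by (auto simp: subalgebra_def sets_past_space tilted_def)
  then show "ennreal ((\<integral>w. indicator A w * exp (\<theta> * X T w) \<partial>M) / mgf_T) = emeasure tilted A"
    by (rule emeasure_tilted[symmetric])
qed

lemma path_law_tilted_measure: "path_law (tilted_measure M X T \<theta>) T X = path_law tilted T X"
  unfolding path_law_def tilted_measure_eq
proof (rule measure_eqI)
  let ?R = "restr_to_subalg tilted past_space" and ?P = "PiM {0..T} (\<lambda>_. borel :: real measure)"
  let ?X = "\<lambda>w. \<lambda>t\<in>{0..T}. X t w"
  have X: "X t \<in> borel_measurable past_space" if "t \<in> {0..T}" for t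
  proof (rule measurableI)
    fix A :: "real set" assume "A \<in> sets borel"
    then show "X t -` A \<inter> space past_space \<in> sets past_space"
      unfolding sets_past_space past_def using that by (intro sigma_sets.Basic) (auto simp: past_space_def space_measure_of_conv)
  qed simp
  then have XP: "?X \<in> measurable past_space ?P" by (rule measurable_restrict)
  then have XR: "?X \<in> measurable ?R ?P" by (rule measurable_in_subalg[OF past_subalgebra])
  have XT: "?X \<in> measurable tilted ?P" unfolding tilted_def by (rule measurable_restrict) simp
  fix E assume "E \<in> sets (distr ?R ?P ?X)"
  then have E: "E \<in> sets ?P" by simp
  have sp: "space past_space = space tilted" using past_subalgebra by (simp add: subalgebra_def)
  show "emeasure (distr ?R ?P ?X) E = emeasure (distr tilted ?P ?X) E"
    using emeasure_restr_to_subalg[OF past_subalgebra measurable_sets[OF XP E]]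
    unfolding emeasure_distr[OF XR E] emeasure_distr[OF XT E] space_restr_to_subalg sp .
qed simp

lemma path_law_tilted: "path_law tilted T X = path_law joint T tilted_limit"
  unfolding path_law_def
proof (rule process_law_eq_of_char_eq[OF prob_space_tilted P.prob_space_axioms])
  show "X t \<in> borel_measurable tilted" if "t \<in> {0..T}" for t
    using that unfolding tilted_def by simp
  show "tilted_limit t \<in> borel_measurable joint" if "t \<in> {0..T}" for t
    using that by (rule tilted_limit_measurable)
  fix F u assume F: "finite F" "F \<subseteq> {0..T}"
  have [measurable]: "(\<lambda>w. \<Sum>t\<in>F. u t * X t w) \<in> borel_measurable M"
    using F by (intro borel_measurable_lincomb X_le_T_measurable) auto
  have "(\<integral>w. iexp (\<Sum>t\<in>F. u t * X t w) \<partial>tilted) = (\<integral>w. (exp (\<theta> * X T w) / mgf_T) *\<^sub>R iexp (\<Sum>t\<in>F. u t * X t w) \<partial>M)"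
  proof -
    have "(\<lambda>w. iexp (\<Sum>t\<in>F. u t * X t w)) \<in> borel_measurable M" by measurable
    then show ?thesis unfolding tilted_def using mgf_T_pos by (intro integral_density) auto
  qed
  also have "\<dots> = (\<integral>w. (1 / mgf_T) *\<^sub>R (exp (\<theta> * X T w) *\<^sub>R iexp (\<Sum>t\<in>F. u t * X t w)) \<partial>M)"
    by (simp only: scaleR_scaleR times_divide_eq_left mult_1_left)
  also have "\<dots> = (1 / mgf_T) *\<^sub>R (\<integral>w. exp (\<theta> * X T w) *\<^sub>R iexp (\<Sum>t\<in>F. u t * X t w) \<partial>M)"
    by (rule integral_scaleR_right)
  also have "\<dots> = (\<integral>x. iexp (\<Sum>t\<in>F. u t * tilted_limit t x) \<partial>joint)"
    unfolding tilted_char_eq[OF F] using mgf_T_pos by (simp add: scaleR_conv_of_real)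
  finally show "(\<integral>w. iexp (\<Sum>t\<in>F. u t * X t w) \<partial>tilted) = (\<integral>x. iexp (\<Sum>t\<in>F. u t * tilted_limit t x) \<partial>joint)" .
qed

lemma tilted_ei_process: "ei_process (tilted_measure M X T \<theta>) T X (distr N char_space characteristics)"
  unfolding ei_process_def
proof (intro exI conjI)
  show "prob_space sample_law" by (rule prob_space_sample_law)
  show "bridge_and_uniforms sample_law (\<lambda>t x. snd (snd x) t) (\<lambda>i x. fst (snd x) i)"
    by (rule sample_bridge_and_uniforms)
  show "ei_series sample_law T (\<lambda>x. fst (fst x)) (\<lambda>x. fst (snd (fst x))) (\<lambda>j x. snd (snd (fst x)) j)
     (\<lambda>t x. snd (snd x) t) (\<lambda>i x. fst (snd x) i) sample_process"
    by (rule sample_ei_series)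
  show "indep_rvs sample_law char_space (\<lambda>x. (fst (fst x), fst (snd (fst x)), \<lambda>j. snd (snd (fst x)) j))
          (PiM {0..1} (\<lambda>_. borel) \<Otimes>\<^sub>M PiM UNIV (\<lambda>_. borel)) (\<lambda>x. (\<lambda>t\<in>{0..1}. snd (snd x) t, \<lambda>i. fst (snd x) i))"
    using sample_indep by simp
  show "distr sample_law char_space (\<lambda>x. (fst (fst x), fst (snd (fst x)), \<lambda>j. snd (snd (fst x)) j)) = distr N char_space characteristics"
    using sample_char_law by simp
  show "path_law (tilted_measure M X T \<theta>) T X = path_law sample_law T sample_process"
    unfolding path_law_tilted_measure path_law_tilted sample_path_law ..
qed

end

context extremal_ei
begin

text \<open>
  The Gaussian factor and the product of the jump factors are both at least 1. One of them tends to
  infinity: the first if \<open>0 < \<sigma>\<close>, the second if some \<open>\<beta> i\<close> is nonzero, because it dominates its single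
  factor at \<open>i\<close>.
\<close>

lemma X_exp_at_top:
  assumes "\<alpha> = 0" and nontriv: "0 < \<sigma> \<or> (\<exists>i. \<beta> i \<noteq> 0)" and t: "t \<in> {0<..<1}"
  shows "filterlim (\<lambda>\<theta>. \<integral>w. exp (\<theta> * X t w) \<partial>M) at_top at_top"
proof -
  have t01: "t \<in> {0..1}" using t by auto
  define P where "P = (\<lambda>\<theta>. \<Prod>j. tilt_factor t \<theta> (\<beta> j))"
  define E where "E = (\<lambda>\<theta>. exp (\<theta>\<^sup>2 * \<sigma>\<^sup>2 * t * (1 - t) / 2))"
  have mgf: "(\<integral>w. exp (\<theta> * X t w) \<partial>M) = E \<theta> * P \<theta>" for \<theta>
    using assms(1) by (simp add: X_exp(3)[OF t01] E_def P_def)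
  have P1: "1 \<le> P \<theta>" for \<theta>
    using tilt_factor_prod_le[OF square_summable t01 finite.emptyI, of \<theta>] by (simp add: P_def)
  have E1: "1 \<le> E \<theta>" for \<theta> using t by (auto simp: E_def)
  from nontriv show ?thesis
  proof
    assume \<sigma>: "0 < \<sigma>"
    have "filterlim E at_top at_top"
      unfolding E_def
    proof (rule filterlim_compose[OF exp_at_top])
      have "0 < \<sigma>\<^sup>2 * t * (1 - t) / 2" using \<sigma> t by simp
      then have "filterlim (\<lambda>\<theta>. (\<sigma>\<^sup>2 * t * (1 - t) / 2) * \<theta>\<^sup>2) at_top at_top"
        by (intro filterlim_tendsto_pos_mult_at_top[OF tendsto_const] filterlim_pow_at_top filterlim_ident) auto
      then show "filterlim (\<lambda>\<theta>. \<theta>\<^sup>2 * \<sigma>\<^sup>2 * t * (1 - t) / 2) at_top at_top" by (simp add: mult_ac)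
    qed
    then show ?thesis
    proof (rule filterlim_at_top_mono, intro always_eventually allI)
      show "E \<theta> \<le> (\<integral>w. exp (\<theta> * X t w) \<partial>M)" for \<theta>
        unfolding mgf using mult_left_mono[OF P1[of \<theta>], of "E \<theta>"] E1[of \<theta>] by simp
    qed
  next
    assume "\<exists>i. \<beta> i \<noteq> 0"
    then obtain i where i: "\<beta> i \<noteq> 0" by blast
    have "filterlim (\<lambda>\<theta>. tilt_factor t \<theta> (\<beta> i)) at_top at_top"
      using t i by (intro tilt_factor_at_top) auto
    then show ?thesis
    proof (rule filterlim_at_top_mono, intro always_eventually allI)
      fix \<theta>
      have "tilt_factor t \<theta> (\<beta> i) \<le> P \<theta>"
        using tilt_factor_prod_le[OF square_summable t01, of "{i}" \<theta>] by (simp add: P_def)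
      also have "\<dots> \<le> E \<theta> * P \<theta>" using mult_right_mono[OF E1[of \<theta>], of "P \<theta>"] P1[of \<theta>] by simp
      finally show "tilt_factor t \<theta> (\<beta> i) \<le> (\<integral>w. exp (\<theta> * X t w) \<partial>M)" unfolding mgf .
    qed
  qed
qed

end

theorem proposition8:
  fixes M :: "'a measure" and X :: "real \<Rightarrow> 'a \<Rightarrow> real"
    and \<alpha> \<sigma> :: real and \<beta> :: "nat \<Rightarrow> real"
  assumes "prob_space M"
    and "extremal_ei_process M \<alpha> \<sigma> \<beta> X"
  shows "(\<forall>t\<in>{0..1}. \<forall>\<theta>::real.
            integrable M (\<lambda>\<omega>. exp (\<theta> * X t \<omega>)) \<and>
            convergent_prod (\<lambda>j. exp (- \<theta> * \<beta> j * t) * (1 - t) + exp (\<theta> * \<beta> j * (1 - t)) * t) \<and>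
            (\<integral>\<omega>. exp (\<theta> * X t \<omega>) \<partial>M) =
              exp (\<alpha> * \<theta> * t + \<theta>\<^sup>2 * \<sigma>\<^sup>2 * t * (1 - t) / 2) *
              (\<Prod>j. exp (- \<theta> * \<beta> j * t) * (1 - t) + exp (\<theta> * \<beta> j * (1 - t)) * t))
       \<and>
         (\<forall>T (\<theta>::real) (N::'b measure) B Z.
            0 < T \<and> T < 1 \<and>
            prob_space N \<and>
            prob_space.indep_vars N (\<lambda>_. count_space UNIV) B UNIV \<and>
            (\<forall>j. distr N (count_space UNIV) (B j) =
                   measure_pmf (bernoulli_pmf (tilted_success_prob T \<theta> (\<beta> j)))) \<and>
            distributed N lborel Z (\<lambda>x. ennreal (std_normal_density x)) \<and>
            indep_rvs N borel Z
              (PiM UNIV (\<lambda>_. count_space UNIV)) (\<lambda>\<omega> j. B j \<omega>)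
            \<longrightarrow>
              (AE \<omega> in N. summable (\<lambda>j. \<beta> j * (of_bool (B j \<omega>) - T))) \<and>
              integrable N (\<lambda>\<omega>. \<Sum>j. \<beta> j * (of_bool (B j \<omega>) - T)) \<and>
              (\<lambda>n. \<integral>\<omega>. \<bar>(\<Sum>j<n. \<beta> j * (of_bool (B j \<omega>) - T))
                        - (\<Sum>j. \<beta> j * (of_bool (B j \<omega>) - T))\<bar> \<partial>N) \<longlonglongrightarrow> 0 \<and>
              ei_process (tilted_measure M X T \<theta>) T X
                (distr N char_space
                  (\<lambda>\<omega>. (tilted_drift \<alpha> \<sigma> \<beta> T \<theta> B Z \<omega>, \<sigma> * sqrt T, \<lambda>j. \<beta> j * of_bool (B j \<omega>)))))
       \<and>
         (\<alpha> = 0 \<and> (0 < \<sigma> \<or> infinite {i. \<beta> i \<noteq> 0}) \<longrightarrow>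
            (\<forall>t\<in>{0<..<1}. filterlim (\<lambda>l. \<integral>\<omega>. exp (l * X t \<omega>) \<partial>M) at_top at_top))"
proof -
  interpret prob_space M by fact
  obtain b U where bU: "bridge_and_uniforms M b U" and sq: "summable (\<lambda>i. (\<beta> i)\<^sup>2)"
    and series: "ei_series M 1 (\<lambda>_. \<alpha>) (\<lambda>_. \<sigma>) (\<lambda>i _. \<beta> i) b U X"
    using assms(2) by (auto simp: extremal_ei_process_def)
  interpret extremal_ei M b U \<alpha> \<sigma> \<beta> X by unfold_locales (fact bU sq series)+
  show ?thesis
  proof (intro conjI ballI allI impI)
    fix t \<theta> :: real assume t: "t \<in> {0..1}"
    show "integrable M (\<lambda>\<omega>. exp (\<theta> * X t \<omega>))" by (rule X_exp(1)[OF t])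
    show "convergent_prod (\<lambda>j. exp (- \<theta> * \<beta> j * t) * (1 - t) + exp (\<theta> * \<beta> j * (1 - t)) * t)"
      using tilt_factor_convergent_prod[OF sq t, of \<theta>] unfolding tilt_factor_def .
    show "(\<integral>\<omega>. exp (\<theta> * X t \<omega>) \<partial>M) =
              exp (\<alpha> * \<theta> * t + \<theta>\<^sup>2 * \<sigma>\<^sup>2 * t * (1 - t) / 2) *
              (\<Prod>j. exp (- \<theta> * \<beta> j * t) * (1 - t) + exp (\<theta> * \<beta> j * (1 - t)) * t)"
      using X_exp(3)[OF t, of \<theta>] unfolding tilt_factor_def .
  next
    fix T \<theta> and N :: "'b measure" and B Z
    assume *: "0 < T \<and> T < 1 \<and>
            prob_space N \<and>
            prob_space.indep_vars N (\<lambda>_. count_space UNIV) B UNIV \<and>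
            (\<forall>j. distr N (count_space UNIV) (B j) =
                   measure_pmf (bernoulli_pmf (tilted_success_prob T \<theta> (\<beta> j)))) \<and>
            distributed N lborel Z (\<lambda>x. ennreal (std_normal_density x)) \<and>
            indep_rvs N borel Z
              (PiM UNIV (\<lambda>_. count_space UNIV)) (\<lambda>\<omega> j. B j \<omega>)"
    then interpret N: prob_space N by simp
    interpret tilted_coupling M b U \<alpha> \<sigma> \<beta> X N B T \<theta> Z
      by unfold_locales (use * sq in auto)
    show "AE \<omega> in N. summable (\<lambda>j. \<beta> j * (of_bool (B j \<omega>) - T))"
      "integrable N (\<lambda>\<omega>. \<Sum>j. \<beta> j * (of_bool (B j \<omega>) - T))"
      "(\<lambda>n. \<integral>\<omega>. \<bar>(\<Sum>j<n. \<beta> j * (of_bool (B j \<omega>) - T))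
                        - (\<Sum>j. \<beta> j * (of_bool (B j \<omega>) - T))\<bar> \<partial>N) \<longlonglongrightarrow> 0"
      by (rule jumps.drift_series)+
    show "ei_process (tilted_measure M X T \<theta>) T X
                (distr N char_space
                  (\<lambda>\<omega>. (tilted_drift \<alpha> \<sigma> \<beta> T \<theta> B Z \<omega>, \<sigma> * sqrt T, \<lambda>j. \<beta> j * of_bool (B j \<omega>))))"
      by (rule tilted_ei_process)
  next
    fix t :: real
    assume *: "\<alpha> = 0 \<and> (0 < \<sigma> \<or> infinite {i. \<beta> i \<noteq> 0})" and t: "t \<in> {0<..<1}"
    have "{i. \<beta> i \<noteq> 0} \<noteq> {}" if "infinite {i. \<beta> i \<noteq> 0}" using that by (metis finite.emptyI)
    with * have "0 < \<sigma> \<or> (\<exists>i. \<beta> i \<noteq> 0)" by auto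
    with * t show "filterlim (\<lambda>l. \<integral>\<omega>. exp (l * X t \<omega>) \<partial>M) at_top at_top"
      by (intro X_exp_at_top) auto
  qed
qed

end
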